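(* Let $\mathfrak n$ be a $7$-dimensional nilpotent Lie algebra whose dual has a basis $\{e^1,\dots,e^7\}$ with $de^1=de^2=de^3=de^4=0$ and $$de^5=\delta\sigma_1^++\epsilon_1\sigma_1^-,\qquad de^6=\delta\sigma_2^++\epsilon_2\sigma_2^-,\qquad de^7=\delta\sigma_3^++\epsilon_3\sigma_3^-,$$ with $\delta,\epsilon_1,\epsilon_2,\epsilon_3\in\mathbb R$ and $\delta\neq0$. Consider on $\mathfrak n$ the $\mathrm G_2$-structure $$\varphi=\sigma_1^+\wedge e^5-\sigma_2^+\wedge e^6-\sigma_3^+\wedge e^7+e^{567}$$ together with the connection $A=Y_5e^5+Y_6e^6+Y_7e^7$ with gauge group $G=\mathrm{SL}(2,\mathbb R)$, where $\{Y_5,Y_6,Y_7\}$ is a basis of $\mathfrak{sl}(2,\mathbb R)$ with $$[Y_6,Y_7]=-2\delta Y_5,\quad [Y_7,Y_5]=2\delta Y_6,\quad [Y_5,Y_6]=2\delta Y_7.$$ Then $\varphi$ defines a co-closed $\mathrm G_2$-structure (with $\tau_0\neq0$) and $A$ is a $\mathrm G_2$-instanton with respect to $\varphi$. Additionally, there exists another $\mathrm G_2$-instanton $\xi$ on a principal $\mathrm U(1)$-bundle, so that the product connection $\hat A=\xi\oplus A$ on the $\mathrm U(1)\times\mathrm{SL}(2,\mathbb R)$-bundle solves the heterotic Bianchi identity $dT_\varphi=\langle F_{\hat A}\wedge F_{\hat A}\rangle$ for a suitable $\mathrm{ad}$-invariant pairing $\langle\cdot,\cdot\rangle$ on $\mathfrak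 u(1)\oplus\mathfrak{sl}(2,\mathbb R)$.
   Context: Write $e^{ij}=e^i\wedge e^j$, etc., and $\sigma_1^+=e^{13}-e^{24}$, $\sigma_2^+=-e^{14}-e^{23}$, $\sigma_3^+=e^{12}+e^{34}$; $\sigma_1^-=e^{13}+e^{24}$, $\sigma_2^-=e^{14}-e^{23}$, $\sigma_3^-=e^{12}-e^{34}$. All forms are viewed as left-invariant forms on the simply connected Lie group $N$ with Lie algebra $\mathfrak n$; $A$ is a connection on the trivial $\mathrm{SL}(2,\mathbb R)$-bundle over $N$, the $\mathrm U(1)$-bundle is also over $N$, and curvature is $F_A=dA+\frac12[A\wedge A]$. A $\mathrm G_2$-structure $\varphi$ determines $g_\varphi,\mathrm{vol}_\varphi$ by $6g_\varphi(X,Y)\mathrm{vol}_\varphi=(X\lrcorner\varphi)\wedge(Y\lrcorner\varphi)\wedge\varphi$, and Hodge star $\star$. Put $\psi=\star\varphi$, $\tau_0=\frac17\star(d\varphi\wedge\varphi)$, $\tau_1=\frac1{12}\star(\varphi\wedge\star d\varphi)$, $T_\varphi=\frac16\star(d\varphi\wedge\varphi)\varphi-\star d\varphi+\star(4\tau_1\wedge\varphi)$. $\varphi$ is co-closed if $d\psi=0$; a connection with curvature $F$ is a $\mathrm G_2$-instanton if $F\wedge\psi=0$. A pairing means a non-degenerate symmetric bilinear form. *)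

theory Defs
  imports "HOL-Analysis.Analysis"
begin

text \<open>
  A form on a vector space is a function on lists of vectors; a \<open>k\<close>-form vanishes on all lists
  whose length is not \<open>k\<close>. The values may lie in an arbitrary real vector space.
\<close>

type_synonym ('a, 'b) form = "'a list \<Rightarrow> 'b"

definition alternating_form :: "nat \<Rightarrow> ('a::real_vector, 'b::real_vector) form \<Rightarrow> bool" where
  "alternating_form k \<omega> \<longleftrightarrow>
     (\<forall>vs. length vs \<noteq> k \<longrightarrow> \<omega> vs = 0) \<and>
     (\<forall>vs i. length vs = k \<and> i < k \<longrightarrow> linear (\<lambda>v. \<omega> (vs[i := v]))) \<and>
     (\<forall>vs. length vs = k \<and> \<not> distinct vs \<longrightarrow> \<omega> vs = 0)"

text \<open>
  The wedge product, with coefficients multiplied by \<open>b\<close>, as a sum over shuffles: \<open>S\<close> is the set of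
  positions fed to the first factor and the exponent counts the inversions of the shuffle. There is
  no factorial normalisation, so \<open>(\<alpha> \<wedge> \<beta>)(v, w) = \<alpha>(v) \<beta>(w) - \<alpha>(w) \<beta>(v)\<close> for 1-forms.
\<close>

definition wedge_by ::
    "('b \<Rightarrow> 'c \<Rightarrow> 'd::real_vector) \<Rightarrow> ('a, 'b) form \<Rightarrow> ('a, 'c) form \<Rightarrow> ('a, 'd) form" where
  "wedge_by b \<alpha> \<beta> = (\<lambda>vs. \<Sum>S\<in>Pow {..<length vs}.
     (- 1) ^ card {(i, j). i \<in> S \<and> j \<in> {..<length vs} - S \<and> j < i} *\<^sub>R
       b (\<alpha> (nths vs S)) (\<beta> (nths vs (- S))))"

abbreviation wedge :: "('a, real) form \<Rightarrow> ('a, real) form \<Rightarrow> ('a, real) form" where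
  "wedge \<equiv> wedge_by (*)"

definition interior_product :: "'a \<Rightarrow> ('a, 'b) form \<Rightarrow> ('a, 'b) form" where
  "interior_product X \<omega> = (\<lambda>vs. \<omega> (X # vs))"

definition oneform :: "('a::real_normed_vector \<Rightarrow>\<^sub>L real) \<Rightarrow> ('a, real) form" where
  "oneform \<alpha> = (\<lambda>vs. if length vs = 1 then blinfun_apply \<alpha> (vs ! 0) else 0)"

text \<open>\<open>ew e [i, j, \<dots>]\<close> is \<open>e\<^sup>i \<wedge> e\<^sup>j \<wedge> \<dots>\<close>, the empty product being the 0-form 1.\<close>

primrec ew :: "(nat \<Rightarrow> ('a::real_normed_vector \<Rightarrow>\<^sub>L real)) \<Rightarrow> nat list \<Rightarrow> ('a, real) form" where
  "ew e [] = (\<lambda>vs. if vs = [] then 1 else 0)"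
| "ew e (i # is) = wedge (oneform (e i)) (ew e is)"

definition dual_basis :: "(nat \<Rightarrow> ('a::euclidean_space \<Rightarrow>\<^sub>L real)) \<Rightarrow> nat \<Rightarrow> bool" where
  "dual_basis e n \<longleftrightarrow>
     inj_on e {1..n} \<and> independent (e ` {1..n}) \<and> span (e ` {1..n}) = UNIV"

text \<open>Membership in the orbit of the standard 3-form under the general linear group.\<close>

definition g2_form :: "('a::euclidean_space, real) form \<Rightarrow> bool" where
  "g2_form \<phi> \<longleftrightarrow> (\<exists>f. dual_basis f 7 \<and>
     \<phi> = (\<lambda>vs. ew f [1,2,3] vs + ew f [1,4,5] vs + ew f [1,6,7] vs + ew f [2,4,6] vs
                - ew f [2,5,7] vs - ew f [3,4,7] vs - ew f [3,5,6] vs))"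

definition inner_product :: "('a::real_vector \<Rightarrow> 'a \<Rightarrow> real) \<Rightarrow> bool" where
  "inner_product g \<longleftrightarrow> bilinear g \<and> (\<forall>x y. g x y = g y x) \<and> (\<forall>x. x \<noteq> 0 \<longrightarrow> g x x > 0)"

definition orthonormal_frame :: "('a::euclidean_space \<Rightarrow> 'a \<Rightarrow> real) \<Rightarrow> 'a list \<Rightarrow> bool" where
  "orthonormal_frame g E \<longleftrightarrow> length E = DIM('a) \<and>
     (\<forall>i<length E. \<forall>j<length E. g (E ! i) (E ! j) = (if i = j then 1 else 0))"

text \<open>
  The last clause of the next definition is \<open>6 g(X, Y) vol = (X \<lrcorner> \<phi>) \<wedge> (Y \<lrcorner> \<phi>) \<wedge> \<phi>\<close>; the third one says
  that \<open>vol\<close> is one of the two volume forms of \<open>g\<close>. For a \<open>g2_form\<close> they pin down both \<open>g\<close> and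
  \<open>vol\<close>, hence also the orientation.
\<close>

definition g2_metric_vol ::
    "('a::euclidean_space, real) form \<Rightarrow> ('a \<Rightarrow> 'a \<Rightarrow> real) \<Rightarrow> ('a, real) form \<Rightarrow> bool" where
  "g2_metric_vol \<phi> g vol \<longleftrightarrow>
     inner_product g \<and> alternating_form 7 vol \<and>
     (\<forall>E. orthonormal_frame g E \<longrightarrow> \<bar>vol E\<bar> = 1) \<and>
     (\<forall>X Y vs. 6 * g X Y * vol vs =
        wedge (wedge (interior_product X \<phi>) (interior_product Y \<phi>)) \<phi> vs)"

definition g2_metric :: "('a::euclidean_space, real) form \<Rightarrow> 'a \<Rightarrow> 'a \<Rightarrow> real" where
  "g2_metric \<phi> = (THE g. \<exists>vol. g2_metric_vol \<phi> g vol)"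

definition g2_vol :: "('a::euclidean_space, real) form \<Rightarrow> ('a, real) form" where
  "g2_vol \<phi> = (THE vol. \<exists>g. g2_metric_vol \<phi> g vol)"

text \<open>
  The Hodge star. From \<open>\<alpha> \<wedge> \<star>\<beta> = \<langle>\<alpha>, \<beta>\<rangle> vol\<close> one gets \<open>\<star>\<beta> = \<Sum>\<^sub>I \<beta>(E\<^sub>I) (E\<^sub>I \<lrcorner> vol)\<close>, where \<open>E\<^sub>I\<close> runs over
  the increasing tuples from an orthonormal frame \<open>E\<close>. The sum does not depend on \<open>E\<close>, which need
  not be oriented; for a \<open>k\<close>-form \<open>\<beta>\<close> only the \<open>S\<close> with \<open>k\<close> elements contribute.
\<close>

definition hodge ::
    "('a::euclidean_space \<Rightarrow> 'a \<Rightarrow> real) \<Rightarrow> ('a, real) form \<Rightarrow> ('a, real) form \<Rightarrow> ('a, real) form" where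
  "hodge g vol \<beta> = (let E = (SOME E. orthonormal_frame g E) in
     (\<lambda>vs. \<Sum>S\<in>Pow {..<length E}. \<beta> (nths E S) * vol (nths E S @ vs)))"

primrec C_k :: "nat \<Rightarrow> ('a::real_normed_vector \<Rightarrow> 'b::real_normed_vector) \<Rightarrow> bool" where
  "C_k 0 f = continuous_on UNIV f"
| "C_k (Suc k) f = ((\<forall>x. f differentiable (at x)) \<and>
     (\<forall>v. C_k k (\<lambda>x. frechet_derivative f (at x) v)))"

definition smooth :: "('a::real_normed_vector \<Rightarrow> 'b::real_normed_vector) \<Rightarrow> bool" where
  "smooth f \<longleftrightarrow> (\<forall>k. C_k k f)"

definition smooth_form ::
    "nat \<Rightarrow> ('a::euclidean_space \<Rightarrow> ('a, 'b::real_normed_vector) form) \<Rightarrow> bool" where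
  "smooth_form k \<omega> \<longleftrightarrow> (\<forall>x. alternating_form k (\<omega> x)) \<and> (\<forall>vs. smooth (\<lambda>x. \<omega> x vs))"

definition ext_d ::
    "('a::euclidean_space \<Rightarrow> ('a, 'b::real_normed_vector) form) \<Rightarrow> 'a \<Rightarrow> ('a, 'b) form" where
  "ext_d \<omega> x = (\<lambda>vs. \<Sum>i<length vs. (- 1) ^ i *\<^sub>R
     frechet_derivative (\<lambda>y. \<omega> y (take i vs @ drop (Suc i) vs)) (at x) (vs ! i))"

definition real_lie_algebra :: "('a::real_vector \<Rightarrow> 'a \<Rightarrow> 'a) \<Rightarrow> bool" where
  "real_lie_algebra br \<longleftrightarrow> bilinear br \<and> (\<forall>x. br x x = 0) \<and>
     (\<forall>x y z. br x (br y z) + br y (br z x) + br z (br x y) = 0)"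

primrec lower_central :: "('a::real_vector \<Rightarrow> 'a \<Rightarrow> 'a) \<Rightarrow> nat \<Rightarrow> 'a set" where
  "lower_central br 0 = UNIV"
| "lower_central br (Suc k) = span {br x y | x y. y \<in> lower_central br k}"

definition nilpotent_lie_algebra :: "('a::real_vector \<Rightarrow> 'a \<Rightarrow> 'a) \<Rightarrow> bool" where
  "nilpotent_lie_algebra br \<longleftrightarrow> real_lie_algebra br \<and> (\<exists>k. lower_central br k = {0})"

text \<open>The Chevalley--Eilenberg differential \<open>(d\<alpha>)(X, Y) = - \<alpha>([X, Y])\<close> on the dual.\<close>

definition lie_d ::
    "('a::real_normed_vector \<Rightarrow> 'a \<Rightarrow> 'a) \<Rightarrow> ('a \<Rightarrow>\<^sub>L real) \<Rightarrow> ('a, real) form" where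
  "lie_d br \<alpha> = (\<lambda>vs. if length vs = 2 then - blinfun_apply \<alpha> (br (vs ! 0) (vs ! 1)) else 0)"

text \<open>
  A simply connected nilpotent Lie group is diffeomorphic to its Lie algebra \<open>'a\<close> by the
  exponential map. So it is a smooth group structure on the manifold \<open>'a\<close> with identity \<open>0\<close>, and
  its Lie algebra is the tangent space \<open>'a\<close> at \<open>0\<close> with the bracket \<open>[V, W] = DW V - DV W\<close> of
  left-invariant vector fields.
\<close>

definition left_field :: "('a::euclidean_space \<Rightarrow> 'a \<Rightarrow> 'a) \<Rightarrow> 'a \<Rightarrow> 'a \<Rightarrow> 'a" where
  "left_field mul X = (\<lambda>x. frechet_derivative (mul x) (at 0) X)"

definition lie_group_with_algebra ::
    "('a::euclidean_space \<Rightarrow> 'a \<Rightarrow> 'a) \<Rightarrow> ('a \<Rightarrow> 'a \<Rightarrow> 'a) \<Rightarrow> ('a \<Rightarrow> 'a) \<Rightarrow> bool" where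
  "lie_group_with_algebra br mul iv \<longleftrightarrow>
     group mul 0 iv \<and> smooth (\<lambda>(x, y). mul x y) \<and> smooth iv \<and>
     (\<forall>X Y. br X Y =
        frechet_derivative (left_field mul Y) (at 0) (left_field mul X 0)
      - frechet_derivative (left_field mul X) (at 0) (left_field mul Y 0))"

text \<open>The left-invariant form with value \<open>\<omega>\<close> at \<open>0\<close>: its value at \<open>x\<close> is the pullback of \<open>\<omega>\<close> along left
  translation by the inverse of \<open>x\<close>.\<close>

definition left_invariant ::
    "('a::euclidean_space \<Rightarrow> 'a \<Rightarrow> 'a) \<Rightarrow> ('a \<Rightarrow> 'a) \<Rightarrow> ('a, 'b) form \<Rightarrow> 'a \<Rightarrow> ('a, 'b) form" where
  "left_invariant mul iv \<omega> x = (\<lambda>vs. \<omega> (map (frechet_derivative (mul (iv x)) (at x)) vs))"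

definition g2_structure :: "('a::euclidean_space \<Rightarrow> ('a, real) form) \<Rightarrow> bool" where
  "g2_structure \<phi> \<longleftrightarrow> smooth_form 3 \<phi> \<and> (\<forall>x. g2_form (\<phi> x))"

definition g2_star ::
    "('a::euclidean_space \<Rightarrow> ('a, real) form) \<Rightarrow> ('a \<Rightarrow> ('a, real) form) \<Rightarrow> 'a \<Rightarrow> ('a, real) form" where
  "g2_star \<phi> \<beta> x = hodge (g2_metric (\<phi> x)) (g2_vol (\<phi> x)) (\<beta> x)"

definition g2_psi :: "('a::euclidean_space \<Rightarrow> ('a, real) form) \<Rightarrow> 'a \<Rightarrow> ('a, real) form" where
  "g2_psi \<phi> = g2_star \<phi> \<phi>"

definition g2_coclosed :: "('a::euclidean_space \<Rightarrow> ('a, real) form) \<Rightarrow> bool" where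
  "g2_coclosed \<phi> \<longleftrightarrow> (\<forall>x vs. ext_d (g2_psi \<phi>) x vs = 0)"

text \<open>Evaluation at the empty list turns a 0-form into a function.\<close>

definition g2_tau0 :: "('a::euclidean_space \<Rightarrow> ('a, real) form) \<Rightarrow> 'a \<Rightarrow> real" where
  "g2_tau0 \<phi> x = 1 / 7 * g2_star \<phi> (\<lambda>y. wedge (ext_d \<phi> y) (\<phi> y)) x []"

definition g2_tau1 :: "('a::euclidean_space \<Rightarrow> ('a, real) form) \<Rightarrow> 'a \<Rightarrow> ('a, real) form" where
  "g2_tau1 \<phi> x = (\<lambda>vs. 1 / 12 *
     g2_star \<phi> (\<lambda>y. wedge (\<phi> y) (g2_star \<phi> (ext_d \<phi>) y)) x vs)"

definition g2_torsion :: "('a::euclidean_space \<Rightarrow> ('a, real) form) \<Rightarrow> 'a \<Rightarrow> ('a, real) form" where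
  "g2_torsion \<phi> x = (\<lambda>vs.
       1 / 6 * g2_star \<phi> (\<lambda>y. wedge (ext_d \<phi> y) (\<phi> y)) x [] * \<phi> x vs
     - g2_star \<phi> (ext_d \<phi>) x vs
     + g2_star \<phi> (\<lambda>y. wedge (\<lambda>us. 4 * g2_tau1 \<phi> y us) (\<phi> y)) x vs)"

text \<open>
  Every principal bundle over the contractible manifold \<open>'a\<close> is trivial, so a connection is a smooth
  1-form with values in the Lie algebra, here a subspace \<open>h\<close> of a normed space with bracket \<open>br\<close>.
\<close>

definition connection_form ::
    "'b set \<Rightarrow> ('a::euclidean_space \<Rightarrow> ('a, 'b::real_normed_vector) form) \<Rightarrow> bool" where
  "connection_form h A \<longleftrightarrow> smooth_form 1 A \<and> (\<forall>x vs. A x vs \<in> h)"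

definition curvature ::
    "('b \<Rightarrow> 'b \<Rightarrow> 'b::real_normed_vector) \<Rightarrow> ('a::euclidean_space \<Rightarrow> ('a, 'b) form) \<Rightarrow>
     'a \<Rightarrow> ('a, 'b) form" where
  "curvature br A x = (\<lambda>vs. ext_d A x vs + (1 / 2) *\<^sub>R wedge_by br (A x) (A x) vs)"

definition g2_instanton ::
    "'b set \<Rightarrow> ('b \<Rightarrow> 'b \<Rightarrow> 'b::real_normed_vector) \<Rightarrow> ('a::euclidean_space \<Rightarrow> ('a, real) form) \<Rightarrow>
     ('a \<Rightarrow> ('a, 'b) form) \<Rightarrow> bool" where
  "g2_instanton h br \<phi> A \<longleftrightarrow> connection_form h A \<and>
     (\<forall>x vs. wedge_by (\<lambda>F r. r *\<^sub>R F) (curvature br A x) (g2_psi \<phi> x) vs = 0)"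

definition sl2 :: "(real^2^2) set" where
  "sl2 = {M. trace M = 0}"

definition sl2_bracket :: "real^2^2 \<Rightarrow> real^2^2 \<Rightarrow> real^2^2" where
  "sl2_bracket M N = M ** N - N ** M"

definition u1 :: "complex set" where
  "u1 = {z. Re z = 0}"

definition u1_bracket :: "complex \<Rightarrow> complex \<Rightarrow> complex" where
  "u1_bracket z w = z * w - w * z"

definition u1_sl2_bracket :: "complex \<times> (real^2^2) \<Rightarrow> complex \<times> (real^2^2) \<Rightarrow> complex \<times> (real^2^2)" where
  "u1_sl2_bracket x y = (u1_bracket (fst x) (fst y), sl2_bracket (snd x) (snd y))"

definition product_connection ::
    "('a \<Rightarrow> ('a, 'b) form) \<Rightarrow> ('a \<Rightarrow> ('a, 'c) form) \<Rightarrow> 'a \<Rightarrow> ('a, 'b \<times> 'c) form" where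
  "product_connection \<xi> A x = (\<lambda>vs. (\<xi> x vs, A x vs))"

text \<open>
  Pairings on the subspace \<open>h\<close>. Only the values of \<open>B\<close> on \<open>h\<close> matter; asking for bilinearity on the
  ambient space is no restriction, since bilinear forms extend from a subspace.
\<close>

definition ad_invariant_pairing ::
    "'b set \<Rightarrow> ('b \<Rightarrow> 'b \<Rightarrow> 'b) \<Rightarrow> ('b::real_vector \<Rightarrow> 'b \<Rightarrow> real) \<Rightarrow> bool" where
  "ad_invariant_pairing h br B \<longleftrightarrow> bilinear B \<and>
     (\<forall>x\<in>h. \<forall>y\<in>h. B x y = B y x) \<and>
     (\<forall>x\<in>h. (\<forall>y\<in>h. B x y = 0) \<longrightarrow> x = 0) \<and>
     (\<forall>x\<in>h. \<forall>y\<in>h. \<forall>z\<in>h. B (br x y) z + B y (br x z) = 0)"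

definition sigma_plus ::
    "(nat \<Rightarrow> ('a::real_normed_vector \<Rightarrow>\<^sub>L real)) \<Rightarrow> nat \<Rightarrow> ('a, real) form" where
  "sigma_plus e i = (\<lambda>vs.
     if i = 1 then ew e [1,3] vs - ew e [2,4] vs
     else if i = 2 then - ew e [1,4] vs - ew e [2,3] vs
     else ew e [1,2] vs + ew e [3,4] vs)"

definition sigma_minus ::
    "(nat \<Rightarrow> ('a::real_normed_vector \<Rightarrow>\<^sub>L real)) \<Rightarrow> nat \<Rightarrow> ('a, real) form" where
  "sigma_minus e i = (\<lambda>vs.
     if i = 1 then ew e [1,3] vs + ew e [2,4] vs
     else if i = 2 then ew e [1,4] vs - ew e [2,3] vs
     else ew e [1,2] vs - ew e [3,4] vs)"

end

theory Submission
  imports Defs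
begin

text \<open>
  With \<open>\<theta>\<close> the Maurer--Cartan form, \<open>f\<^sub>i = e\<^sup>i \<circ> \<theta>\<close> is a moving coframe, orthonormal for \<open>\<phi>\<close>, whose differentials are
  linear combinations of the \<open>f\<^sub>j \<wedge> f\<^sub>k\<close> with constant coefficients. So all invariant forms
  are constant combinations of products of the \<open>f\<^sub>i\<close>, and \<open>\<wedge>\<close>, \<open>d\<close> and \<open>\<star>\<close> act on the coefficients; this gives \<open>d\<psi> = 0\<close>,
  \<open>\<tau>\<^sub>0 = - 4 \<delta> / 7\<close>, \<open>\<tau>\<^sub>1 = 0\<close> and \<open>F\<^sub>A \<wedge> \<psi> = 0\<close>. Every left-invariant instanton on a \<open>U(1)\<close>-bundle is flat, so \<open>\<xi>\<close> is not
  left-invariant: \<open>f\<^sub>1 = dx\<^sub>1\<close> and \<open>f\<^sub>2 = dx\<^sub>2\<close> by the Poincare lemma, and \<open>\<xi> = \<i> (x\<^sub>1 f\<^sub>3 + x\<^sub>2 f\<^sub>4)\<close> has the anti-self-dual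
  curvature \<open>\<i> \<sigma>\<^sub>1\<^sup>-\<close>. The pairing on \<open>sl(2)\<close> is the multiple of the trace form that matches the mixed terms
  of \<open>dT\<close>; the remaining multiple of \<open>e\<^sup>1\<^sup>2\<^sup>3\<^sup>4\<close> has a nonzero coefficient, which the pairing on \<open>u(1)\<close> absorbs.
\<close>

section \<open>Smooth maps\<close>

text \<open>Two notions cannot be computed as they stand: \<open>g2_metric\<close> and
  \<open>g2_vol\<close> are definite descriptions, and \<open>hodge\<close> sums over an arbitrarily
  chosen orthonormal frame. \<open>g2_metric_vol_unique\<close> and
  \<open>frame_sum_invariant\<close> remove this obstacle; afterwards the star is a signed
  complement of index lists.

  Why invariant abelian instantons are flat: an invariant connection has curvature a_5 de^5 + a_6
  de^6 + a_7 de^7 up to the factor i. Wedging with \<psi> sees only its self-dual part, whose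
  coefficients are \<delta> a_5, \<delta> a_6, \<delta> a_7, and \<delta> \<noteq> 0. The way out is
  a curvature that is invariant while its potential is not. The form sigma_1^- qualifies: it is
  closed because e^1, ..., e^4 are, and its square -2 e^1234 is not zero.

  The abelian factor is there because the ad-invariant pairings on sl(2) form a one-parameter
  family, and the terms of dT with two factors among e^5, e^6, e^7 already fix that
  parameter.\<close>

lemma C_k_Suc_has_derivative:
  assumes "C_k (Suc k) f"
  shows "(f has_derivative frechet_derivative f (at x)) (at x)"
  using assms frechet_derivative_works by auto

text \<open>\<open>C_k\<close> is stated with the term \<open>frechet_derivative\<close>; by
  uniqueness of derivatives any convenient formula may stand for it.\<close>

lemma C_k_SucI:
  assumes "\<And>x. (f has_derivative f' x) (at x)" "\<And>v. C_k k (\<lambda>x. f' x v)"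
  shows "C_k (Suc k) f"
proof -
  have "frechet_derivative f (at x) = f' x" for x
    using frechet_derivative_at[OF assms(1)] by simp
  with assms show ?thesis by (auto simp: differentiable_def)
qed

lemma C_k_lower: "C_k (Suc k) f \<Longrightarrow> C_k k f"
proof (induction k arbitrary: f)
  case 0
  then show ?case
    by (auto intro!: continuous_at_imp_continuous_on differentiable_imp_continuous_within)
qed auto

lemma C_k_const: "C_k k (\<lambda>x. c)"
  by (induction k arbitrary: c) auto

lemma C_k_bounded_linear: "bounded_linear f \<Longrightarrow> C_k k f"
proof (cases k)
  case 0
  then show "bounded_linear f \<Longrightarrow> C_k k f" by (simp add: linear_continuous_on)
next
  case (Suc m)
  assume "bounded_linear f"
  then show ?thesis unfolding Suc
    by (intro C_k_SucI[where f' = "\<lambda>x. f"] C_k_const bounded_linear_imp_has_derivative)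
qed

lemma C_k_add: "C_k k f \<Longrightarrow> C_k k g \<Longrightarrow> C_k k (\<lambda>x. f x + g x)"
proof (induction k arbitrary: f g)
  case 0
  then show ?case by (auto intro: continuous_on_add)
next
  case (Suc k)
  show ?case
    by (rule C_k_SucI[where f' = "\<lambda>x v. frechet_derivative f (at x) v + frechet_derivative g (at x) v"])
      (use Suc in \<open>auto intro!: has_derivative_add C_k_Suc_has_derivative[of k]\<close>)
qed

lemma (in bounded_bilinear) C_k_prod: "C_k k f \<Longrightarrow> C_k k g \<Longrightarrow> C_k k (\<lambda>x. prod (f x) (g x))"
proof (induction k arbitrary: f g)
  case 0
  then show ?case by (auto intro: continuous_on)
next
  case (Suc k)
  show ?case
  proof (rule C_k_SucI)
    fix x
    show "((\<lambda>x. prod (f x) (g x)) has_derivative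
       (\<lambda>v. prod (f x) (frechet_derivative g (at x) v) + prod (frechet_derivative f (at x) v) (g x))) (at x)"
      using Suc.prems by (intro FDERIV C_k_Suc_has_derivative[of k])
  next
    fix v
    show "C_k k (\<lambda>x. prod (f x) (frechet_derivative g (at x) v) + prod (frechet_derivative f (at x) v) (g x))"
      \<comment> \<open>The product rule also contains the undifferentiated factors, which have to
        be lowered from order \<open>Suc k\<close> to order \<open>k\<close>.\<close>
      using Suc.prems C_k_lower[of k f] C_k_lower[of k g] by (auto intro!: C_k_add Suc.IH)
  qed
qed

lemma C_k_sum: "(\<And>i. i \<in> I \<Longrightarrow> C_k k (f i)) \<Longrightarrow> C_k k (\<lambda>x. \<Sum>i\<in>I. f i x)"
  by (induction I rule: infinite_finite_induct) (auto intro: C_k_const C_k_add)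

text \<open>\<open>C_k\<close> speaks of derivatives in fixed directions, but the chain rule
  differentiates f in a direction that moves with the point. Expanding that direction over
  \<open>Basis\<close> leaves fixed directions with \<open>C_k\<close> coefficients; this is why the
  middle space is Euclidean.\<close>

lemma C_k_compose:
  fixes f :: "'b::euclidean_space \<Rightarrow> 'c::real_normed_vector"
  shows "C_k k f \<Longrightarrow> C_k k g \<Longrightarrow> C_k k (\<lambda>x. f (g x))"
proof (induction k arbitrary: f)
  case 0
  then show ?case by (auto intro: continuous_on_compose2)
next
  case (Suc k)
  let ?f' = "\<lambda>x v. \<Sum>b\<in>Basis. (frechet_derivative g (at x) v \<bullet> b) *\<^sub>R frechet_derivative f (at (g x)) b"
  show ?case
  proof (rule C_k_SucI)
    fix x
    have lin: "linear (frechet_derivative f (at (g x)))"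
      using Suc.prems by (intro linear_frechet_derivative) auto
    have "(\<lambda>v. frechet_derivative f (at (g x)) (frechet_derivative g (at x) v)) = ?f' x"
    proof
      fix v
      let ?w = "frechet_derivative g (at x) v"
      have "frechet_derivative f (at (g x)) ?w = frechet_derivative f (at (g x)) (\<Sum>b\<in>Basis. (?w \<bullet> b) *\<^sub>R b)"
        by (simp add: euclidean_representation)
      also have "\<dots> = ?f' x v" using lin by (simp add: linear_sum linear_scale)
      finally show "frechet_derivative f (at (g x)) ?w = ?f' x v" .
    qed
    moreover have "((\<lambda>x. f (g x)) has_derivative (\<lambda>v. frechet_derivative f (at (g x)) (frechet_derivative g (at x) v))) (at x)"
      using Suc.prems by (intro has_derivative_compose[OF C_k_Suc_has_derivative[of k] C_k_Suc_has_derivative[of k]])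
    ultimately show "((\<lambda>x. f (g x)) has_derivative ?f' x) (at x)" by simp
  next
    fix v
    show "C_k k (\<lambda>x. ?f' x v)"
      using Suc.prems C_k_lower[of k g]
      by (auto intro!: C_k_sum bounded_bilinear.C_k_prod[OF bounded_bilinear_scaleR]
          bounded_bilinear.C_k_prod[OF bounded_bilinear_inner] C_k_const Suc.IH)
  qed
qed

lemma smooth_C_k: "smooth f \<Longrightarrow> C_k k f"
  by (simp add: smooth_def)

lemma smooth_has_derivative:
  "smooth f \<Longrightarrow> (f has_derivative frechet_derivative f (at x)) (at x)"
  by (rule C_k_Suc_has_derivative[of 0]) (simp add: smooth_def del: C_k.simps)

lemma smooth_differentiable: "smooth f \<Longrightarrow> f differentiable (at x)"
  using smooth_has_derivative by (auto simp: differentiable_def)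

lemma smooth_frechet_derivative: "smooth f \<Longrightarrow> smooth (\<lambda>x. frechet_derivative f (at x) v)"
  unfolding smooth_def using C_k.simps(2) by blast

lemma smoothI_derivative:
  assumes "\<And>x. (f has_derivative f' x) (at x)" "\<And>v. smooth (\<lambda>x. f' x v)"
  shows "smooth f"
proof -
  have "C_k (Suc k) f" for k
    using assms by (intro C_k_SucI[where f' = f']) (auto simp: smooth_def)
  then show ?thesis by (auto simp: smooth_def intro: C_k_lower)
qed

lemma smooth_const: "smooth (\<lambda>x. c)"
  and smooth_bounded_linear: "bounded_linear l \<Longrightarrow> smooth l"
  and smooth_add: "smooth f \<Longrightarrow> smooth g \<Longrightarrow> smooth (\<lambda>x. f x + g x)"
  and smooth_sum: "(\<And>i. i \<in> I \<Longrightarrow> smooth (h i)) \<Longrightarrow> smooth (\<lambda>x. \<Sum>i\<in>I. h i x)"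
  by (auto simp: smooth_def C_k_const intro: C_k_bounded_linear C_k_add C_k_sum)

lemma (in bounded_bilinear) smooth_prod: "smooth f \<Longrightarrow> smooth g \<Longrightarrow> smooth (\<lambda>x. prod (f x) (g x))"
  by (auto simp: smooth_def intro: C_k_prod)

lemmas smooth_mult = bounded_bilinear.smooth_prod[OF bounded_bilinear_mult]

lemma smooth_compose:
  fixes f :: "'b::euclidean_space \<Rightarrow> 'c::real_normed_vector"
  shows "smooth f \<Longrightarrow> smooth g \<Longrightarrow> smooth (\<lambda>x. f (g x))"
  by (auto simp: smooth_def intro: C_k_compose)

text \<open>A linear outer map is its own derivative at every point, so the induction runs without a
  basis expansion and the middle space may be any normed space.\<close>

lemma smooth_bounded_linear_compose: "bounded_linear l \<Longrightarrow> smooth g \<Longrightarrow> smooth (\<lambda>x. l (g x))"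
proof -
  assume l: "bounded_linear l" and g: "smooth g"
  have "C_k k g \<Longrightarrow> C_k k (\<lambda>x. l (g x))" for k and g :: "'c \<Rightarrow> 'a"
  proof (induction k arbitrary: g)
    case 0
    then show ?case using l by (auto intro: bounded_linear.continuous_on)
  next
    case (Suc k)
    have "((\<lambda>x. l (g x)) has_derivative (\<lambda>v. l (frechet_derivative g (at x) v))) (at x)" for x
      by (rule bounded_linear.has_derivative[OF l C_k_Suc_has_derivative[OF Suc.prems]])
    then show ?case
      using Suc by (intro C_k_SucI) auto
  qed
  then show ?thesis using g by (simp add: smooth_def)
qed

lemma smooth_Pair:
  fixes f :: "'c::real_normed_vector \<Rightarrow> 'a::real_normed_vector" and g :: "'c \<Rightarrow> 'b::real_normed_vector"
  shows "smooth f \<Longrightarrow> smooth g \<Longrightarrow> smooth (\<lambda>x. (f x, g x))"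
proof -
  assume f: "smooth f" and g: "smooth g"
  have "bounded_linear (\<lambda>x::'a. (x, 0::'b))" "bounded_linear (\<lambda>x::'b. (0::'a, x))"
    by (auto intro!: bounded_linear_Pair bounded_linear_ident bounded_linear_zero)
  from smooth_add[OF smooth_bounded_linear_compose[OF this(1) f] smooth_bounded_linear_compose[OF this(2)]] g
  show ?thesis by simp
qed

text \<open>The mean value theorem is used twice: along u for the difference of f between two
  parallel segments, then along v for the derivative of f. The second difference is symmetric in u
  and v, so exchanging them compares the two mixed derivatives.\<close>

lemma second_difference_mean_value:
  fixes f :: "'a::real_normed_vector \<Rightarrow> real"
  assumes f: "smooth f" and h: "h > 0"
  shows "\<exists>s t. 0 < s \<and> s < h \<and> 0 < t \<and> t < h \<and>
    f (x + h *\<^sub>R u + h *\<^sub>R v) - f (x + h *\<^sub>R u) - f (x + h *\<^sub>R v) + f x =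
    h * h * frechet_derivative (\<lambda>y. frechet_derivative f (at y) u) (at (x + s *\<^sub>R u + t *\<^sub>R v)) v"
proof -
  have along: "((\<lambda>r. k (a + r *\<^sub>R w)) has_real_derivative frechet_derivative k (at (a + r *\<^sub>R w)) w) (at r)"
    if "smooth k" for k :: "'a \<Rightarrow> real" and a w r
  proof -
    have "((\<lambda>r. a + r *\<^sub>R w) has_derivative (\<lambda>q. q *\<^sub>R w)) (at r)"
      by (auto intro!: derivative_eq_intros)
    from has_derivative_compose[OF this smooth_has_derivative[OF that]]
    show ?thesis
      using linear_frechet_derivative[OF smooth_differentiable[OF that], of "a + r *\<^sub>R w"]
      by (simp add: has_field_derivative_def linear_scale mult_commute_abs)
  qed
  define D where "D y = frechet_derivative f (at y) u" for y
  define G where "G r = f ((x + h *\<^sub>R v) + r *\<^sub>R u) - f (x + r *\<^sub>R u)" for r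
  have G': "(G has_real_derivative D ((x + h *\<^sub>R v) + r *\<^sub>R u) - D (x + r *\<^sub>R u)) (at r)" for r
    unfolding G_def D_def by (intro DERIV_diff along f)
  obtain s where s: "0 < s" "s < h" "G h - G 0 = (h - 0) * (D ((x + h *\<^sub>R v) + s *\<^sub>R u) - D (x + s *\<^sub>R u))"
    using MVT2[OF h G'] by auto
  have D: "smooth D" unfolding D_def by (rule smooth_frechet_derivative[OF f])
  obtain t where t: "0 < t" "t < h"
    "D ((x + s *\<^sub>R u) + h *\<^sub>R v) - D ((x + s *\<^sub>R u) + 0 *\<^sub>R v) = (h - 0) * frechet_derivative D (at ((x + s *\<^sub>R u) + t *\<^sub>R v)) v"
    using MVT2[OF h along[OF D, of "x + s *\<^sub>R u" v]] by auto
  have "f (x + h *\<^sub>R u + h *\<^sub>R v) - f (x + h *\<^sub>R u) - f (x + h *\<^sub>R v) + f x = G h - G 0"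
    by (simp add: G_def algebra_simps)
  also have "\<dots> = h * h * frechet_derivative D (at (x + s *\<^sub>R u + t *\<^sub>R v)) v"
    using s(3) t(3) by (simp add: algebra_simps)
  finally show ?thesis using s t unfolding D_def by blast
qed

text \<open>In every small parallelogram at x, one mixed derivative at some point equals the other
  one at some other point. Shrinking the sides to 1/(n+1) and using continuity gives equality at
  x.\<close>

lemma symmetric_second_derivative_real:
  fixes f :: "'a::real_normed_vector \<Rightarrow> real"
  assumes f: "smooth f"
  shows "frechet_derivative (\<lambda>y. frechet_derivative f (at y) u) (at x) v =
    frechet_derivative (\<lambda>y. frechet_derivative f (at y) v) (at x) u"
proof -
  define P where "P y = frechet_derivative (\<lambda>y. frechet_derivative f (at y) u) (at y) v" for y
  define Q where "Q y = frechet_derivative (\<lambda>y. frechet_derivative f (at y) v) (at y) u" for y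
  have cont: "isCont P x" "isCont Q x"
    unfolding P_def Q_def using f
    by (auto intro!: differentiable_imp_continuous_within smooth_differentiable smooth_frechet_derivative)
  have "\<exists>s t s' t'. 0 < s \<and> s < h \<and> 0 < t \<and> t < h \<and> 0 < s' \<and> s' < h \<and> 0 < t' \<and> t' < h \<and>
      P (x + s *\<^sub>R u + t *\<^sub>R v) = Q (x + s' *\<^sub>R v + t' *\<^sub>R u)" if "h > 0" for h
  proof -
    from second_difference_mean_value[OF f that, of x u v] obtain s t where
      1: "0 < s" "s < h" "0 < t" "t < h"
      "f (x + h *\<^sub>R u + h *\<^sub>R v) - f (x + h *\<^sub>R u) - f (x + h *\<^sub>R v) + f x = h * h * P (x + s *\<^sub>R u + t *\<^sub>R v)"
      unfolding P_def by blast
    from second_difference_mean_value[OF f that, of x v u] obtain s' t' where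
      2: "0 < s'" "s' < h" "0 < t'" "t' < h"
      "f (x + h *\<^sub>R v + h *\<^sub>R u) - f (x + h *\<^sub>R v) - f (x + h *\<^sub>R u) + f x = h * h * Q (x + s' *\<^sub>R v + t' *\<^sub>R u)"
      unfolding Q_def by blast
    have "h * h * P (x + s *\<^sub>R u + t *\<^sub>R v) = h * h * Q (x + s' *\<^sub>R v + t' *\<^sub>R u)"
      using 1(5) 2(5) by (simp add: algebra_simps)
    then show ?thesis using 1 2 that by auto
  qed
  then have "\<exists>s t s' t'. 0 < s \<and> s < inverse (real (Suc n)) \<and> 0 < t \<and> t < inverse (real (Suc n)) \<and>
      0 < s' \<and> s' < inverse (real (Suc n)) \<and> 0 < t' \<and> t' < inverse (real (Suc n)) \<and>
      P (x + s *\<^sub>R u + t *\<^sub>R v) = Q (x + s' *\<^sub>R v + t' *\<^sub>R u)" for n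
    by simp
  then obtain s t s' t' where st:
    "\<And>n. 0 < s n \<and> s n < inverse (real (Suc n))" "\<And>n. 0 < t n \<and> t n < inverse (real (Suc n))"
    "\<And>n. 0 < s' n \<and> s' n < inverse (real (Suc n))" "\<And>n. 0 < t' n \<and> t' n < inverse (real (Suc n))"
    "\<And>n. P (x + s n *\<^sub>R u + t n *\<^sub>R v) = Q (x + s' n *\<^sub>R v + t' n *\<^sub>R u)"
    by metis
  have lim: "r \<longlonglongrightarrow> 0" if "\<And>n. 0 < r n \<and> r n < inverse (real (Suc n))" for r :: "nat \<Rightarrow> real"
    by (rule tendsto_sandwich[OF _ _ tendsto_const LIMSEQ_inverse_real_of_nat])
      (use that in \<open>auto intro!: always_eventually less_imp_le\<close>)
  have "(\<lambda>n. x + s n *\<^sub>R u + t n *\<^sub>R v) \<longlonglongrightarrow> x + 0 *\<^sub>R u + 0 *\<^sub>R v"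
    by (intro tendsto_intros lim st)
  then have p: "(\<lambda>n. P (x + s n *\<^sub>R u + t n *\<^sub>R v)) \<longlonglongrightarrow> P x"
    by (intro isCont_tendsto_compose[OF cont(1)]) simp
  have "(\<lambda>n. x + s' n *\<^sub>R v + t' n *\<^sub>R u) \<longlonglongrightarrow> x + 0 *\<^sub>R v + 0 *\<^sub>R u"
    by (intro tendsto_intros lim st)
  then have q: "(\<lambda>n. Q (x + s' n *\<^sub>R v + t' n *\<^sub>R u)) \<longlonglongrightarrow> Q x"
    by (intro isCont_tendsto_compose[OF cont(2)]) simp
  show ?thesis
    using LIMSEQ_unique[OF p] q st(5) by (simp add: P_def Q_def)
qed

lemma frechet_derivative_bounded_linear:
  assumes "bounded_linear l" "f differentiable (at x)"
  shows "frechet_derivative (\<lambda>y. l (f y)) (at x) = (\<lambda>v. l (frechet_derivative f (at x) v))"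
  using assms by (metis bounded_linear.has_derivative frechet_derivative_at frechet_derivative_works)

lemma symmetric_second_derivative:
  fixes f :: "'a::real_normed_vector \<Rightarrow> 'b::euclidean_space"
  assumes f: "smooth f"
  shows "frechet_derivative (\<lambda>y. frechet_derivative f (at y) u) (at x) v =
    frechet_derivative (\<lambda>y. frechet_derivative f (at y) v) (at x) u"
proof (rule euclidean_eqI)
  fix b :: 'b
  have bl: "bounded_linear (\<lambda>z::'b. z \<bullet> b)" by (rule bounded_linear_inner_left)
  have sm: "smooth (\<lambda>y. f y \<bullet> b)" by (rule smooth_bounded_linear_compose[OF bl f])
  have 1: "frechet_derivative (\<lambda>y. f y \<bullet> b) (at y) w = frechet_derivative f (at y) w \<bullet> b" for y w
    using frechet_derivative_bounded_linear[OF bl smooth_differentiable[OF f]] by metis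
  have 2: "frechet_derivative (\<lambda>y. frechet_derivative f (at y) w \<bullet> b) (at y) z =
      frechet_derivative (\<lambda>y. frechet_derivative f (at y) w) (at y) z \<bullet> b" for y w z
    using frechet_derivative_bounded_linear[OF bl smooth_differentiable[OF smooth_frechet_derivative[OF f]]] by metis
  show "frechet_derivative (\<lambda>y. frechet_derivative f (at y) u) (at x) v \<bullet> b =
      frechet_derivative (\<lambda>y. frechet_derivative f (at y) v) (at x) u \<bullet> b"
    using symmetric_second_derivative_real[OF sm, of u x v] unfolding 1 2 .
qed

section \<open>Maurer--Cartan equation and Poincare lemma\<close>

lemma linear_frechet_derivative_smooth: "smooth f \<Longrightarrow> linear (frechet_derivative f (at x))"
  by (rule linear_frechet_derivative[OF smooth_differentiable])

text \<open>A product rule for an operator field applied to a vector field. Smoothness is given only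
  for the single values \<open>L y w\<close>, so L is handled through its values on
  \<open>Basis\<close> and not as a curve in a space of operators.\<close>

lemma has_derivative_linear_field:
  fixes L :: "'a::real_normed_vector \<Rightarrow> 'b::euclidean_space \<Rightarrow> 'c::real_normed_vector"
  assumes lin: "\<And>y. linear (L y)" and L: "\<And>w. smooth (\<lambda>y. L y w)" and W: "smooth W"
  shows "((\<lambda>y. L y (W y)) has_derivative
    (\<lambda>u. frechet_derivative (\<lambda>y. L y (W x)) (at x) u + L x (frechet_derivative W (at x) u))) (at x)"
proof -
  let ?D = "\<lambda>w. frechet_derivative (\<lambda>y. L y w) (at x)" and ?W' = "frechet_derivative W (at x)"
  have exp: "L y w = (\<Sum>b\<in>Basis. (w \<bullet> b) *\<^sub>R L y b)" for y w
  proof -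
    have "L y w = L y (\<Sum>b\<in>Basis. (w \<bullet> b) *\<^sub>R b)" by (simp add: euclidean_representation)
    also have "\<dots> = (\<Sum>b\<in>Basis. (w \<bullet> b) *\<^sub>R L y b)" using lin[of y] by (simp add: linear_sum linear_scale)
    finally show ?thesis .
  qed
  have D: "?D w u = (\<Sum>b\<in>Basis. (w \<bullet> b) *\<^sub>R ?D b u)" for w u
  proof -
    have "((\<lambda>y. \<Sum>b\<in>Basis. (w \<bullet> b) *\<^sub>R L y b) has_derivative (\<lambda>u. \<Sum>b\<in>Basis. (w \<bullet> b) *\<^sub>R ?D b u)) (at x)"
      by (intro has_derivative_sum has_derivative_scaleR_right smooth_has_derivative L)
    moreover have "(\<lambda>y. L y w) = (\<lambda>y. \<Sum>b\<in>Basis. (w \<bullet> b) *\<^sub>R L y b)"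
      by (rule ext) (rule exp)
    ultimately have "((\<lambda>y. L y w) has_derivative (\<lambda>u. \<Sum>b\<in>Basis. (w \<bullet> b) *\<^sub>R ?D b u)) (at x)"
      by simp
    from frechet_derivative_at[OF this, symmetric] show ?thesis by simp
  qed
  have "((\<lambda>y. \<Sum>b\<in>Basis. (W y \<bullet> b) *\<^sub>R L y b) has_derivative
      (\<lambda>u. \<Sum>b\<in>Basis. (W x \<bullet> b) *\<^sub>R ?D b u + (?W' u \<bullet> b) *\<^sub>R L x b)) (at x)"
    by (intro has_derivative_sum has_derivative_scaleR has_derivative_inner_left smooth_has_derivative L W)
  moreover have "(\<lambda>y. \<Sum>b\<in>Basis. (W y \<bullet> b) *\<^sub>R L y b) = (\<lambda>y. L y (W y))"
    by (rule ext) (rule exp[symmetric])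
  moreover have "(\<lambda>u. \<Sum>b\<in>Basis. (W x \<bullet> b) *\<^sub>R ?D b u + (?W' u \<bullet> b) *\<^sub>R L x b) = (\<lambda>u. ?D (W x) u + L x (?W' u))"
    by (rule ext) (simp only: sum.distrib D[symmetric] exp[symmetric])
  ultimately show ?thesis by simp
qed

definition mc_form :: "('a::euclidean_space \<Rightarrow> 'a \<Rightarrow> 'a) \<Rightarrow> ('a \<Rightarrow> 'a) \<Rightarrow> 'a \<Rightarrow> 'a \<Rightarrow> 'a" where
  "mc_form mul iv x = frechet_derivative (mul (iv x)) (at x)"

context
  fixes br mul :: "'a::euclidean_space \<Rightarrow> 'a \<Rightarrow> 'a" and iv :: "'a \<Rightarrow> 'a"
  assumes lie_group: "lie_group_with_algebra br mul iv"
begin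

lemma lie_group_group: "group mul 0 iv"
  and lie_group_smooth_mul: "smooth (\<lambda>(x, y). mul x y)"
  and lie_group_smooth_iv: "smooth iv"
  using lie_group by (auto simp: lie_group_with_algebra_def)

interpretation grp: group mul 0 iv by (rule lie_group_group)

text \<open>Expresses the derivative of a left translation as a directional derivative of the joint
  multiplication, from which smoothness in both the translation and the base point follows by
  composition.\<close>

lemma frechet_derivative_mul:
  "frechet_derivative (mul a) (at y) v = frechet_derivative (\<lambda>(x, y). mul x y) (at (a, y)) (0, v)"
proof -
  have "((\<lambda>y. (a, y)) has_derivative (\<lambda>v. (0, v))) (at y)"
    by (auto intro!: derivative_eq_intros)
  from has_derivative_compose[OF this smooth_has_derivative[OF lie_group_smooth_mul]]
  have "(mul a has_derivative (\<lambda>v. frechet_derivative (\<lambda>(x, y). mul x y) (at (a, y)) (0, v))) (at y)"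
    by simp
  from frechet_derivative_at[OF this] show ?thesis by metis
qed

lemma smooth_mul: "smooth (mul a)"
  using smooth_compose[OF lie_group_smooth_mul smooth_Pair[OF smooth_const smooth_bounded_linear[OF bounded_linear_ident]]]
  by simp

lemma smooth_frechet_derivative_mul:
  assumes "smooth a" "smooth y"
  shows "smooth (\<lambda>x. frechet_derivative (mul (a x)) (at (y x)) v)"
  unfolding frechet_derivative_mul
  by (rule smooth_compose[OF smooth_frechet_derivative[OF lie_group_smooth_mul] smooth_Pair[OF assms]])

lemma smooth_left_field: "smooth (left_field mul X)"
  unfolding left_field_def
  by (rule smooth_frechet_derivative_mul[OF smooth_bounded_linear[OF bounded_linear_ident] smooth_const])

lemma smooth_mc_form: "smooth (\<lambda>x. mc_form mul iv x v)"
  unfolding mc_form_def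
  by (rule smooth_frechet_derivative_mul[OF lie_group_smooth_iv smooth_bounded_linear[OF bounded_linear_ident]])

lemma linear_mc_form: "linear (mc_form mul iv x)"
  unfolding mc_form_def by (rule linear_frechet_derivative_smooth[OF smooth_mul])

lemma frechet_derivative_mul_mul:
  "frechet_derivative (mul (mul x y)) (at z) v =
    frechet_derivative (mul x) (at (mul y z)) (frechet_derivative (mul y) (at z) v)"
proof -
  have eq: "mul (mul x y) = mul x \<circ> mul y" by (auto simp: grp.assoc)
  show ?thesis
    unfolding eq by (simp add: frechet_derivative_compose smooth_differentiable smooth_mul)
qed

lemma frechet_derivative_mul_0: "frechet_derivative (mul 0) (at z) v = v"
proof -
  have "mul 0 = (\<lambda>x. x)" by (auto simp: grp.group_left_neutral)
  then show ?thesis by simp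
qed

lemma mc_form_left_field: "mc_form mul iv x (left_field mul X x) = X"
  using frechet_derivative_mul_mul[of "iv x" x 0 X]
  by (simp add: mc_form_def left_field_def frechet_derivative_mul_0)

lemma left_field_mc_form: "left_field mul (mc_form mul iv x v) x = v"
  using frechet_derivative_mul_mul[of x "iv x" x v]
  by (simp add: mc_form_def left_field_def frechet_derivative_mul_0)

lemma left_field_mul: "left_field mul Y (mul x y) = frechet_derivative (mul x) (at y) (left_field mul Y y)"
  using frechet_derivative_mul_mul[of x y 0 Y] by (simp add: left_field_def)

text \<open>At the identity this is the definition of the bracket. For other points
  \<open>left_field_mul\<close> is differentiated at the identity: the derivative of the translation
  by x carries the bracket along, and the second derivatives of the translation cancel by
  symmetry.\<close>

lemma left_field_bracket:
  "frechet_derivative (left_field mul Y) (at x) (left_field mul X x)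
    - frechet_derivative (left_field mul X) (at x) (left_field mul Y x) = left_field mul (br X Y) x"
proof -
  let ?V = "left_field mul" and ?D = "frechet_derivative"
  have at_0: "?V Z 0 = Z" for Z by (simp add: left_field_def frechet_derivative_mul_0)
  have lin: "linear (?D (mul x) (at y))" for y by (rule linear_frechet_derivative_smooth[OF smooth_mul])
  have eq: "?D (?V Z) (at x) (?V W x) = ?D (\<lambda>y. ?D (mul x) (at y) Z) (at 0) W + ?D (mul x) (at 0) (?D (?V Z) (at 0) W)"
    for Z W
  proof -
    have 1: "((\<lambda>y. ?D (mul x) (at y) (?V Z y)) has_derivative
        (\<lambda>u. ?D (\<lambda>y. ?D (mul x) (at y) (?V Z 0)) (at 0) u + ?D (mul x) (at 0) (?D (?V Z) (at 0) u))) (at 0)"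
      by (intro has_derivative_linear_field lin smooth_frechet_derivative smooth_mul smooth_left_field)
    have 2: "((\<lambda>y. ?V Z (mul x y)) has_derivative (\<lambda>u. ?D (?V Z) (at (mul x 0)) (?D (mul x) (at 0) u))) (at 0)"
      by (intro has_derivative_compose[OF smooth_has_derivative smooth_has_derivative] smooth_mul smooth_left_field)
    show ?thesis
      using fun_cong[OF has_derivative_unique[OF 1 2[unfolded left_field_mul]], of W]
      by (simp add: at_0 left_field_def[of mul W])
  qed
  have "br X Y = ?D (?V Y) (at 0) X - ?D (?V X) (at 0) Y"
    using lie_group by (simp add: lie_group_with_algebra_def at_0)
  then have "?V (br X Y) x = ?D (mul x) (at 0) (?D (?V Y) (at 0) X) - ?D (mul x) (at 0) (?D (?V X) (at 0) Y)"
    using lin[of 0] by (simp add: left_field_def linear_diff)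
  then show ?thesis
    using symmetric_second_derivative[OF smooth_mul, of x X 0 Y] by (simp add: eq)
qed

text \<open>Extend u and v to left-invariant fields. On these the form is constant
  (\<open>mc_form_left_field\<close>), so differentiating the form amounts to minus the form applied
  to the derivative of the field, and \<open>left_field_bracket\<close> applies.\<close>

lemma maurer_cartan:
  "frechet_derivative (\<lambda>y. mc_form mul iv y v) (at x) u - frechet_derivative (\<lambda>y. mc_form mul iv y u) (at x) v
    = - br (mc_form mul iv x u) (mc_form mul iv x v)"
proof -
  let ?\<theta> = "mc_form mul iv" and ?V = "left_field mul" and ?D = "frechet_derivative"
  have eq: "?D (\<lambda>y. ?\<theta> y (?V Z x)) (at x) w = - ?\<theta> x (?D (?V Z) (at x) w)" for Z w
  proof -
    have 1: "((\<lambda>y. ?\<theta> y (?V Z y)) has_derivative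
        (\<lambda>w. ?D (\<lambda>y. ?\<theta> y (?V Z x)) (at x) w + ?\<theta> x (?D (?V Z) (at x) w))) (at x)"
      by (intro has_derivative_linear_field linear_mc_form smooth_mc_form smooth_left_field)
    have 2: "((\<lambda>y. ?\<theta> y (?V Z y)) has_derivative (\<lambda>w. 0)) (at x)"
      by (simp add: mc_form_left_field)
    show ?thesis
      using fun_cong[OF has_derivative_unique[OF 1 2], of w] by (simp add: eq_neg_iff_add_eq_0)
  qed
  have "br (?\<theta> x u) (?\<theta> x v) = ?\<theta> x (?D (?V (?\<theta> x v)) (at x) u) - ?\<theta> x (?D (?V (?\<theta> x u)) (at x) v)"
    using arg_cong[OF left_field_bracket[of "?\<theta> x v" x "?\<theta> x u"], of "?\<theta> x"]
    by (simp add: left_field_mc_form mc_form_left_field linear_diff[OF linear_mc_form])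
  then show ?thesis
    using eq[of "?\<theta> x v" u] eq[of "?\<theta> x u" v] by (simp add: left_field_mc_form)
qed

end

text \<open>The primitive is the integral of \<open>\<alpha> (t *\<^sub>R x) x\<close> over t in
  [0,1]. Closedness turns the integrand of its derivative in direction v into the t-derivative of
  \<open>t * \<alpha> (t *\<^sub>R x) v\<close>, whose boundary values are
  \<open>\<alpha> x v\<close> and 0.\<close>

lemma poincare_one_form:
  fixes \<alpha> :: "'a::euclidean_space \<Rightarrow> 'a \<Rightarrow> real"
  assumes lin: "\<And>x. linear (\<alpha> x)" and sm: "\<And>v. smooth (\<lambda>x. \<alpha> x v)"
    and closed: "\<And>x u v. frechet_derivative (\<lambda>y. \<alpha> y v) (at x) u = frechet_derivative (\<lambda>y. \<alpha> y u) (at x) v"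
  shows "\<exists>F. smooth F \<and> (\<forall>x. (F has_derivative \<alpha> x) (at x))"
proof -
  define D where "D y v u = frechet_derivative (\<lambda>y. \<alpha> y v) (at y) u" for y v u
  have D_lin: "linear (D y v)" for y v
    unfolding D_def by (rule linear_frechet_derivative_smooth[OF sm])
  have D_sm: "smooth (\<lambda>y. D y v u)" for v u
    unfolding D_def by (rule smooth_frechet_derivative[OF sm])
  have D_sym: "D y v u = D y u v" for y u v
    unfolding D_def by (rule closed)
  have D_lin': "linear (\<lambda>v. D y v u)" for y u
    using D_lin[of y u] by (subst D_sym)
  define f where "f x t = \<alpha> (t *\<^sub>R x) x" for x and t :: real
  define f' where "f' x t v = t * D (t *\<^sub>R x) x v + \<alpha> (t *\<^sub>R x) v" for x v and t :: real
  have smooth_cont: "continuous_on UNIV h" if "smooth h" for h :: "'a \<Rightarrow> real"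
    using smooth_C_k[OF that, of 0] by simp
  have f_der: "((\<lambda>x. f x t) has_derivative f' x t) (at x)" for x t
  proof -
    have "((\<lambda>x. \<alpha> (t *\<^sub>R x) v) has_derivative (\<lambda>u. D (t *\<^sub>R x) v (t *\<^sub>R u))) (at x)" for v x
    proof -
      have "((\<lambda>x. t *\<^sub>R x) has_derivative (\<lambda>u. t *\<^sub>R u)) (at x)" by (auto intro!: derivative_eq_intros)
      from has_derivative_compose[OF this smooth_has_derivative[OF sm]] show ?thesis unfolding D_def .
    qed
    note d = this
    have "smooth (\<lambda>x. \<alpha> (t *\<^sub>R x) v)" for v
      by (rule smooth_compose[OF sm smooth_bounded_linear[OF bounded_linear_scaleR_right]])
    from has_derivative_linear_field[of "\<lambda>x. \<alpha> (t *\<^sub>R x)" "\<lambda>x. x", OF lin this smooth_bounded_linear[OF bounded_linear_ident]]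
    have "((\<lambda>x. f x t) has_derivative (\<lambda>u. D (t *\<^sub>R x) x (t *\<^sub>R u) + \<alpha> (t *\<^sub>R x) u)) (at x)"
      unfolding f_def frechet_derivative_at[OF d, symmetric] by simp
    then show ?thesis
      unfolding f'_def using linear_scale[OF D_lin] by simp
  qed
  have bl: "bounded_linear (f' x t)" for x t
    using f_der by (rule has_derivative_bounded_linear)
  have cont_f': "continuous_on S (\<lambda>(x, t). f' x t v)" for S v
  proof -
    have "D (t *\<^sub>R x) x v = (\<Sum>b\<in>Basis. (x \<bullet> b) * D (t *\<^sub>R x) b v)" for x t
    proof -
      have "D (t *\<^sub>R x) x v = D (t *\<^sub>R x) (\<Sum>b\<in>Basis. (x \<bullet> b) *\<^sub>R b) v" by (simp add: euclidean_representation)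
      also have "\<dots> = (\<Sum>b\<in>Basis. (x \<bullet> b) * D (t *\<^sub>R x) b v)" by (simp add: linear_sum[OF D_lin'] linear_scale[OF D_lin'])
      finally show ?thesis .
    qed
    moreover have h: "continuous_on S (\<lambda>p. h (snd p *\<^sub>R fst p))" if "smooth h" for h :: "'a \<Rightarrow> real"
      by (intro continuous_on_compose2[OF smooth_cont[OF that]] continuous_intros) auto
    ultimately show ?thesis
      unfolding f'_def case_prod_unfold by (auto intro!: continuous_intros h[OF D_sm] h[OF sm])
  qed
  define fx where "fx x t = Blinfun (f' x t)" for x t
  have fx: "blinfun_apply (fx x t) = f' x t" for x t
    unfolding fx_def by (rule bounded_linear_Blinfun_apply[OF bl])
  define F where "F x = integral (cbox 0 1) (f x)" for x
  have f_cont: "continuous_on S (f x)" for x S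
    unfolding f_def by (intro continuous_on_compose2[OF smooth_cont[OF sm]] continuous_intros) auto
  have F_der: "(F has_derivative integral (cbox 0 1) (fx x)) (at x)" for x
    unfolding F_def
  proof (rule leibniz_rule[where U = UNIV])
    show "((\<lambda>x. f x t) has_derivative blinfun_apply (fx x t)) (at x)" for x t
      unfolding fx by (rule f_der)
    show "f x integrable_on cbox 0 1" for x
      by (rule integrable_continuous[OF f_cont])
    show "continuous_on (UNIV \<times> cbox 0 1) (\<lambda>(x, t). fx x t)"
      using cont_f' by (intro continuous_on_blinfun_componentwise) (simp add: fx case_prod_unfold)
  qed auto
  have "blinfun_apply (integral (cbox 0 1) (fx x)) v = \<alpha> x v" for x v
  proof -
    have "continuous_on (cbox 0 1) (fx x)"
    proof (rule continuous_on_blinfun_componentwise)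
      fix i
      have "continuous_on (cbox 0 1) (\<lambda>t. (\<lambda>(x, t). f' x t i) (x, t))"
        by (intro continuous_on_compose2[OF cont_f'[of UNIV i]] continuous_intros) auto
      then show "continuous_on (cbox 0 1) (\<lambda>t. blinfun_apply (fx x t) i)" by (simp add: fx)
    qed
    then have int: "fx x integrable_on cbox 0 1" by (rule integrable_continuous)
    have "blinfun_apply (integral (cbox 0 1) (fx x)) v = integral (cbox 0 1) (\<lambda>t. f' x t v)"
      using blinfun_apply_integral[OF int] by (simp add: fx)
    moreover have "((\<lambda>t. f' x t v) has_integral (1 * \<alpha> (1 *\<^sub>R x) v - 0 * \<alpha> (0 *\<^sub>R x) v)) {0..1}"
    proof (rule fundamental_theorem_of_calculus)
      fix t :: real
      have "((\<lambda>t. t *\<^sub>R x) has_derivative (\<lambda>s. s *\<^sub>R x)) (at t within {0..1})"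
        by (auto intro!: derivative_eq_intros)
      from has_derivative_compose[OF this smooth_has_derivative[OF sm]]
      have "((\<lambda>t. \<alpha> (t *\<^sub>R x) v) has_derivative (\<lambda>s. D (t *\<^sub>R x) v (s *\<^sub>R x))) (at t within {0..1})"
        unfolding D_def .
      from has_derivative_mult[OF has_derivative_ident this]
      show "((\<lambda>t. t * \<alpha> (t *\<^sub>R x) v) has_vector_derivative f' x t v) (at t within {0..1})"
        unfolding has_vector_derivative_def f'_def
        by (simp add: linear_scale[OF D_lin] D_sym[of _ x] algebra_simps)
    qed simp
    ultimately show ?thesis by (simp add: integral_unique)
  qed
  then have "blinfun_apply (integral (cbox 0 1) (fx x)) = \<alpha> x" for x by auto
  with F_der have "(F has_derivative \<alpha> x) (at x)" for x by metis
  then show ?thesis using smoothI_derivative[where f = F and f' = \<alpha>, OF _ sm] by blast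
qed

section \<open>Wedge products\<close>

text \<open>The degree condition of \<open>alternating_form\<close> on its own: the signs in the
  Leibniz rules depend only on it, and it survives contraction.\<close>

definition homogeneous :: "nat \<Rightarrow> ('a, 'b::zero) form \<Rightarrow> bool" where
  "homogeneous k \<omega> \<longleftrightarrow> (\<forall>vs. length vs \<noteq> k \<longrightarrow> \<omega> vs = 0)"

lemma homogeneousD: "homogeneous k \<omega> \<Longrightarrow> length vs \<noteq> k \<Longrightarrow> \<omega> vs = 0"
  by (simp add: homogeneous_def)

text \<open>For \<open>k = 0\<close> the contraction is zero, so the truncated subtraction does no
  harm.\<close>

lemma homogeneous_interior_product: "homogeneous k \<omega> \<Longrightarrow> homogeneous (k - 1) (interior_product v \<omega>)"
  by (auto simp: homogeneous_def interior_product_def)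

lemma homogeneous_oneform: "homogeneous 1 (oneform a)"
  by (auto simp: homogeneous_def oneform_def)

lemma wedge_by_Nil: "wedge_by b \<alpha> \<beta> [] = b (\<alpha> []) (\<beta> [])"
  by (simp add: wedge_by_def)

text \<open>Contraction is an antiderivation: the shuffles of \<open>v # vs\<close> split by whether
  position 0 goes to the first or to the second factor.\<close>

lemma wedge_by_Cons:
  assumes b: "bilinear b" and \<alpha>: "homogeneous k \<alpha>"
  shows "wedge_by b \<alpha> \<beta> (v # vs) = wedge_by b (interior_product v \<alpha>) \<beta> vs
    + (- 1) ^ k *\<^sub>R wedge_by b \<alpha> (interior_product v \<beta>) vs"
proof -
  define n where "n = length vs"
  define inv where "inv m S = {(i, j). i \<in> S \<and> j \<in> {..<m} - S \<and> j < i}" for m :: nat and S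
  define t where "t S = (- 1) ^ card (inv (Suc n) S) *\<^sub>R b (\<alpha> (nths (v # vs) S)) (\<beta> (nths (v # vs) (- S)))" for S
  have split: "Pow {..<Suc n} = (\<lambda>S. insert 0 (Suc ` S)) ` Pow {..<n} \<union> (`) Suc ` Pow {..<n}"
    by (simp add: lessThan_Suc_eq_insert_0 Pow_insert image_Pow_surj[symmetric] image_image Un_commute)
  have inj: "inj_on (\<lambda>S. insert 0 (Suc ` S)) (Pow {..<n})" "inj_on ((`) Suc) (Pow {..<n})"
    by (auto simp: inj_on_def)
  have inj': "inj_on (map_prod Suc Suc) P" for P
    by (rule inj_on_subset[OF prod.inj_map]) auto
  have "wedge_by b \<alpha> \<beta> (v # vs) = (\<Sum>S\<in>Pow {..<Suc n}. t S)"
    by (simp add: wedge_by_def n_def t_def inv_def)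
  also have "\<dots> = (\<Sum>S\<in>Pow {..<n}. t (insert 0 (Suc ` S))) + (\<Sum>S\<in>Pow {..<n}. t (Suc ` S))"
    unfolding split by (subst sum.union_disjoint) (auto simp: sum.reindex[OF inj(1)] sum.reindex[OF inj(2)])
  also have "(\<Sum>S\<in>Pow {..<n}. t (insert 0 (Suc ` S))) = wedge_by b (interior_product v \<alpha>) \<beta> vs"
    unfolding wedge_by_def n_def[symmetric]
  proof (rule sum.cong)
    fix S assume "S \<in> Pow {..<n}"
    have "inv (Suc n) (insert 0 (Suc ` S)) = map_prod Suc Suc ` inv n S"
      unfolding inv_def by (auto simp: map_prod_def image_iff gr0_conv_Suc less_Suc_eq_0_disj)
    then have "card (inv (Suc n) (insert 0 (Suc ` S))) = card (inv n S)"
      by (simp add: card_image[OF inj'])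
    moreover have "{j. Suc j \<in> insert 0 (Suc ` S)} = S" "{j. Suc j \<in> - insert 0 (Suc ` S)} = - S" by auto
    ultimately show "t (insert 0 (Suc ` S)) =
        (- 1) ^ card {(i, j). i \<in> S \<and> j \<in> {..<n} - S \<and> j < i} *\<^sub>R b (interior_product v \<alpha> (nths vs S)) (\<beta> (nths vs (- S)))"
      by (simp add: t_def nths_Cons interior_product_def inv_def)
  qed simp
  also have "(\<Sum>S\<in>Pow {..<n}. t (Suc ` S)) = (- 1) ^ k *\<^sub>R wedge_by b \<alpha> (interior_product v \<beta>) vs"
    unfolding wedge_by_def n_def[symmetric] scaleR_sum_right
  proof (rule sum.cong)
    fix S assume S: "S \<in> Pow {..<n}"
    then have fin: "finite S" using finite_subset by auto
    have fin': "finite (inv n S)"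
      by (rule finite_subset[of _ "S \<times> {..<n}"]) (use fin in \<open>auto simp: inv_def\<close>)
    \<comment> \<open>Position 0 belongs to the second factor and every element of S stands behind
      it, which costs \<open>card S\<close> additional inversions.\<close>
    have "inv (Suc n) (Suc ` S) = map_prod Suc Suc ` inv n S \<union> Suc ` S \<times> {0}"
      unfolding inv_def by (auto simp: map_prod_def image_iff gr0_conv_Suc less_Suc_eq_0_disj)
    moreover have "card (map_prod Suc Suc ` inv n S \<union> Suc ` S \<times> {0}) = card (inv n S) + card S"
      using fin fin' by (subst card_Un_disjoint) (auto simp: card_image[OF inj'] card_image card_cartesian_product)
    ultimately have card: "card (inv (Suc n) (Suc ` S)) = card (inv n S) + card S" by simp
    have sets: "{j. Suc j \<in> Suc ` S} = S" "{j. Suc j \<notin> Suc ` S} = - S" by auto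
    have "length (nths vs S) = card S"
      using S by (auto simp: length_nths n_def intro!: arg_cong[of _ _ card])
    \<comment> \<open>Only terms with \<open>card S = k\<close> survive, so the additional sign is
      uniformly \<open>(- 1) ^ k\<close>.\<close>
    then have "\<alpha> (nths vs S) = 0 \<or> card S = k"
      using homogeneousD[OF \<alpha>] by metis
    then show "t (Suc ` S) = (- 1) ^ k *\<^sub>R (- 1) ^ card {(i, j). i \<in> S \<and> j \<in> {..<n} - S \<and> j < i} *\<^sub>R
        b (\<alpha> (nths vs S)) (interior_product v \<beta> (nths vs (- S)))"
      using bilinear_lzero[OF b]
      by (auto simp: t_def nths_Cons interior_product_def sets card power_add mult.commute) (simp add: inv_def)
  qed simp
  finally show ?thesis .
qed

lemma bilinear_mult: "bilinear ((*) :: real \<Rightarrow> real \<Rightarrow> real)"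
  by (simp add: bilinear_conv_bounded_bilinear bounded_bilinear_mult)

lemma wedge_Cons:
  assumes "homogeneous k \<alpha>"
  shows "wedge \<alpha> \<beta> (v # vs) = wedge (interior_product v \<alpha>) \<beta> vs + (- 1) ^ k * wedge \<alpha> (interior_product v \<beta>) vs"
  using wedge_by_Cons[OF bilinear_mult assms] by simp

lemma interior_product_wedge:
  assumes "homogeneous k \<alpha>"
  shows "interior_product v (wedge \<alpha> \<beta>) =
    (\<lambda>vs. wedge (interior_product v \<alpha>) \<beta> vs + (- 1) ^ k * wedge \<alpha> (interior_product v \<beta>) vs)"
  using wedge_Cons[OF assms] by (auto simp: interior_product_def)

lemma homogeneous_wedge_by:
  assumes b: "bilinear b" and \<alpha>: "homogeneous k \<alpha>" and \<beta>: "homogeneous l \<beta>"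
  shows "homogeneous (k + l) (wedge_by b \<alpha> \<beta>)"
proof -
  have "b (\<alpha> (nths vs S)) (\<beta> (nths vs (- S))) = 0" if "length vs \<noteq> k + l" for vs S
  proof -
    have "length (nths vs S) + length (nths vs (- S)) = card {i. i < length vs \<and> i \<in> S} + card {i. i < length vs \<and> i \<in> - S}"
      by (simp add: length_nths)
    also have "\<dots> = card ({i. i < length vs \<and> i \<in> S} \<union> {i. i < length vs \<and> i \<in> - S})"
      by (rule card_Un_disjoint[symmetric]) auto
    also have "{i. i < length vs \<and> i \<in> S} \<union> {i. i < length vs \<and> i \<in> - S} = {..<length vs}" by auto
    finally have "length (nths vs S) \<noteq> k \<or> length (nths vs (- S)) \<noteq> l" using that by auto
    then show ?thesis
      using homogeneousD[OF \<alpha>] homogeneousD[OF \<beta>] bilinear_lzero[OF b] bilinear_rzero[OF b] by metis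
  qed
  then show ?thesis by (simp add: homogeneous_def wedge_by_def)
qed

lemmas homogeneous_wedge = homogeneous_wedge_by[OF bilinear_mult]

lemma wedge_by_add_left: "bilinear b \<Longrightarrow> wedge_by b (\<lambda>us. \<alpha> us + \<alpha>' us) \<beta> vs = wedge_by b \<alpha> \<beta> vs + wedge_by b \<alpha>' \<beta> vs"
  and wedge_by_add_right: "bilinear b \<Longrightarrow> wedge_by b \<alpha> (\<lambda>us. \<beta> us + \<beta>' us) vs = wedge_by b \<alpha> \<beta> vs + wedge_by b \<alpha> \<beta>' vs"
  and wedge_by_scaleR_left: "bilinear b \<Longrightarrow> wedge_by b (\<lambda>us. c *\<^sub>R \<alpha> us) \<beta> vs = c *\<^sub>R wedge_by b \<alpha> \<beta> vs"
  and wedge_by_scaleR_right: "bilinear b \<Longrightarrow> wedge_by b \<alpha> (\<lambda>us. c *\<^sub>R \<beta> us) vs = c *\<^sub>R wedge_by b \<alpha> \<beta> vs"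
  and wedge_by_zero_left: "bilinear b \<Longrightarrow> wedge_by b (\<lambda>us. 0) \<beta> vs = 0"
  and wedge_by_zero_right: "bilinear b \<Longrightarrow> wedge_by b \<alpha> (\<lambda>us. 0) vs = 0"
  by (simp_all add: wedge_by_def bilinear_ladd bilinear_radd bilinear_lmul bilinear_rmul bilinear_lzero bilinear_rzero
      scaleR_add_right sum.distrib scaleR_sum_right mult.commute)

lemmas wedge_add_left = wedge_by_add_left[OF bilinear_mult]
  and wedge_add_right = wedge_by_add_right[OF bilinear_mult]
  and wedge_scale_left = wedge_by_scaleR_left[OF bilinear_mult, unfolded real_scaleR_def]
  and wedge_scale_right = wedge_by_scaleR_right[OF bilinear_mult, unfolded real_scaleR_def]
  and wedge_zero_left = wedge_by_zero_left[OF bilinear_mult]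
  and wedge_zero_right = wedge_by_zero_right[OF bilinear_mult]

text \<open>Induction on the arguments: contraction with the first one is an antiderivation on both
  sides, which spares a bijection between threefold shuffles.\<close>

lemma wedge_assoc:
  "homogeneous k \<alpha> \<Longrightarrow> homogeneous l \<beta> \<Longrightarrow> wedge (wedge \<alpha> \<beta>) \<gamma> vs = wedge \<alpha> (wedge \<beta> \<gamma>) vs"
proof (induction vs arbitrary: k l \<alpha> \<beta> \<gamma>)
  case Nil
  show ?case by (simp add: wedge_by_Nil)
next
  case (Cons v vs)
  note ip = homogeneous_interior_product[of _ _ v]
  show ?case
    using Cons.IH[OF ip[OF Cons.prems(1)] Cons.prems(2)] Cons.IH[OF Cons.prems(1) ip[OF Cons.prems(2)]]
      Cons.IH[OF Cons.prems]
    by (simp add: wedge_Cons[OF homogeneous_wedge[OF Cons.prems]] wedge_Cons[OF Cons.prems(1)]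
        interior_product_wedge[OF Cons.prems(1)] interior_product_wedge[OF Cons.prems(2)]
        wedge_add_left wedge_add_right wedge_scale_left wedge_scale_right power_add distrib_left)
qed

lemma interior_product_oneform: "interior_product v (oneform a) = (\<lambda>us. if us = [] then blinfun_apply a v else 0)"
  by (auto simp: interior_product_def oneform_def)

lemma wedge_zero_form: "wedge (\<lambda>us. if us = [] then c else 0) \<gamma> vs = c * \<gamma> vs"
proof (induction vs arbitrary: \<gamma>)
  case Nil
  show ?case by (simp add: wedge_by_Nil)
next
  case (Cons v vs)
  have "homogeneous 0 (\<lambda>us::'a list. if us = [] then c else 0)" by (simp add: homogeneous_def)
  from wedge_Cons[OF this, of \<gamma> v vs] Cons[of "interior_product v \<gamma>"] show ?case
    by (simp add: interior_product_def wedge_zero_left)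
qed

lemma wedge_oneform_Cons:
  "wedge (oneform a) \<gamma> (v # vs) = blinfun_apply a v * \<gamma> vs - wedge (oneform a) (interior_product v \<gamma>) vs"
  by (simp add: wedge_Cons[OF homogeneous_oneform] interior_product_oneform wedge_zero_form)

lemma wedge_oneform_Nil: "wedge (oneform a) \<gamma> [] = 0"
  by (simp add: wedge_by_Nil oneform_def)

lemma interior_product_wedge_oneform: "interior_product v (wedge (oneform a) \<gamma>) =
    (\<lambda>us. blinfun_apply a v * \<gamma> us + (- 1) * wedge (oneform a) (interior_product v \<gamma>) us)"
  by (auto simp: interior_product_def wedge_oneform_Cons)

lemma wedge_oneform_anticommute:
  "wedge (oneform a) (wedge (oneform b) \<gamma>) vs = - wedge (oneform b) (wedge (oneform a) \<gamma>) vs"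
proof (induction vs arbitrary: \<gamma>)
  case Nil
  show ?case by (simp add: wedge_oneform_Nil)
next
  case (Cons v vs)
  show ?case
    unfolding wedge_oneform_Cons interior_product_wedge_oneform wedge_add_right wedge_scale_right
    using Cons[of "interior_product v \<gamma>"] by simp
qed

lemma wedge_oneform_self: "wedge (oneform a) (wedge (oneform a) \<gamma>) vs = 0"
  using wedge_oneform_anticommute[of a a \<gamma> vs] by simp

lemma homogeneous_ew: "homogeneous (length I) (ew e I)"
proof (induction I)
  case Nil
  show ?case by (simp add: homogeneous_def)
next
  case (Cons i I)
  show ?case using homogeneous_wedge[OF homogeneous_oneform Cons] by simp
qed

lemma wedge_ew: "wedge (ew e I) (ew e J) = ew e (I @ J)"
proof (induction I)
  case Nil
  show ?case by (simp add: wedge_zero_form)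
next
  case (Cons i I)
  show ?case
    using wedge_assoc[OF homogeneous_oneform homogeneous_ew] by (auto simp: Cons[symmetric] intro!: ext)
qed

lemma ew_singleton: "ew e [i] = oneform (e i)"
proof
  fix vs
  show "ew e [i] vs = oneform (e i) vs"
  proof (cases vs)
    case (Cons v us)
    have "interior_product v (ew e []) = (\<lambda>us. 0)" by (auto simp: interior_product_def)
    then show ?thesis
      unfolding Cons ew.simps(2) wedge_oneform_Cons by (simp add: wedge_zero_right) (simp add: oneform_def)
  qed (simp add: wedge_by_Nil oneform_def)
qed

lemma ew_swap: "ew e (i # j # I) vs = - ew e (j # i # I) vs"
  unfolding ew.simps by (rule wedge_oneform_anticommute)

lemma wedge_oneform_eq_0: "(\<And>v. v \<in> set vs \<Longrightarrow> blinfun_apply a v = 0) \<Longrightarrow> wedge (oneform a) \<gamma> vs = 0"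
  by (induction vs arbitrary: \<gamma>) (auto simp: wedge_oneform_Nil wedge_oneform_Cons)

lemma interior_product_ew_eq_0:
  "(\<And>i. i \<in> set I \<Longrightarrow> blinfun_apply (e i) v = 0) \<Longrightarrow> interior_product v (ew e I) = (\<lambda>us. 0)"
proof (induction I)
  case Nil
  show ?case by (auto simp: interior_product_def)
next
  case (Cons i I)
  then show ?case by (simp add: interior_product_wedge_oneform wedge_zero_right)
qed

text \<open>Multilinearity and alternation without a fixed degree are inherited by interior products, which
  makes inductions over argument lists possible.\<close>

definition multilinear :: "('a::real_vector, 'b::real_vector) form \<Rightarrow> bool" where
  "multilinear \<omega> \<longleftrightarrow> (\<forall>vs i. i < length vs \<longrightarrow> linear (\<lambda>v. \<omega> (vs[i := v])))"

definition alternates :: "('a, 'b::zero) form \<Rightarrow> bool" where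
  "alternates \<omega> \<longleftrightarrow> (\<forall>vs. \<not> distinct vs \<longrightarrow> \<omega> vs = 0)"

lemma multilinear_interior_product: "multilinear \<omega> \<Longrightarrow> multilinear (interior_product v \<omega>)"
proof -
  assume "multilinear \<omega>"
  then have "linear (\<lambda>w. \<omega> ((v # vs)[Suc i := w]))" if "i < length vs" for vs i
    using that unfolding multilinear_def by (metis Suc_mono length_Cons)
  then show ?thesis by (simp add: multilinear_def interior_product_def)
qed

lemma alternates_interior_product: "alternates \<omega> \<Longrightarrow> alternates (interior_product v \<omega>)"
  unfolding alternates_def interior_product_def by simp

lemma multilinear_linear_Cons: "multilinear \<omega> \<Longrightarrow> linear (\<lambda>v. \<omega> (v # vs))"
proof -
  assume "multilinear \<omega>"
  then have "0 < length (v # vs) \<longrightarrow> linear (\<lambda>w. \<omega> ((v # vs)[0 := w]))" for v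
    unfolding multilinear_def by blast
  then show ?thesis by simp
qed

lemma alternating_formI:
  "homogeneous k \<omega> \<Longrightarrow> multilinear \<omega> \<Longrightarrow> alternates \<omega> \<Longrightarrow> alternating_form k \<omega>"
  by (auto simp: alternating_form_def homogeneous_def multilinear_def alternates_def)

lemma alternating_formD:
  assumes "alternating_form k \<omega>"
  shows "homogeneous k \<omega>" "multilinear \<omega>" "alternates \<omega>"
proof -
  show "homogeneous k \<omega>" "alternates \<omega>"
    using assms by (auto simp: alternating_form_def homogeneous_def alternates_def)
  show "multilinear \<omega>"
    unfolding multilinear_def
  proof (intro allI impI)
    fix vs :: "'a list" and i assume "i < length vs"
    then show "linear (\<lambda>v. \<omega> (vs[i := v]))"
      using assms by (cases "length vs = k") (auto simp: alternating_form_def linear_zero)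
  qed
qed

text \<open>Polarization of the vanishing on two equal arguments v + w.\<close>

lemma alternates_swap:
  assumes "multilinear \<omega>" "alternates \<omega>"
  shows "\<omega> (v # w # us) = - \<omega> (w # v # us)"
proof -
  have z: "\<omega> (x # x # us) = 0" for x using assms(2) by (simp add: alternates_def)
  have l: "linear (\<lambda>x. \<omega> (x # y # us))" for y by (rule multilinear_linear_Cons[OF assms(1)])
  have r: "linear (\<lambda>y. \<omega> (x # y # us))" for x
    using multilinear_linear_Cons[OF multilinear_interior_product[OF assms(1), of x], of us]
    by (simp add: interior_product_def)
  have "\<omega> ((v + w) # (v + w) # us) = \<omega> (v # w # us) + \<omega> (w # v # us)"
    unfolding linear_add[OF l] linear_add[OF r] by (simp add: z)
  then show ?thesis unfolding z by (simp add: eq_neg_iff_add_eq_0)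
qed

lemma multilinear_wedge_oneform:
  fixes a :: "'a::real_normed_vector \<Rightarrow>\<^sub>L real"
  shows "multilinear \<gamma> \<Longrightarrow> multilinear (wedge (oneform a) \<gamma>)"
proof -
  have "linear (\<lambda>v. wedge (oneform a) \<gamma> (vs[i := v]))" if "multilinear \<gamma>" "i < length vs" for vs i
    using that
  proof (induction vs arbitrary: i \<gamma>)
    case Nil
    then show ?case by simp
  next
    case (Cons w vs)
    show ?case
    proof (cases i)
      case 0
      have lin: "linear (\<lambda>v. \<gamma> (v # us))" for us by (rule multilinear_linear_Cons[OF Cons.prems(1)])
      have "wedge (oneform a) (interior_product (x + y) \<gamma>) vs =
          wedge (oneform a) (interior_product x \<gamma>) vs + wedge (oneform a) (interior_product y \<gamma>) vs"
        "wedge (oneform a) (interior_product (c *\<^sub>R x) \<gamma>) vs = c * wedge (oneform a) (interior_product x \<gamma>) vs"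
        for x y c
        by (simp_all add: interior_product_def linear_add[OF lin] linear_scale[OF lin] wedge_add_right wedge_scale_right)
      then show ?thesis
        by (auto simp: 0 wedge_oneform_Cons blinfun.add_right blinfun.scaleR_right algebra_simps intro!: linearI)
    next
      case (Suc j)
      have "linear (\<lambda>v. wedge (oneform a) (interior_product w \<gamma>) (vs[j := v]))"
        using Cons.prems Suc by (intro Cons.IH multilinear_interior_product) auto
      moreover have "linear (\<lambda>v. blinfun_apply a w *\<^sub>R \<gamma> (vs[j := v]))"
        using Cons.prems Suc by (intro linear_compose_scale_right) (auto simp: multilinear_def)
      ultimately show ?thesis
        unfolding Suc list_update.simps nat.case wedge_oneform_Cons real_scaleR_def
        by (intro linear_compose_sub)
    qed
  qed
  then show "multilinear \<gamma> \<Longrightarrow> multilinear (wedge (oneform a) \<gamma>)" by (simp add: multilinear_def)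
qed

text \<open>The contraction formula deals with a repetition in the tail. A repetition that involves
  the head is moved into the tail by exchanging the first two arguments; this changes the tail,
  hence the induction on the length.\<close>

lemma alternates_wedge_oneform:
  fixes a :: "'a::real_normed_vector \<Rightarrow>\<^sub>L real"
  assumes "multilinear \<gamma>" "alternates \<gamma>"
  shows "alternates (wedge (oneform a) \<gamma>)"
proof -
  have swap: "wedge (oneform a) \<gamma> (v # w # us) = - wedge (oneform a) \<gamma> (w # v # us)"
    if "multilinear \<gamma>" "alternates \<gamma>" for v w us and \<gamma> :: "('a, real) form"
  proof -
    have "interior_product w (interior_product v \<gamma>) = (\<lambda>us. (- 1) * interior_product v (interior_product w \<gamma>) us)"
      by (simp add: interior_product_def alternates_swap[OF that, of v w])
    from arg_cong[OF this, of "\<lambda>\<omega>. wedge (oneform a) \<omega> us"]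
    have "wedge (oneform a) (interior_product w (interior_product v \<gamma>)) us =
        - wedge (oneform a) (interior_product v (interior_product w \<gamma>)) us"
      unfolding wedge_scale_right by simp
    moreover have "interior_product x \<gamma> us = \<gamma> (x # us)" for x by (simp add: interior_product_def)
    ultimately show ?thesis unfolding wedge_oneform_Cons by simp
  qed
  have "wedge (oneform a) \<gamma> vs = 0" if "multilinear \<gamma>" "alternates \<gamma>" "\<not> distinct vs" for vs \<gamma>
    using that
  proof (induction vs arbitrary: \<gamma> rule: length_induct)
    case (1 vs)
    have tail: "wedge (oneform a) \<gamma> (x # xs) = 0" if "length (x # xs) = length vs" "\<not> distinct xs" for x xs
      using 1 that multilinear_interior_product[OF 1(2), of x] alternates_interior_product[OF 1(3), of x]
      by (auto simp: wedge_oneform_Cons alternates_def)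
    obtain v w us where vs: "vs = v # w # us"
      using 1(4) by (metis distinct.simps(1) distinct_singleton neq_Nil_conv)
    consider "\<not> distinct (w # us)" | "v = w" | "\<not> distinct (v # us)" using 1(4) vs by auto
    then show ?case
    proof cases
      case 2
      then show ?thesis using swap[OF 1(2,3), of v v us] vs by simp
    next
      case 3
      then show ?thesis using swap[OF 1(2,3), of v w us] tail[of w "v # us"] vs by simp
    qed (use tail vs in auto)
  qed
  then show ?thesis using assms by (simp add: alternates_def)
qed

lemma multilinear_ew: "multilinear (ew e I)"
proof (induction I)
  case Nil
  show ?case by (auto simp: multilinear_def linear_zero)
qed (simp add: multilinear_wedge_oneform)

lemma alternates_ew: "alternates (ew e I)"
proof (induction I)
  case Nil
  show ?case by (auto simp: alternates_def)
qed (simp add: alternates_wedge_oneform multilinear_ew)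

section \<open>Exterior derivatives and linear combinations of basis forms\<close>

text \<open>In contrast to \<open>smooth_form\<close> this fixes neither degree nor alternation, so
  that it passes to contractions in the inductions below.\<close>

definition smooth_family :: "('a::real_normed_vector \<Rightarrow> ('b, 'c::real_normed_vector) form) \<Rightarrow> bool" where
  "smooth_family \<alpha> \<longleftrightarrow> (\<forall>vs. smooth (\<lambda>x. \<alpha> x vs))"

lemma smooth_family_interior_product:
  "smooth_family \<alpha> \<Longrightarrow> smooth_family (\<lambda>x. interior_product v (\<alpha> x))"
  by (simp add: smooth_family_def interior_product_def)

lemma smooth_family_wedge_by:
  assumes "bounded_bilinear b" "smooth_family \<alpha>" "smooth_family \<beta>"
  shows "smooth_family (\<lambda>x. wedge_by b (\<alpha> x) (\<beta> x))"
  using assms unfolding smooth_family_def wedge_by_def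
  by (auto intro!: smooth_sum smooth_bounded_linear_compose[OF bounded_linear_scaleR_right]
      bounded_bilinear.smooth_prod[OF assms(1)])

definition form_derivative :: "'a \<Rightarrow> ('a::real_normed_vector \<Rightarrow> ('b, 'c::real_normed_vector) form) \<Rightarrow> 'a \<Rightarrow> ('b, 'c) form" where
  "form_derivative v \<alpha> x = (\<lambda>vs. frechet_derivative (\<lambda>y. \<alpha> y vs) (at x) v)"

lemma form_derivative_wedge_by:
  assumes b: "bounded_bilinear b" and \<alpha>: "smooth_family \<alpha>" and \<beta>: "smooth_family \<beta>"
  shows "form_derivative v (\<lambda>y. wedge_by b (\<alpha> y) (\<beta> y)) x vs =
    wedge_by b (form_derivative v \<alpha> x) (\<beta> x) vs + wedge_by b (\<alpha> x) (form_derivative v \<beta> x) vs"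
proof -
  let ?D = "\<lambda>\<omega> vs. frechet_derivative (\<lambda>y. \<omega> y vs) (at x)"
  let ?s = "\<lambda>S. (- 1) ^ card {(i, j). i \<in> S \<and> j \<in> {..<length vs} - S \<and> j < i} :: real"
  have "((\<lambda>y. wedge_by b (\<alpha> y) (\<beta> y) vs) has_derivative (\<lambda>v. \<Sum>S\<in>Pow {..<length vs}.
      ?s S *\<^sub>R (b (\<alpha> x (nths vs S)) (?D \<beta> (nths vs (- S)) v) + b (?D \<alpha> (nths vs S) v) (\<beta> x (nths vs (- S)))))) (at x)"
    unfolding wedge_by_def
    using \<alpha> \<beta> unfolding smooth_family_def
    by (intro has_derivative_sum has_derivative_scaleR_right bounded_bilinear.FDERIV[OF b] smooth_has_derivative) auto
  from fun_cong[OF frechet_derivative_at[OF this], of v, symmetric] show ?thesis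
    by (simp add: form_derivative_def wedge_by_def scaleR_add_right sum.distrib add.commute)
qed

lemma ext_d_Nil: "ext_d \<omega> x [] = 0"
  by (simp add: ext_d_def)

text \<open>Cartan's formula for the constant vector field \<open>v\<close>.\<close>

lemma ext_d_Cons:
  "ext_d \<omega> x (v # vs) = form_derivative v \<omega> x vs - ext_d (\<lambda>y. interior_product v (\<omega> y)) x vs"
  unfolding ext_d_def form_derivative_def interior_product_def length_Cons sum.lessThan_Suc_shift
  by (simp add: sum_negf)

lemma homogeneous_ext_d:
  assumes "\<And>x. homogeneous k (\<omega> x)" shows "homogeneous (Suc k) (ext_d \<omega> x)"
  using assms by (auto simp: homogeneous_def ext_d_def min_def intro!: sum.neutral)

lemma ext_d_zero: "ext_d (\<lambda>x vs. 0) x vs = 0"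
  by (simp add: ext_d_def)

lemma form_derivative_add:
  "smooth_family \<alpha> \<Longrightarrow> smooth_family \<beta> \<Longrightarrow>
    form_derivative v (\<lambda>x us. \<alpha> x us + \<beta> x us) x vs = form_derivative v \<alpha> x vs + form_derivative v \<beta> x vs"
  using fun_cong[OF frechet_derivative_at[OF has_derivative_add[OF smooth_has_derivative smooth_has_derivative]],
    of "\<lambda>x. \<alpha> x vs" "\<lambda>x. \<beta> x vs" x v]
  by (simp add: form_derivative_def smooth_family_def)

lemma form_derivative_bounded_linear:
  assumes "bounded_linear l" "smooth_family \<alpha>"
  shows "form_derivative v (\<lambda>x us. l (\<alpha> x us)) x vs = l (form_derivative v \<alpha> x vs)"
  using frechet_derivative_bounded_linear[OF assms(1) smooth_differentiable, of "\<lambda>y. \<alpha> y vs" x] assms(2)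
  by (simp add: form_derivative_def smooth_family_def)

lemma ext_d_add:
  assumes "smooth_family \<alpha>" "smooth_family \<beta>"
  shows "ext_d (\<lambda>x us. \<alpha> x us + \<beta> x us) x vs = ext_d \<alpha> x vs + ext_d \<beta> x vs"
  using assms
proof (induction vs arbitrary: \<alpha> \<beta>)
  case (Cons v vs)
  show ?case
    using Cons.IH[OF Cons.prems[THEN smooth_family_interior_product]]
    by (simp add: ext_d_Cons form_derivative_add[OF Cons.prems] interior_product_def)
qed (simp add: ext_d_Nil)

lemma ext_d_bounded_linear:
  assumes "bounded_linear l" "smooth_family \<alpha>"
  shows "ext_d (\<lambda>x us. l (\<alpha> x us)) x vs = l (ext_d \<alpha> x vs)"
  using assms(2)
proof (induction vs arbitrary: \<alpha>)
  case Nil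
  show ?case using assms(1) by (simp add: ext_d_Nil linear_0 bounded_linear.linear)
next
  case (Cons v vs)
  show ?case
    using Cons.IH[OF Cons.prems[THEN smooth_family_interior_product]] linear_diff[OF bounded_linear.linear[OF assms(1)]]
    by (simp add: ext_d_Cons form_derivative_bounded_linear[OF assms(1) Cons.prems] interior_product_def)
qed

lemmas ext_d_scale = ext_d_bounded_linear[OF bounded_linear_mult_right]

text \<open>Induction on the arguments: \<open>ext_d_Cons\<close> trades the differential for
  \<open>form_derivative\<close>, which is a derivation, and the differential of a contracted form,
  and contraction is an antiderivation.\<close>

lemma ext_d_wedge:
  fixes \<alpha> \<beta> :: "'a::euclidean_space \<Rightarrow> ('a, real) form"
  assumes "\<And>x. homogeneous k (\<alpha> x)" "smooth_family \<alpha>" "smooth_family \<beta>"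
  shows "ext_d (\<lambda>x. wedge (\<alpha> x) (\<beta> x)) x vs = wedge (ext_d \<alpha> x) (\<beta> x) vs + (- 1) ^ k * wedge (\<alpha> x) (ext_d \<beta> x) vs"
  using assms
proof (induction vs arbitrary: k \<alpha> \<beta>)
  case Nil
  show ?case using homogeneousD[OF homogeneous_ext_d[OF Nil(1)], of "[]"]
    by (simp add: wedge_by_Nil ext_d_Nil)
next
  case (Cons v vs)
  let ?\<iota> = "\<lambda>\<omega> x. interior_product v (\<omega> x)"
  note hom = Cons.prems(1) and sm = Cons.prems(2,3)
  note sm' = sm[THEN smooth_family_interior_product, of v]
  note bb = bounded_bilinear_mult
  have \<iota>d: "interior_product v (ext_d \<omega> x) = (\<lambda>us. form_derivative v \<omega> x us + (- 1) * ext_d (?\<iota> \<omega>) x us)"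
    for \<omega> :: "'a \<Rightarrow> ('a, real) form"
    by (auto simp: interior_product_def ext_d_Cons)
  have IH1: "ext_d (\<lambda>x. wedge (?\<iota> \<alpha> x) (\<beta> x)) x vs =
      wedge (ext_d (?\<iota> \<alpha>) x) (\<beta> x) vs + (- 1) ^ (k + 1) * wedge (?\<iota> \<alpha> x) (ext_d \<beta> x) vs"
  \<comment> \<open>The contracted form has degree \<open>k - 1\<close>, and
    \<open>(- 1) ^ (k + 1)\<close> is the sign of that degree. For \<open>k = 0\<close> the
    contracted form vanishes and both sides are zero.\<close>
  proof (cases k)
    case 0
    then have "interior_product v (\<alpha> y) = (\<lambda>us. 0)" for y
      using hom by (auto simp: fun_eq_iff interior_product_def homogeneous_def)
    moreover have "(\<lambda>y. wedge (\<lambda>us. 0) (\<beta> y)) = (\<lambda>y us. 0)" by (simp add: fun_eq_iff wedge_zero_left)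
    moreover have "ext_d (\<lambda>y us. 0) x = (\<lambda>us. 0 :: real)" by (auto simp: ext_d_zero)
    ultimately show ?thesis by (simp add: wedge_zero_left)
  next
    case (Suc m)
    then show ?thesis
      using Cons.IH[of m "?\<iota> \<alpha>" \<beta>] homogeneous_interior_product[OF hom] sm sm' by simp
  qed
  have IH2: "ext_d (\<lambda>x. wedge (\<alpha> x) (?\<iota> \<beta> x)) x vs =
      wedge (ext_d \<alpha> x) (?\<iota> \<beta> x) vs + (- 1) ^ k * wedge (\<alpha> x) (ext_d (?\<iota> \<beta>) x) vs"
    by (rule Cons.IH[OF hom sm(1) sm'(2)])
  have "ext_d (\<lambda>x. wedge (\<alpha> x) (\<beta> x)) x (v # vs) =
      wedge (form_derivative v \<alpha> x) (\<beta> x) vs + wedge (\<alpha> x) (form_derivative v \<beta> x) vs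
      - (ext_d (\<lambda>x. wedge (?\<iota> \<alpha> x) (\<beta> x)) x vs + (- 1) ^ k * ext_d (\<lambda>x. wedge (\<alpha> x) (?\<iota> \<beta> x)) x vs)"
  proof -
    have sm1: "smooth_family (\<lambda>x. wedge (?\<iota> \<alpha> x) (\<beta> x))" and sm2: "smooth_family (\<lambda>x. wedge (\<alpha> x) (?\<iota> \<beta> x))"
      by (intro smooth_family_wedge_by bb sm sm')+
    have "smooth_family (\<lambda>x us. (- 1) ^ k * wedge (\<alpha> x) (?\<iota> \<beta> x) us)"
      using sm2 unfolding smooth_family_def by (auto intro: smooth_bounded_linear_compose[OF bounded_linear_mult_right])
    from ext_d_add[OF sm1 this] show ?thesis
      unfolding ext_d_Cons form_derivative_wedge_by[OF bb sm] interior_product_wedge[OF hom]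
      by (simp add: ext_d_scale[OF sm2])
  qed
  then show ?case
    unfolding IH1 IH2 wedge_Cons[OF homogeneous_ext_d[OF hom]] wedge_Cons[OF hom] \<iota>d
      wedge_add_left wedge_add_right wedge_scale_left wedge_scale_right
    by (simp add: algebra_simps)
qed

section \<open>Formal linear combinations of products of coframe elements\<close>

type_synonym term_list = "(real \<times> nat list) list"

text \<open>Index lists may be unsorted or repeat an index, and a list may occur in several terms.
  The operations on forms thus become plain list functions that \<open>simp\<close> can run; a
  normal form, \<open>collect_terms\<close>, is taken only for comparisons.\<close>

definition lin_comb :: "(nat \<Rightarrow> ('a::real_normed_vector \<Rightarrow>\<^sub>L real)) \<Rightarrow> term_list \<Rightarrow> ('a, real) form" where
  "lin_comb e p vs = (\<Sum>(c, I)\<leftarrow>p. c * ew e I vs)"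

lemma lin_comb_Nil: "lin_comb e [] = (\<lambda>vs. 0)"
  and lin_comb_Cons: "lin_comb e ((c, I) # p) = (\<lambda>vs. c * ew e I vs + lin_comb e p vs)"
  and lin_comb_append: "lin_comb e (p @ q) = (\<lambda>vs. lin_comb e p vs + lin_comb e q vs)"
  by (auto simp: lin_comb_def fun_eq_iff)

definition scale_terms :: "real \<Rightarrow> term_list \<Rightarrow> term_list" where
  "scale_terms c p = map (\<lambda>(d, I). (c * d, I)) p"

lemma lin_comb_scale: "lin_comb e (scale_terms c p) = (\<lambda>vs. c * lin_comb e p vs)"
  by (auto simp: lin_comb_def scale_terms_def fun_eq_iff sum_list_const_mult[symmetric] comp_def
      case_prod_unfold mult.assoc)

definition wedge_terms :: "term_list \<Rightarrow> term_list \<Rightarrow> term_list" where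
  "wedge_terms p q = concat (map (\<lambda>(c, I). map (\<lambda>(d, J). (c * d, I @ J)) q) p)"

lemma wedge_lin_comb: "wedge (lin_comb e p) (lin_comb e q) = lin_comb e (wedge_terms p q)"
proof -
  have 1: "wedge (ew e I) (lin_comb e q) vs = (\<Sum>(d, J)\<leftarrow>q. d * ew e (I @ J) vs)" for I vs
  proof (induction q)
    case (Cons t q)
    then show ?case
      by (cases t) (simp add: lin_comb_Cons wedge_add_right wedge_scale_right wedge_ew)
  qed (simp add: lin_comb_Nil wedge_zero_right)
  have 2: "lin_comb e (map (\<lambda>(d, J). (c * d, I @ J)) q) vs = c * (\<Sum>(d, J)\<leftarrow>q. d * ew e (I @ J) vs)" for c I vs
    by (simp add: lin_comb_def sum_list_const_mult[symmetric] comp_def case_prod_unfold mult.assoc)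
  have "wedge (lin_comb e p) (lin_comb e q) vs = lin_comb e (wedge_terms p q) vs" for vs
  proof (induction p)
    case (Cons t p)
    then show ?case
      by (cases t) (simp add: lin_comb_Cons wedge_terms_def lin_comb_append wedge_add_left wedge_scale_left 1 2)
  qed (simp add: lin_comb_Nil wedge_zero_left wedge_terms_def)
  then show ?thesis by auto
qed

definition homogeneous_terms :: "nat \<Rightarrow> term_list \<Rightarrow> bool" where
  "homogeneous_terms k p \<longleftrightarrow> (\<forall>(c, I)\<in>set p. length I = k)"

lemma homogeneous_lin_comb: "homogeneous_terms k p \<Longrightarrow> homogeneous k (lin_comb e p)"
  by (induction p) (use homogeneous_ew[of _ e] in \<open>auto simp: lin_comb_Nil lin_comb_Cons homogeneous_def homogeneous_terms_def\<close>)

lemma multilinear_lin_comb: "multilinear (lin_comb e p)"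
proof (induction p)
  case (Cons t p)
  have "linear (\<lambda>v. fst t *\<^sub>R ew e (snd t) (vs[i := v]))" if "i < length vs" for vs i
    using multilinear_ew[of e "snd t"] that unfolding multilinear_def by (intro linear_compose_scale_right) blast
  with Cons show ?case
    by (cases t) (auto simp: lin_comb_Cons multilinear_def intro: linear_compose_add)
qed (auto simp: lin_comb_Nil multilinear_def linear_zero)

lemma alternates_lin_comb: "alternates (lin_comb e p)"
  by (induction p) (use alternates_ew[of e] in \<open>auto simp: lin_comb_Nil lin_comb_Cons alternates_def\<close>)

lemma smooth_family_oneform:
  assumes "\<And>v. smooth (\<lambda>x. blinfun_apply (a x) v)"
  shows "smooth_family (\<lambda>x. oneform (a x))"
  unfolding smooth_family_def
proof
  fix vs show "smooth (\<lambda>x. oneform (a x) vs)"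
    by (cases "length vs = 1") (simp_all add: oneform_def assms smooth_const)
qed

lemma smooth_family_ew:
  assumes "\<And>i v. smooth (\<lambda>x. blinfun_apply (f x i) v)"
  shows "smooth_family (\<lambda>x. ew (f x) I)"
proof (induction I)
  case (Cons i I)
  from smooth_family_wedge_by[OF bounded_bilinear_mult smooth_family_oneform[of "\<lambda>x. f x i"] Cons] assms show ?case by simp
qed (simp add: smooth_family_def smooth_const)

lemma smooth_family_lin_comb:
  assumes "\<And>i v. smooth (\<lambda>x. blinfun_apply (f x i) v)"
  shows "smooth_family (\<lambda>x. lin_comb (f x) p)"
proof (induction p)
  case (Cons t p)
  then show ?case
    using smooth_family_ew[of f, OF assms] by (cases t) (auto simp: lin_comb_Cons smooth_family_def intro!: smooth_add smooth_mult smooth_const)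
qed (simp add: lin_comb_Nil smooth_family_def smooth_const)

text \<open>The Leibniz rule on a product of 1-forms, where \<open>s i\<close> lists the terms of
  the differential of the i-th one; the minus sign comes from passing that 1-form.\<close>

primrec d_index :: "(nat \<Rightarrow> term_list) \<Rightarrow> nat list \<Rightarrow> term_list" where
  "d_index s [] = []"
| "d_index s (i # I) = map (\<lambda>(c, J). (c, J @ I)) (s i) @ map (\<lambda>(c, J). (- c, i # J)) (d_index s I)"

definition d_terms :: "(nat \<Rightarrow> term_list) \<Rightarrow> term_list \<Rightarrow> term_list" where
  "d_terms s p = concat (map (\<lambda>(c, I). scale_terms c (d_index s I)) p)"

lemma ext_d_ew:
  fixes f :: "'a::euclidean_space \<Rightarrow> nat \<Rightarrow> ('a \<Rightarrow>\<^sub>L real)"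
  assumes sm: "\<And>i v. smooth (\<lambda>x. blinfun_apply (f x i) v)"
    and s: "\<And>i x. i \<in> set I \<Longrightarrow> ext_d (\<lambda>y. oneform (f y i)) x = lin_comb (f x) (s i)"
  shows "ext_d (\<lambda>y. ew (f y) I) x = lin_comb (f x) (d_index s I)"
  using s
proof (induction I)
  case Nil
  show ?case
  proof
    fix vs :: "'a list"
    show "ext_d (\<lambda>y. ew (f y) []) x vs = lin_comb (f x) (d_index s []) vs"
      by (simp add: ext_d_def lin_comb_Nil if_distrib)
  qed
next
  case (Cons i I)
  show ?case
  proof
    fix vs :: "'a list"
    have sm1: "smooth_family (\<lambda>x. oneform (f x i))"
      by (rule smooth_family_oneform[OF sm])
    have 1: "wedge (lin_comb (f x) (s i)) (ew (f x) I) vs = lin_comb (f x) (map (\<lambda>(c, J). (c, J @ I)) (s i)) vs"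
    proof -
      have "ew (f x) I = lin_comb (f x) [(1, I)]" by (auto simp: lin_comb_def)
      then show ?thesis
        by (simp only: wedge_lin_comb) (simp add: wedge_terms_def case_prod_unfold comp_def concat_map_singleton)
    qed
    have 2: "wedge (oneform (f x i)) (lin_comb (f x) (d_index s I)) vs =
        - lin_comb (f x) (map (\<lambda>(c, J). (- c, i # J)) (d_index s I)) vs"
    proof -
      have eq: "oneform (f x i) = lin_comb (f x) [(1, [i])]"
        by (auto simp: lin_comb_def ew_singleton simp del: ew.simps)
      show ?thesis
        unfolding eq wedge_lin_comb
        by (simp add: wedge_terms_def lin_comb_def case_prod_unfold comp_def uminus_sum_list_map del: ew.simps)
    qed
    have "ext_d (\<lambda>y. ew (f y) (i # I)) x vs = wedge (ext_d (\<lambda>y. oneform (f y i)) x) (ew (f x) I) vs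
        - wedge (oneform (f x i)) (ext_d (\<lambda>y. ew (f y) I) x) vs"
      using ext_d_wedge[OF homogeneous_oneform sm1 smooth_family_ew[of f I, OF sm], of x vs] by simp
    also have "ext_d (\<lambda>y. oneform (f y i)) x = lin_comb (f x) (s i)" using Cons.prems by simp
    also have "ext_d (\<lambda>y. ew (f y) I) x = lin_comb (f x) (d_index s I)" using Cons by simp
    finally show "ext_d (\<lambda>y. ew (f y) (i # I)) x vs = lin_comb (f x) (d_index s (i # I)) vs"
      unfolding 1 2 by (simp add: lin_comb_append)
  qed
qed

lemma ext_d_lin_comb:
  fixes f :: "'a::euclidean_space \<Rightarrow> nat \<Rightarrow> ('a \<Rightarrow>\<^sub>L real)"
  assumes sm: "\<And>i v. smooth (\<lambda>x. blinfun_apply (f x i) v)"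
    and s: "\<And>i x. i \<in> N \<Longrightarrow> ext_d (\<lambda>y. oneform (f y i)) x = lin_comb (f x) (s i)"
    and p: "\<forall>(c, I)\<in>set p. set I \<subseteq> N"
  shows "ext_d (\<lambda>y. lin_comb (f y) p) x = lin_comb (f x) (d_terms s p)"
  using p
proof (induction p)
  case Nil
  show ?case by (auto simp: lin_comb_Nil d_terms_def ext_d_zero)
next
  case (Cons t p)
  obtain c I where t: "t = (c, I)" by fastforce
  have sm1: "smooth_family (\<lambda>x. ew (f x) I)" by (rule smooth_family_ew[OF sm])
  then have sm2: "smooth_family (\<lambda>x us. c * ew (f x) I us)"
    by (auto simp: smooth_family_def intro: smooth_mult smooth_const)
  have "ext_d (\<lambda>y. ew (f y) I) x = lin_comb (f x) (d_index s I)"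
    using Cons.prems by (intro ext_d_ew sm s) (auto simp: t)
  then show ?case
    using ext_d_add[OF sm2 smooth_family_lin_comb[of f, OF sm]] Cons
    by (auto simp: t lin_comb_Cons d_terms_def lin_comb_append lin_comb_scale ext_d_scale[OF sm1] fun_eq_iff)
qed

text \<open>A repeated index is signalled by the sign \<open>0\<close>; the list returned with it is junk.\<close>

fun insert_index :: "nat \<Rightarrow> nat list \<Rightarrow> real \<times> nat list" where
  "insert_index i [] = (1, [i])"
| "insert_index i (j # J) = (if i < j then (1, i # j # J) else if i = j then (0, [])
     else case insert_index i J of (s, K) \<Rightarrow> (- s, j # K))"

primrec sort_index :: "nat list \<Rightarrow> real \<times> nat list" where
  "sort_index [] = (1, [])"
| "sort_index (i # I) = (case sort_index I of (s, J) \<Rightarrow> case insert_index i J of (t, K) \<Rightarrow> (s * t, K))"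

lemma ew_insert_index: "ew e (i # J) vs = fst (insert_index i J) * ew e (snd (insert_index i J)) vs"
proof (induction i J arbitrary: vs rule: insert_index.induct)
  case (2 i j J)
  show ?case
  proof (cases "i < j \<or> i = j")
    case True
    then show ?thesis using wedge_oneform_self by auto
  next
    case False
    obtain s K where sK: "insert_index i J = (s, K)" by fastforce
    have "ew e (i # J) = (\<lambda>vs. s * ew e K vs)" using 2 False by (auto simp: sK)
    then have "ew e (j # i # J) vs = s * ew e (j # K) vs"
      by (simp add: wedge_scale_right)
    then show ?thesis
      using False by (subst ew_swap) (simp add: sK del: ew.simps)
  qed
qed simp

lemma ew_sort_index: "ew e I vs = fst (sort_index I) * ew e (snd (sort_index I)) vs"
proof (induction I arbitrary: vs)
  case (Cons i I)
  obtain s J where sJ: "sort_index I = (s, J)" by fastforce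
  have "ew e I = (\<lambda>vs. s * ew e J vs)" using Cons by (auto simp: sJ)
  then have "ew e (i # I) vs = s * ew e (i # J) vs" by (simp add: wedge_scale_right)
  then show ?case
    by (subst (asm) ew_insert_index) (simp add: sJ case_prod_unfold del: ew.simps)
qed simp

fun add_term :: "real \<Rightarrow> nat list \<Rightarrow> term_list \<Rightarrow> term_list" where
  "add_term c I [] = [(c, I)]"
| "add_term c I ((d, J) # p) = (if I = J then (c + d, J) # p else (d, J) # add_term c I p)"

text \<open>Terms with coefficient zero are kept, because whether a polynomial in the structure
  constants vanishes is decided only later.\<close>

primrec collect_terms :: "term_list \<Rightarrow> term_list" where
  "collect_terms [] = []"
| "collect_terms (t # p) = (case sort_index (snd t) of (s, I) \<Rightarrow> add_term (fst t * s) I (collect_terms p))"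

lemma lin_comb_add_term: "lin_comb e (add_term c I p) vs = c * ew e I vs + lin_comb e p vs"
  by (induction c I p rule: add_term.induct) (auto simp: lin_comb_Cons lin_comb_Nil algebra_simps)

lemma lin_comb_collect_terms: "lin_comb e (collect_terms p) = lin_comb e p"
proof -
  have "lin_comb e (collect_terms p) vs = lin_comb e p vs" for vs
  proof (induction p)
    case (Cons t p)
    then show ?case
      by (cases t) (simp add: lin_comb_add_term lin_comb_Cons case_prod_unfold ew_sort_index[symmetric])
  qed simp
  then show ?thesis by auto
qed

section \<open>Orthonormal frames and the Hodge star\<close>

lemma orthonormal_frame_expansion:
  fixes g :: "'a::euclidean_space \<Rightarrow> 'a \<Rightarrow> real"
  assumes g: "inner_product g" and E: "orthonormal_frame g E"
  shows "v = (\<Sum>i<DIM('a). g v (E ! i) *\<^sub>R E ! i)"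
proof -
  have bil: "bilinear g" and pos: "\<And>x. x \<noteq> 0 \<Longrightarrow> g x x > 0" using g by (auto simp: inner_product_def)
  have lin: "linear (\<lambda>x. g x y)" "linear (g x)" for x y using bil by (auto simp: bilinear_def)
  have len: "length E = DIM('a)" and on: "\<And>i j. i < DIM('a) \<Longrightarrow> j < DIM('a) \<Longrightarrow> g (E ! i) (E ! j) = (if i = j then 1 else 0)"
    using E by (auto simp: orthonormal_frame_def)
  have coord: "g (\<Sum>i<DIM('a). c i *\<^sub>R E ! i) (E ! j) = c j" if "j < DIM('a)" for c j
    using that by (simp add: linear_sum[OF lin(1)] linear_scale[OF lin(1)] on if_distrib sum.delta cong: if_cong)
  have inj: "inj_on ((!) E) {..<DIM('a)}"
    using on by (intro inj_onI) (metis lessThan_iff zero_neq_one)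
  have "independent ((!) E ` {..<DIM('a)})"
  proof (rule independent_if_scalars_zero)
    fix c x assume 0: "(\<Sum>x\<in>(!) E ` {..<DIM('a)}. c x *\<^sub>R x) = 0" and x: "x \<in> (!) E ` {..<DIM('a)}"
    from x obtain j where j: "j < DIM('a)" "x = E ! j" by auto
    from 0 have "(\<Sum>i<DIM('a). c (E ! i) *\<^sub>R E ! i) = 0" by (simp add: sum.reindex[OF inj])
    from arg_cong[OF this, of "\<lambda>v. g v (E ! j)"] coord[OF j(1), of "\<lambda>i. c (E ! i)"] show "c x = 0"
      by (simp add: linear_0[OF lin(1)] j(2))
  qed simp
  then have "UNIV \<subseteq> span ((!) E ` {..<DIM('a)})"
    by (intro card_ge_dim_independent) (simp_all add: card_image[OF inj])
  then have "v \<in> span ((!) E ` {..<DIM('a)})" by auto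
  then obtain c where "v = (\<Sum>x\<in>(!) E ` {..<DIM('a)}. c x *\<^sub>R x)"
    by (auto simp: span_finite)
  then have v: "v = (\<Sum>i<DIM('a). c (E ! i) *\<^sub>R E ! i)" by (simp add: sum.reindex[OF inj])
  have "g v (E ! i) = c (E ! i)" if "i < DIM('a)" for i
    by (subst v) (rule coord[OF that])
  with v show ?thesis by (metis (no_types, lifting) lessThan_iff sum.cong)
qed

text \<open>For h a product of two linear functionals this is frame independence of the inner
  product in degree one. Arbitrary h makes room for the induction on the degree in
  \<open>frame_sum_invariant\<close>.\<close>

lemma orthonormal_frame_trace:
  fixes g :: "'a::euclidean_space \<Rightarrow> 'a \<Rightarrow> real" and h :: "'a \<Rightarrow> 'a \<Rightarrow> real"
  assumes g: "inner_product g" and E: "orthonormal_frame g E" and B: "orthonormal_frame g B" and h: "bilinear h"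
  shows "(\<Sum>i<DIM('a). h (E ! i) (E ! i)) = (\<Sum>i<DIM('a). h (B ! i) (B ! i))"
proof -
  let ?n = "DIM('a)"
  have sym: "g x y = g y x" and bil: "bilinear g" for x y using g by (auto simp: inner_product_def)
  have lin: "linear (\<lambda>x. g x y)" for y using bil by (auto simp: bilinear_def)
  have linh: "linear (\<lambda>x. h x y)" "linear (h x)" for x y using h by (auto simp: bilinear_def)
  have on: "g (B ! j) (B ! k) = (if j = k then 1 else 0)" if "j < ?n" "k < ?n" for j k
    using B that by (auto simp: orthonormal_frame_def)
  have gg: "(\<Sum>i<?n. g (E ! i) (B ! j) * g (E ! i) (B ! k)) = (if j = k then 1 else 0)" if "j < ?n" "k < ?n" for j k
  proof -
    have "g (B ! j) (B ! k) = g (\<Sum>i<?n. g (B ! j) (E ! i) *\<^sub>R E ! i) (B ! k)"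
      using orthonormal_frame_expansion[OF g E, of "B ! j"] by simp
    also have "\<dots> = (\<Sum>i<?n. g (E ! i) (B ! j) * g (E ! i) (B ! k))"
      by (simp add: linear_sum[OF lin] linear_scale[OF lin]) (simp add: sym)
    finally show ?thesis using on that by simp
  qed
  have "h (E ! i) (E ! i) = (\<Sum>j<?n. \<Sum>k<?n. g (E ! i) (B ! j) * g (E ! i) (B ! k) * h (B ! j) (B ! k))" for i
  proof -
    have "h (E ! i) (E ! i) = h (\<Sum>j<?n. g (E ! i) (B ! j) *\<^sub>R B ! j) (\<Sum>k<?n. g (E ! i) (B ! k) *\<^sub>R B ! k)"
      using orthonormal_frame_expansion[OF g B, of "E ! i"] by simp
    then show ?thesis
      by (subst sum.swap) (simp add: linear_sum[OF linh(1)] linear_sum[OF linh(2)] linear_scale[OF linh(1)] linear_scale[OF linh(2)]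
          sum_distrib_left mult_ac)
  qed
  then have "(\<Sum>i<?n. h (E ! i) (E ! i)) =
      (\<Sum>i<?n. \<Sum>j<?n. \<Sum>k<?n. g (E ! i) (B ! j) * g (E ! i) (B ! k) * h (B ! j) (B ! k))" by simp
  also have "\<dots> = (\<Sum>j<?n. \<Sum>k<?n. \<Sum>i<?n. g (E ! i) (B ! j) * g (E ! i) (B ! k) * h (B ! j) (B ! k))"
    by (subst sum.swap, rule sum.cong[OF refl], rule sum.swap)
  also have "\<dots> = (\<Sum>j<?n. \<Sum>k<?n. (if j = k then 1 else 0) * h (B ! j) (B ! k))"
    by (intro sum.cong refl) (simp add: sum_distrib_right[symmetric] gg)
  also have "\<dots> = (\<Sum>j<?n. h (B ! j) (B ! j))"
    by (simp add: if_distrib[of "\<lambda>c. c * _"] cong: if_cong)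
  finally show ?thesis .
qed

text \<open>For an orthonormal frame this is the induced inner product of k-forms.\<close>

definition frame_sum :: "nat \<Rightarrow> 'a list \<Rightarrow> ('a, real) form \<Rightarrow> ('a, real) form \<Rightarrow> real" where
  "frame_sum k E \<beta> \<gamma> = (\<Sum>S | S \<subseteq> {..<length E} \<and> card S = k. \<beta> (nths E S) * \<gamma> (nths E S))"

lemma alternates_move:
  fixes \<beta> :: "('a::real_vector, real) form"
  shows "multilinear \<beta> \<Longrightarrow> alternates \<beta> \<Longrightarrow> \<beta> (x # us @ ws) = (- 1) ^ length us * \<beta> (us @ x # ws)"
proof (induction us arbitrary: \<beta>)
  case (Cons u us)
  have "\<beta> (x # (u # us) @ ws) = - interior_product u \<beta> (x # us @ ws)"
    using alternates_swap[OF Cons.prems, of x u "us @ ws"] by (simp add: interior_product_def)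
  then show ?case
    using Cons.IH[OF multilinear_interior_product[OF Cons.prems(1)] alternates_interior_product[OF Cons.prems(2)], of u]
    by (simp add: interior_product_def)
qed simp

lemma nths_insert:
  assumes "i < length E" "i \<notin> S"
  shows "\<exists>us ws. nths E S = us @ ws \<and> nths E (insert i S) = us @ E ! i # ws"
proof -
  have E: "E = take i E @ E ! i # drop (Suc i) E" using id_take_nth_drop[OF assms(1)] .
  have len: "length (take i E) = i" using assms(1) by simp
  have "nths (take i E) (insert i S) = nths (take i E) S"
    unfolding nths_def by (intro arg_cong[of _ _ "map fst"] filter_cong) (auto simp: set_zip)
  moreover have "{j. Suc j + i \<in> insert i S} = {j. Suc j + i \<in> S}" by auto
  ultimately show ?thesis
    using assms(2)
    by (subst (1 2) E, unfold nths_append nths_Cons len)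
      (intro exI[of _ "nths (take i E) S"] exI[of _ "nths (drop (Suc i) E) {j. Suc j + i \<in> S}"], simp)
qed

text \<open>A set T with k + 1 elements arises from k + 1 pairs, an element i of T together with T -
  {i}. Moving \<open>E ! i\<close> from the front to its place costs the same sign in both factors,
  so the signs cancel.\<close>

lemma frame_sum_Suc:
  fixes \<beta> \<gamma> :: "('a::real_vector, real) form"
  assumes "multilinear \<beta>" "alternates \<beta>" "multilinear \<gamma>" "alternates \<gamma>"
  shows "real (Suc k) * frame_sum (Suc k) E \<beta> \<gamma> =
    (\<Sum>i<length E. frame_sum k E (interior_product (E ! i) \<beta>) (interior_product (E ! i) \<gamma>))"
proof -
  let ?n = "length E"
  define P where "P m = {S. S \<subseteq> {..<?n} \<and> card S = m}" for m
  have fin: "finite (P m)" for m unfolding P_def by (rule finite_subset[of _ "Pow {..<?n}"]) auto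
  define H where "H S = \<beta> (nths E S) * \<gamma> (nths E S)" for S
  have summand: "interior_product (E ! i) \<beta> (nths E S) * interior_product (E ! i) \<gamma> (nths E S) =
      (if i \<in> S then 0 else H (insert i S))" if i: "i < ?n" for i S
  proof (cases "i \<in> S")
    case True
    then have "E ! i \<in> set (nths E S)" using i by (auto simp: set_nths)
    then show ?thesis using True assms(2) by (auto simp: interior_product_def alternates_def)
  next
    case False
    from nths_insert[OF i this] obtain us ws where
      "nths E S = us @ ws" "nths E (insert i S) = us @ E ! i # ws" by auto
    then show ?thesis
      using False alternates_move[OF assms(1,2), of "E ! i" us ws] alternates_move[OF assms(3,4), of "E ! i" us ws]
      by (simp add: interior_product_def H_def mult.left_commute mult.assoc flip: power_mult_distrib)
  qed
  have "(\<Sum>i<?n. frame_sum k E (interior_product (E ! i) \<beta>) (interior_product (E ! i) \<gamma>)) =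
      (\<Sum>i<?n. \<Sum>S\<in>P k. if i \<in> S then 0 else H (insert i S))"
    unfolding frame_sum_def P_def[symmetric] by (intro sum.cong refl) (simp add: summand)
  also have "\<dots> = (\<Sum>i<?n. \<Sum>S | S \<in> P k \<and> i \<notin> S. H (insert i S))"
    by (intro sum.cong refl sum.mono_neutral_cong_right fin) auto
  also have "\<dots> = (\<Sum>(i, S)\<in>Sigma {..<?n} (\<lambda>i. {S. S \<in> P k \<and> i \<notin> S}). H (insert i S))"
    by (rule sum.Sigma) (auto intro: finite_subset[OF _ fin])
  also have "\<dots> = (\<Sum>(T, i)\<in>Sigma (P (Suc k)) (\<lambda>T. T). H T)"
    by (rule sum.reindex_bij_witness[where i = "\<lambda>(T, i). (i, T - {i})" and j = "\<lambda>(i, S). (insert i S, i)"])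
      (auto simp: P_def insert_absorb card_Diff_singleton finite_subset[OF _ finite_lessThan] card_insert_if
        dest: finite_subset[OF _ finite_lessThan])
  also have "\<dots> = (\<Sum>T\<in>P (Suc k). \<Sum>i\<in>T. H T)"
    by (rule sum.Sigma[symmetric]) (use fin in \<open>auto simp: P_def intro: finite_subset[OF _ finite_lessThan]\<close>)
  also have "\<dots> = real (Suc k) * frame_sum (Suc k) E \<beta> \<gamma>"
    unfolding frame_sum_def P_def[symmetric] H_def[symmetric] sum_distrib_left
    by (intro sum.cong refl) (simp add: P_def)
  finally show ?thesis by simp
qed

text \<open>Induction on the degree through \<open>frame_sum_Suc\<close>: the induction hypothesis
  changes the frame in the remaining slots, \<open>orthonormal_frame_trace\<close> changes it in the
  slot split off. This replaces a computation with minors of an orthogonal matrix.\<close>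

lemma frame_sum_invariant:
  fixes g :: "'a::euclidean_space \<Rightarrow> 'a \<Rightarrow> real"
  assumes g: "inner_product g" and E: "orthonormal_frame g E" and B: "orthonormal_frame g B"
  shows "multilinear \<beta> \<Longrightarrow> alternates \<beta> \<Longrightarrow> multilinear \<gamma> \<Longrightarrow> alternates \<gamma> \<Longrightarrow>
    frame_sum k E \<beta> \<gamma> = frame_sum k B \<beta> \<gamma>"
proof (induction k arbitrary: \<beta> \<gamma>)
  case 0
  have "{S. S \<subseteq> {..<m} \<and> card S = 0} = {{}}" for m :: nat
    by (auto dest: finite_subset[OF _ finite_lessThan])
  then show ?case by (simp add: frame_sum_def)
next
  case (Suc k)
  have len: "length E = DIM('a)" "length B = DIM('a)" using E B by (auto simp: orthonormal_frame_def)
  let ?h = "\<lambda>u w. frame_sum k B (interior_product u \<beta>) (interior_product w \<gamma>)"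
  have "bilinear ?h"
    unfolding bilinear_def
  proof (intro conjI allI)
    fix w
    have l: "linear (\<lambda>u. \<beta> (u # vs))" "linear (\<lambda>u. \<gamma> (u # vs))" for vs
      using Suc.prems by (auto intro: multilinear_linear_Cons)
    show "linear (\<lambda>u. ?h w u)" "linear (\<lambda>u. ?h u w)"
      by (auto intro!: linearI simp: frame_sum_def interior_product_def linear_add[OF l(1)] linear_add[OF l(2)]
          linear_scale[OF l(1)] linear_scale[OF l(2)] sum.distrib sum_distrib_left algebra_simps)
  qed
  from orthonormal_frame_trace[OF g E B this]
  have "(\<Sum>i<DIM('a). ?h (E ! i) (E ! i)) = (\<Sum>i<DIM('a). ?h (B ! i) (B ! i))" .
  moreover have "frame_sum k E (interior_product u \<beta>) (interior_product w \<gamma>) = ?h u w" for u w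
    using Suc.prems by (intro Suc.IH multilinear_interior_product alternates_interior_product)
  ultimately have "real (Suc k) * frame_sum (Suc k) E \<beta> \<gamma> = real (Suc k) * frame_sum (Suc k) B \<beta> \<gamma>"
    unfolding frame_sum_Suc[OF Suc.prems] len by simp
  then show ?case by simp
qed

text \<open>For fixed \<open>vs\<close> the star is the inner product of \<beta> with the form that
  sends \<open>us\<close> to \<open>vol (us @ vs)\<close>. So the unknown frame picked by
  \<open>SOME\<close> can be exchanged for a given one.\<close>

lemma hodge_eq_frame_sum:
  fixes g :: "'a::euclidean_space \<Rightarrow> 'a \<Rightarrow> real"
  assumes g: "inner_product g" and B: "orthonormal_frame g B"
    and \<beta>: "homogeneous k \<beta>" "multilinear \<beta>" "alternates \<beta>" and vol: "multilinear vol" "alternates vol"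
  shows "hodge g vol \<beta> vs = frame_sum k B \<beta> (\<lambda>us. vol (us @ vs))"
proof -
  define E where "E = (SOME E. orthonormal_frame g E)"
  have E: "orthonormal_frame g E" unfolding E_def using B by (rule someI)
  have "hodge g vol \<beta> vs = (\<Sum>S\<in>Pow {..<length E}. \<beta> (nths E S) * vol (nths E S @ vs))"
    by (simp add: hodge_def E_def Let_def)
  also have "\<dots> = frame_sum k E \<beta> (\<lambda>us. vol (us @ vs))"
    unfolding frame_sum_def
  proof (rule sum.mono_neutral_right)
    show "\<forall>S\<in>Pow {..<length E} - {S. S \<subseteq> {..<length E} \<and> card S = k}. \<beta> (nths E S) * vol (nths E S @ vs) = 0"
    proof
      fix S assume "S \<in> Pow {..<length E} - {S. S \<subseteq> {..<length E} \<and> card S = k}"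
      then have "{i. i < length E \<and> i \<in> S} = S" "card S \<noteq> k" by auto
      then show "\<beta> (nths E S) * vol (nths E S @ vs) = 0"
        using homogeneousD[OF \<beta>(1)] by (simp add: length_nths)
    qed
  qed auto
  also have "\<dots> = frame_sum k B \<beta> (\<lambda>us. vol (us @ vs))"
  proof (rule frame_sum_invariant[OF g E B \<beta>(2,3)])
    show "multilinear (\<lambda>us. vol (us @ vs))"
      unfolding multilinear_def
    proof (intro allI impI)
      fix us :: "'a list" and i assume "i < length us"
      moreover from this have "linear (\<lambda>v. vol ((us @ vs)[i := v]))"
        using vol(1) unfolding multilinear_def by simp
      ultimately show "linear (\<lambda>v. vol (us[i := v] @ vs))" by (simp add: list_update_append)
    qed
    show "alternates (\<lambda>us. vol (us @ vs))" using vol(2) by (auto simp: alternates_def)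
  qed
  finally show ?thesis .
qed

section \<open>Coframes in dimension seven\<close>

text \<open>Index lists are written with numerals; this keeps \<open>1\<close> from being rewritten
  to \<open>Suc 0\<close>.\<close>

declare One_nat_def [simp del]

lemma bij_betw_enumerate_Basis:
  obtains \<beta> :: "nat \<Rightarrow> 'a::euclidean_space" where "bij_betw \<beta> {1..DIM('a)} Basis"
proof -
  have "\<exists>h. bij_betw h {1..DIM('a)} (Basis :: 'a set)"
    by (rule finite_same_card_bij) auto
  then show ?thesis using that by blast
qed

text \<open>The map T that collects the values of all \<open>e i\<close> is injective: the
  functional given by the inner product with v lies in the span of the \<open>e i\<close>, so a v
  that they all kill satisfies v \<bullet> v = 0. By dimension T is onto, and preimages of the
  standard basis are the wanted vectors.\<close>

lemma dual_basis_vectors: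
  fixes e :: "nat \<Rightarrow> ('a::euclidean_space \<Rightarrow>\<^sub>L real)"
  assumes e: "dual_basis e DIM('a)"
  obtains b where "\<And>i j. i \<in> {1..DIM('a)} \<Longrightarrow> j \<in> {1..DIM('a)} \<Longrightarrow> blinfun_apply (e i) (b j) = (if i = j then 1 else 0)"
proof -
  let ?N = "{1..DIM('a)}"
  obtain \<beta> :: "nat \<Rightarrow> 'a" where \<beta>: "bij_betw \<beta> ?N Basis" by (rule bij_betw_enumerate_Basis)
  have \<beta>\<beta>: "\<beta> i \<bullet> \<beta> j = (if i = j then 1 else 0)" if "i \<in> ?N" "j \<in> ?N" for i j
    using inner_Basis[of "\<beta> i" "\<beta> j"] bij_betw_apply[OF \<beta>] inj_on_eq_iff[OF bij_betw_imp_inj_on[OF \<beta>]] that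
    by metis
  define T where "T v = (\<Sum>i\<in>?N. blinfun_apply (e i) v *\<^sub>R \<beta> i)" for v
  have lin: "linear T"
    unfolding T_def by (auto intro!: linearI simp: blinfun.add_right blinfun.scaleR_right scaleR_add_left sum.distrib scaleR_sum_right)
  have T\<beta>: "T v \<bullet> \<beta> i = blinfun_apply (e i) v" if "i \<in> ?N" for v i
    unfolding T_def using that by (simp add: inner_sum_left \<beta>\<beta> if_distrib cong: if_cong)
  have "inj T"
    unfolding linear_injective_0[OF lin]
  proof (intro allI impI)
    fix v assume "T v = 0"
    then have 0: "blinfun_apply (e i) v = 0" if "i \<in> ?N" for i using T\<beta>[OF that, of v] by simp
    have "subspace {l :: 'a \<Rightarrow>\<^sub>L real. blinfun_apply l v = 0}"
      by (auto simp: subspace_def plus_blinfun.rep_eq scaleR_blinfun.rep_eq)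
    moreover have "e ` ?N \<subseteq> {l. blinfun_apply l v = 0}" using 0 by auto
    ultimately have "span (e ` ?N) \<subseteq> {l. blinfun_apply l v = 0}" by (rule span_minimal[rotated])
    moreover have "span (e ` ?N) = UNIV" using e by (simp add: dual_basis_def)
    ultimately have "blinfun_apply (blinfun_inner_right v) v = 0" by blast
    then show "v = 0" by simp
  qed
  then have "surj T" using linear_injective_imp_surjective[OF lin] by blast
  then have "T (inv T x) = x" for x by (simp add: surj_f_inv_f)
  with T\<beta> \<beta>\<beta> that[of "\<lambda>j. inv T (\<beta> j)"] show ?thesis by metis
qed

locale coframe =
  fixes e :: "nat \<Rightarrow> ('a::euclidean_space \<Rightarrow>\<^sub>L real)" and b :: "nat \<Rightarrow> 'a"
  assumes DIM_7: "DIM('a) = 7"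
    and dual: "\<And>i j. i \<in> {1..7} \<Longrightarrow> j \<in> {1..7} \<Longrightarrow> blinfun_apply (e i) (b j) = (if i = j then 1 else 0)"
begin

lemma independent_frame: "inj_on b {1..7}" "independent (b ` {1..7})"
proof -
  show inj: "inj_on b {1..7}" by (intro inj_onI) (metis dual zero_neq_one)
  show "independent (b ` {1..7})"
  proof (rule independent_if_scalars_zero)
    fix c x assume 0: "(\<Sum>x\<in>b ` {1..7}. c x *\<^sub>R x) = 0" and "x \<in> b ` {1..7}"
    then obtain j where j: "j \<in> {1..7}" "x = b j" by auto
    from 0 have "blinfun_apply (e j) (\<Sum>i\<in>{1..7}. c (b i) *\<^sub>R b i) = 0" by (simp add: sum.reindex[OF inj])
    then have "(\<Sum>i\<in>{1..7}. c (b i) * (if j = i then 1 else 0)) = 0"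
      using dual[OF j(1)] by (simp add: blinfun.sum_right blinfun.scaleR_right)
    then show "c x = 0" using j by (simp add: if_distrib cong: if_cong)
  qed simp
qed

lemma span_frame: "span (b ` {1..7}) = UNIV"
  using card_ge_dim_independent[of "b ` {1..7}" UNIV] independent_frame DIM_7 by (auto simp: card_image)

lemma frame_expansion: "v = (\<Sum>i\<in>{1..7}. blinfun_apply (e i) v *\<^sub>R b i)"
proof -
  have "v \<in> span (b ` {1..7})" using span_frame by simp
  then obtain c where "v = (\<Sum>x\<in>b ` {1..7}. c x *\<^sub>R x)" by (auto simp: span_finite)
  then have v: "v = (\<Sum>i\<in>{1..7}. c (b i) *\<^sub>R b i)" by (simp add: sum.reindex[OF independent_frame(1)])
  have "blinfun_apply (e j) v = c (b j)" if j: "j \<in> {1..7}" for j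
  proof -
    have "blinfun_apply (e j) v = (\<Sum>i\<in>{1..7}. c (b i) * blinfun_apply (e j) (b i))"
      by (subst v) (simp add: blinfun.sum_right blinfun.scaleR_right)
    also have "\<dots> = (\<Sum>i\<in>{1..7}. if i = j then c (b i) else 0)"
      by (intro sum.cong refl) (use dual[OF j] in auto)
    finally show ?thesis using j by simp
  qed
  then have "(\<Sum>i\<in>{1..7}. c (b i) *\<^sub>R b i) = (\<Sum>i\<in>{1..7}. blinfun_apply (e i) v *\<^sub>R b i)"
    by (intro sum.cong) auto
  with v show ?thesis by (rule trans)
qed

lemma dual_basis: "dual_basis e 7"
  unfolding dual_basis_def
proof (intro conjI)
  show inj: "inj_on e {1..7}" by (intro inj_onI) (metis dual zero_neq_one)
  show "independent (e ` {1..7})"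
  proof (rule independent_if_scalars_zero)
    fix c x assume 0: "(\<Sum>x\<in>e ` {1..7}. c x *\<^sub>R x) = 0" and "x \<in> e ` {1..7}"
    then obtain j where j: "j \<in> {1..7}" "x = e j" by auto
    from 0 have "blinfun_apply (\<Sum>i\<in>{1..7}. c (e i) *\<^sub>R e i) (b j) = 0" by (simp add: sum.reindex[OF inj])
    then have "(\<Sum>i\<in>{1..7}. c (e i) * (if i = j then 1 else 0)) = 0"
      using dual[OF _ j(1)] by (simp add: blinfun.sum_left blinfun.scaleR_left)
    then show "c x = 0" using j by (simp add: if_distrib cong: if_cong)
  qed simp
  have "l \<in> span (e ` {1..7})" for l
  proof -
    have "l = (\<Sum>i\<in>{1..7}. blinfun_apply l (b i) *\<^sub>R e i)"
    proof (rule blinfun_eqI)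
      fix v
      have "blinfun_apply l v = blinfun_apply l (\<Sum>i\<in>{1..7}. blinfun_apply (e i) v *\<^sub>R b i)"
        using frame_expansion[of v] by simp
      then show "blinfun_apply l v = blinfun_apply (\<Sum>i\<in>{1..7}. blinfun_apply l (b i) *\<^sub>R e i) v"
        by (simp add: blinfun.sum_right blinfun.scaleR_right blinfun.sum_left blinfun.scaleR_left mult.commute)
    qed
    then show ?thesis by (metis (no_types, lifting) span_sum span_scale span_base imageI)
  qed
  then show "span (e ` {1..7}) = UNIV" by auto
qed

definition metric :: "'a \<Rightarrow> 'a \<Rightarrow> real" where
  "metric x y = (\<Sum>i\<in>{1..7}. blinfun_apply (e i) x * blinfun_apply (e i) y)"

abbreviation frame :: "'a list" where
  "frame \<equiv> map b [1..<8]"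

abbreviation volume :: "('a, real) form" where
  "volume \<equiv> ew e [1,2,3,4,5,6,7]"

lemma bilinear_metric: "bilinear metric"
  by (auto simp: bilinear_def metric_def blinfun.add_right blinfun.scaleR_right sum.distrib sum_distrib_left algebra_simps
      intro!: linearI)

lemma inner_product_metric: "inner_product metric"
  unfolding inner_product_def
proof (intro conjI allI impI)
  show "bilinear metric" by (rule bilinear_metric)
  show "metric x y = metric y x" for x y by (simp add: metric_def mult.commute)
  fix x :: 'a assume "x \<noteq> 0"
  then obtain i where i: "i \<in> {1..7}" "blinfun_apply (e i) x \<noteq> 0"
    using frame_expansion[of x] by (metis (no_types, lifting) scaleR_zero_left sum.neutral)
  show "metric x x > 0"
    unfolding metric_def by (rule sum_pos2[OF _ i(1)]) (use i in \<open>auto simp: zero_less_mult_iff linorder_neq_iff\<close>)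
qed

lemma metric_frame: "i \<in> {1..7} \<Longrightarrow> j \<in> {1..7} \<Longrightarrow> metric (b i) (b j) = (if i = j then 1 else 0)"
proof -
  assume ij: "i \<in> {1..7}" "j \<in> {1..7}"
  have "metric (b i) (b j) = (\<Sum>k\<in>{1..7}. if k = i then (if i = j then 1 else 0) else 0)"
    unfolding metric_def by (intro sum.cong refl) (use dual[OF _ ij(1)] dual[OF _ ij(2)] in auto)
  then show ?thesis using ij by simp
qed

lemma interior_product_frame_ew:
  "k \<in> {1..7} \<Longrightarrow> set I \<subseteq> {1..7} \<Longrightarrow> k \<notin> set I \<Longrightarrow> interior_product (b k) (ew e I) = (\<lambda>us. 0)"
  by (intro interior_product_ew_eq_0) (use dual in \<open>metis subsetD\<close>)

lemma orthonormal_frame_frame: "orthonormal_frame metric frame"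
  unfolding orthonormal_frame_def using DIM_7 by (auto simp: metric_frame)

lemma ew_frame:
  "sorted_wrt (<) I \<Longrightarrow> sorted_wrt (<) J \<Longrightarrow> set I \<subseteq> {1..7} \<Longrightarrow> set J \<subseteq> {1..7} \<Longrightarrow>
    ew e I (map b J) = (if I = J then 1 else 0)"
proof (induction I arbitrary: J)
  case Nil
  show ?case by auto
next
  case (Cons i I)
  show ?case
  proof (cases J)
    case Nil
    then show ?thesis by (simp add: wedge_oneform_Nil)
  next
    case (Cons j K)
    note prems = Cons.prems[unfolded Cons]
    consider "i = j" | "i < j" | "j < i" by linarith
    then show ?thesis
    proof cases
      case 1
      have "interior_product (b i) (ew e I) = (\<lambda>us. 0)"
        by (rule interior_product_frame_ew) (use prems in auto)
      then show ?thesis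
        using 1 prems Cons.IH[of K] dual[of i i] by (simp add: Cons wedge_oneform_Cons wedge_zero_right)
    next
      case 2
      have "wedge (oneform (e i)) (ew e I) (map b J) = 0"
      proof (rule wedge_oneform_eq_0)
        fix w assume "w \<in> set (map b J)"
        then obtain x where "w = b x" "x \<in> set J" by auto
        moreover from this have "x \<in> {1..7}" "i \<noteq> x" "i \<in> {1..7}" using prems 2 Cons by auto
        ultimately show "blinfun_apply (e i) w = 0" using dual[of i x] by simp
      qed
      then show ?thesis using 2 Cons by simp
    next
      case 3
      have "interior_product (b j) (ew e I) = (\<lambda>us. 0)"
        by (rule interior_product_frame_ew) (use prems 3 in auto)
      then show ?thesis
        using 3 prems dual[of i j] by (simp add: Cons wedge_oneform_Cons wedge_zero_right)
    qed
  qed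
qed

lemma volume_frame: "volume frame = 1"
  using ew_frame[of "[1,2,3,4,5,6,7]" "[1,2,3,4,5,6,7]"] by (simp add: upt_rec del: ew.simps)

text \<open>In top degree a frame sum has a single term, so \<open>frame_sum_invariant\<close> says
  that \<open>volume\<close> has the same square on E as on \<open>frame\<close>.\<close>

lemma volume_orthonormal_frame:
  assumes "orthonormal_frame metric E" shows "\<bar>volume E\<bar> = 1"
proof -
  have fs: "frame_sum 7 F volume volume = volume F * volume F" if "length F = 7" for F
  proof -
    have "{S. S \<subseteq> {..<length F} \<and> card S = 7} = {{..<length F}}"
      using that card_subset_eq[of "{..<7::nat}"] by auto
    then show ?thesis by (simp add: frame_sum_def nths_all del: ew.simps)
  qed
  have "length E = 7" using assms DIM_7 by (simp add: orthonormal_frame_def)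
  then have "volume E * volume E = volume frame * volume frame"
    using frame_sum_invariant[OF inner_product_metric assms orthonormal_frame_frame
        multilinear_ew alternates_ew multilinear_ew alternates_ew, of 7 e "[1,2,3,4,5,6,7]" e "[1,2,3,4,5,6,7]"]
    by (simp add: fs del: ew.simps)
  then have "(volume E)\<^sup>2 = 1" by (simp add: volume_frame power2_eq_square del: ew.simps)
  then show ?thesis by (auto simp: power2_eq_1_iff simp del: ew.simps)
qed

text \<open>Equality of the products of metric and volume form gives metric = c g with c =
  \<open>vol frame\<close>, and c > 0 because both metrics are positive. Scaling
  \<open>frame\<close> by r = sqrt c makes it orthonormal for g; there vol has absolute value 1 and
  also the value r^7 c = r^9. So c = 1, which settles scale and orientation together.\<close>

lemma g2_metric_vol_unique:
  assumes 1: "g2_metric_vol \<phi> metric volume" and 2: "g2_metric_vol \<phi> g vol"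
  shows "g = metric \<and> vol = volume"
proof -
  note defs = 1[unfolded g2_metric_vol_def] 2[unfolded g2_metric_vol_def]
  from defs have "inner_product g" and alt: "alternating_form 7 vol"
    and on: "\<And>E. orthonormal_frame g E \<Longrightarrow> \<bar>vol E\<bar> = 1"
    and "\<And>X Y vs. 6 * g X Y * vol vs = 6 * metric X Y * volume vs" by (blast, blast, blast, presburger)
  then have eq: "g X Y * vol vs = metric X Y * volume vs" for X Y vs by (simp add: mult.assoc)
  have bil: "bilinear g" and pos: "\<And>x. x \<noteq> 0 \<Longrightarrow> g x x > 0" using \<open>inner_product g\<close> by (auto simp: inner_product_def)
  define c where "c = vol frame"
  have metric: "metric X Y = c * g X Y" for X Y
    using eq[of X Y frame] by (simp add: volume_frame c_def mult.commute del: ew.simps)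
  have "b 1 \<noteq> 0" using dual[of 1 1] by (auto simp: blinfun.zero_right)
  from pos[OF this] have "g (b 1) (b 1) > 0" .
  moreover have "c * g (b 1) (b 1) = 1" unfolding metric[symmetric] by (simp add: metric_frame)
  ultimately have "c > 0" by (metis zero_less_mult_pos2 zero_less_one)
  define r where "r = sqrt c"
  have r: "r > 0" "r * r = c" using \<open>c > 0\<close> by (auto simp: r_def)
  have "orthonormal_frame g (map ((*\<^sub>R) r) frame)"
    unfolding orthonormal_frame_def
  proof (intro conjI allI impI)
    fix i j assume ij: "i < length (map ((*\<^sub>R) r) frame)" "j < length (map ((*\<^sub>R) r) frame)"
    have "g (r *\<^sub>R b (1 + i)) (r *\<^sub>R b (1 + j)) = c * g (b (1 + i)) (b (1 + j))"
      using r(2) by (simp add: bilinear_lmul[OF bil] bilinear_rmul[OF bil])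
    then show "g (map ((*\<^sub>R) r) frame ! i) (map ((*\<^sub>R) r) frame ! j) = (if i = j then 1 else 0)"
      using ij by (simp add: metric[symmetric] metric_frame)
  qed (use DIM_7 in simp)
  from on[OF this] have "\<bar>vol (map ((*\<^sub>R) r) frame)\<bar> = 1" .
  moreover have "vol (map ((*\<^sub>R) r) F) = r ^ length F * vol F" for F
  proof -
    have "\<And>\<omega> :: ('a, real) form. multilinear \<omega> \<Longrightarrow> \<omega> (map ((*\<^sub>R) r) F) = r ^ length F * \<omega> F"
    proof (induction F)
      case (Cons x F)
      have "\<omega> (r *\<^sub>R x # map ((*\<^sub>R) r) F) = r *\<^sub>R \<omega> (x # map ((*\<^sub>R) r) F)"
        by (rule linear_scale[OF multilinear_linear_Cons[OF Cons.prems]])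
      then show ?case
        using Cons.IH[OF multilinear_interior_product[OF Cons.prems, of x]] by (simp add: interior_product_def)
    qed simp
    then show ?thesis using alternating_formD(2)[OF alt] by blast
  qed
  ultimately have "r ^ 7 * (r * r) = 1" using r \<open>c > 0\<close> by (simp add: c_def[symmetric] abs_mult del: map_map)
  then have "r ^ 9 = 1" by (simp add: power_numeral_reduce)
  then have "r = 1" using r(1) power_eq_imp_eq_base[of r 9 1] by simp
  then have "c = 1" using r by simp
  then have "g = metric" using metric by (auto simp: fun_eq_iff)
  moreover have "vol = volume"
    using eq[of "b 1" "b 1"] metric_frame[of 1 1] \<open>g = metric\<close> by (auto simp: fun_eq_iff simp del: ew.simps)
  ultimately show ?thesis by simp
qed

lemma g2_metric_volume:
  assumes "g2_metric_vol \<phi> metric volume"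
  shows "g2_metric \<phi> = metric" "g2_vol \<phi> = volume"
  unfolding g2_metric_def g2_vol_def using assms g2_metric_vol_unique[OF assms] by (blast intro!: the_equality)+

lemma ew_append_frame:
  assumes "set I \<subseteq> {1..7}" "set J \<subseteq> {1..7}" "distinct (I @ J)"
  shows "ew e (I @ J) (map b I @ vs) = ew e J vs"
  using assms
proof (induction I)
  case (Cons i I)
  have "interior_product (b i) (ew e (I @ J)) = (\<lambda>us. 0)"
    by (rule interior_product_frame_ew) (use Cons.prems in auto)
  then show ?case using Cons dual[of i i] by (simp add: wedge_oneform_Cons wedge_zero_right)
qed simp

end

lemma insert_index_distinct:
  assumes "sorted_wrt (<) J" "i \<notin> set J" "insert_index i J = (s, K)"
  shows "sorted_wrt (<) K \<and> set K = insert i (set J) \<and> s * s = 1"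
  using assms
proof (induction i J arbitrary: s K rule: insert_index.induct)
  case (2 i j J)
  obtain t L where L: "insert_index i J = (t, L)" by fastforce
  show ?case
  proof (cases "i < j")
    case True
    then show ?thesis using 2 by (auto; meson less_trans)
  next
    case False
    then have "i \<noteq> j" "sorted_wrt (<) L \<and> set L = insert i (set J) \<and> t * t = 1"
      using 2 L by auto
    then show ?thesis using 2 L False by auto
  qed
qed auto

lemma sort_index_distinct:
  "distinct I \<Longrightarrow> sort_index I = (s, K) \<Longrightarrow> sorted_wrt (<) K \<and> set K = set I \<and> s * s = 1"
proof (induction I arbitrary: s K)
  case (Cons i I)
  obtain t J where J: "sort_index I = (t, J)" by fastforce
  obtain u L where L: "insert_index i J = (u, L)" by fastforce
  have "sorted_wrt (<) J \<and> set J = set I \<and> t * t = 1" using Cons.IH[OF _ J] Cons.prems by simp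
  moreover from this have "sorted_wrt (<) L \<and> set L = insert i (set J) \<and> u * u = 1"
    using insert_index_distinct[OF _ _ L] Cons.prems by auto
  ultimately show ?case using Cons.prems J L by (auto simp: mult_ac)
qed auto

section \<open>The star and contractions on coefficient lists\<close>

lemma atLeastAtMost_1_7: "{1..7} = set [1,2,3,4,5,6,7::nat]"
  by (rule set_eqI) (simp, presburger)

definition increasing_terms :: "term_list \<Rightarrow> bool" where
  "increasing_terms p \<longleftrightarrow> (\<forall>(c, I)\<in>set p. sorted_wrt (<) I \<and> set I \<subseteq> {1..7})"

text \<open>For increasing I the sign is the one that makes the wedge product of e^I with its star
  equal to the volume form.\<close>

definition star_terms :: "term_list \<Rightarrow> term_list" where
  "star_terms p = map (\<lambda>(c, I). let J = filter (\<lambda>i. i \<notin> set I) [1,2,3,4,5,6,7] in (c * fst (sort_index (I @ J)), J)) p"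

primrec contract_index :: "nat \<Rightarrow> nat list \<Rightarrow> term_list" where
  "contract_index j [] = []"
| "contract_index j (i # I) = (if i = j then [(1, I)] else []) @ map (\<lambda>(c, J). (- c, i # J)) (contract_index j I)"

definition contract_terms :: "nat \<Rightarrow> term_list \<Rightarrow> term_list" where
  "contract_terms j p = concat (map (\<lambda>(c, I). scale_terms c (contract_index j I)) p)"

context coframe
begin

lemma hodge_ew_frame:
  assumes I: "sorted_wrt (<) I" "set I \<subseteq> {1..7}"
  shows "hodge metric volume (ew e I) vs = volume (map b I @ vs)"
proof -
  \<comment> \<open>Positions in \<open>frame\<close> start at 0, indices at 1. This is the only set
    of positions whose frame vectors are not annihilated by \<open>ew e I\<close>.\<close>
  let ?S = "(\<lambda>i. i - 1) ` set I"
  have I_S: "nths [1..<8] ?S = I"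
  proof (rule sorted_distinct_set_unique)
    show "sorted (nths [1..<8] ?S)" by (rule sorted_nths) simp
    show "sorted I" "distinct I" using I(1) by (auto simp: strict_sorted_iff)
    show "set (nths [1..<8] ?S) = set I"
    proof (intro set_eqI iffI)
      fix x assume "x \<in> set (nths [1..<8] ?S)"
      then obtain j where "x = 1 + j" "j \<in> ?S" by (auto simp: set_nths)
      moreover from \<open>j \<in> ?S\<close> obtain i where "i \<in> set I" "j = i - 1" by auto
      moreover from \<open>i \<in> set I\<close> have "1 \<le> i" using I(2) by auto
      ultimately show "x \<in> set I" by simp
    next
      fix x assume x: "x \<in> set I"
      then have "1 \<le> x" "x \<le> 7" using I(2) by auto
      then have "[1..<8] ! (x - 1) = x" "x - 1 < length [1..<8]" by auto
      then show "x \<in> set (nths [1..<8] ?S)"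
        unfolding set_nths using x by (intro CollectI exI[of _ "x - 1"] conjI) auto
    qed
  qed (simp add: distinct_nthsI)
  have inj: "inj_on (\<lambda>i. i - 1) (set I)"
  proof (rule inj_onI)
    fix x y assume "x \<in> set I" "y \<in> set I" "x - 1 = y - 1"
    moreover from this have "1 \<le> x" "1 \<le> y" using I(2) by auto
    ultimately show "x = y" by simp
  qed
  have card_S: "card ?S = length I" using I(1) by (simp add: card_image[OF inj] distinct_card strict_sorted_iff)
  have "hodge metric volume (ew e I) vs = frame_sum (length I) frame (ew e I) (\<lambda>us. volume (us @ vs))"
    by (intro hodge_eq_frame_sum inner_product_metric orthonormal_frame_frame homogeneous_ew multilinear_ew alternates_ew)
  also have "\<dots> = (\<Sum>S | S \<subseteq> {..<7::nat} \<and> card S = length I. if S = ?S then volume (map b I @ vs) else 0)"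
    unfolding frame_sum_def
  proof (rule sum.cong)
    fix S assume S: "S \<in> {S. S \<subseteq> {..<7::nat} \<and> card S = length I}"
    have sub: "set (nths [1..<8] S) \<subseteq> {1..7}" using set_nths_subset[of "[1..<8]" S] by auto
    have "nths [1..<8] S = I \<longleftrightarrow> S = ?S"
    proof
      assume eq: "nths [1..<8] S = I"
      have "j \<in> ?S" if "j \<in> S" for j
      proof -
        have "Suc j \<in> set I" using that S by (auto simp: eq[symmetric] set_nths intro!: exI[of _ j])
        then show ?thesis by force
      qed
      then have "S \<subseteq> ?S" by auto
      then show "S = ?S" using S card_S by (intro card_subset_eq) auto
    qed (use I_S in simp)
    moreover have "sorted_wrt (<) (nths [1..<8] S)"
      by (simp add: strict_sorted_iff sorted_nths distinct_nthsI)
    ultimately show "ew e I (nths frame S) * volume (nths frame S @ vs) = (if S = ?S then volume (map b I @ vs) else 0)"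
      using ew_frame[OF I(1) _ I(2) sub] by (auto simp: nths_map simp del: ew.simps)
  qed simp
  also have "\<dots> = volume (map b I @ vs)"
  proof -
    have "i - 1 < 7" if "i \<in> set I" for i
    proof -
      have "1 \<le> i" "i \<le> 7" using that I(2) by auto
      then show ?thesis by simp
    qed
    then have "?S \<subseteq> {..<7}" by auto
    moreover have "finite {S. S \<subseteq> {..<7::nat} \<and> card S = length I}"
      by (rule finite_subset[of _ "Pow {..<7}"]) auto
    ultimately show ?thesis using card_S by (simp add: sum.delta del: ew.simps)
  qed
  finally show ?thesis .
qed

lemma hodge_lin_comb:
  assumes "increasing_terms p"
  shows "hodge metric volume (lin_comb e p) = lin_comb e (star_terms p)"
proof
  fix vs
  have "hodge metric volume (ew e I) vs = fst (sort_index (I @ J)) * ew e J vs"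
    if I: "sorted_wrt (<) I" "set I \<subseteq> {1..7}" and J: "J = filter (\<lambda>i. i \<notin> set I) [1,2,3,4,5,6,7]" for I J
  proof -
    obtain s K where K: "sort_index (I @ J) = (s, K)" by fastforce
    have "distinct I" using I(1) by (simp add: strict_sorted_iff)
    then have dist: "distinct (I @ J)" unfolding J by auto
    have set: "set (I @ J) = {1..7}"
      using I(2) unfolding J atLeastAtMost_1_7 by auto
    note K' = sort_index_distinct[OF dist K]
    have "K = [1,2,3,4,5,6,7]"
    proof (rule sorted_distinct_set_unique)
      show "sorted K" "distinct K" using K' by (auto simp: strict_sorted_iff)
      show "set K = set [1,2,3,4,5,6,7]" using K' set unfolding atLeastAtMost_1_7 by simp
    qed auto
    then have "ew e (I @ J) us = s * volume us" for us
      using ew_sort_index[of e "I @ J" us] K by simp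
    then have "volume us = s * ew e (I @ J) us" for us
      using K' by (simp add: mult.assoc[symmetric])
    then show ?thesis
      using hodge_ew_frame[OF I, of vs] ew_append_frame[of I J vs] I(2) dist set K
      by (metis Un_upper2 fst_conv set_append)
  qed
  note ew_star = this
  have add: "hodge metric volume (\<lambda>us. c * \<alpha> us + \<beta> us) vs = c * hodge metric volume \<alpha> vs + hodge metric volume \<beta> vs"
    for c and \<alpha> \<beta> :: "('a, real) form"
    by (simp add: hodge_def Let_def distrib_right sum.distrib sum_distrib_left mult.assoc del: ew.simps)
  have zero: "hodge metric volume (\<lambda>us. 0) vs = 0"
    by (simp add: hodge_def)
  show "hodge metric volume (lin_comb e p) vs = lin_comb e (star_terms p) vs"
    using assms
  proof (induction p)
    case Nil
    show ?case by (simp add: lin_comb_Nil star_terms_def zero del: ew.simps)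
  next
    case (Cons t p)
    obtain c I where t: "t = (c, I)" by fastforce
    define J where "J = filter (\<lambda>i. i \<notin> set I) [1,2,3,4,5,6,7]"
    have "star_terms (t # p) = (c * fst (sort_index (I @ J)), J) # star_terms p"
      by (simp only: t star_terms_def J_def list.map case_prod_conv Let_def)
    then show ?case
      using Cons ew_star[OF _ _ J_def]
      by (simp add: t lin_comb_Cons add increasing_terms_def del: ew.simps)
  qed
qed

lemma interior_product_lin_comb:
  assumes j: "j \<in> {1..7}" and p: "\<forall>(c, I)\<in>set p. set I \<subseteq> {1..7}"
  shows "interior_product (b j) (lin_comb e p) = lin_comb e (contract_terms j p)"
proof
  fix vs
  have neg: "wedge (oneform (e i)) (lin_comb e q) us = - lin_comb e (map (\<lambda>(c, J). (- c, i # J)) q) us" for i q us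
  proof -
    have eq: "oneform (e i) = lin_comb e [(1, [i])]" by (auto simp: lin_comb_def ew_singleton simp del: ew.simps)
    show ?thesis
      unfolding eq wedge_lin_comb
      by (simp add: wedge_terms_def lin_comb_def case_prod_unfold comp_def uminus_sum_list_map del: ew.simps)
  qed
  have "interior_product (b j) (ew e I) = lin_comb e (contract_index j I)" if "set I \<subseteq> {1..7}" for I
    using that
  proof (induction I)
    case Nil
    show ?case by (auto simp: interior_product_def lin_comb_Nil)
  next
    case (Cons i I)
    then have IH: "interior_product (b j) (ew e I) = lin_comb e (contract_index j I)" by simp
    show ?case
      by (rule ext) (use dual[of i j] j Cons.prems in
        \<open>simp add: IH interior_product_wedge_oneform neg lin_comb_append lin_comb_Cons lin_comb_Nil\<close>)
  qed
  note ew_contract = this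
  show "interior_product (b j) (lin_comb e p) vs = lin_comb e (contract_terms j p) vs"
    using p
  proof (induction p)
    case (Cons t p)
    obtain c I where t: "t = (c, I)" by fastforce
    have "interior_product (b j) (lin_comb e (t # p)) vs = c * interior_product (b j) (ew e I) vs + interior_product (b j) (lin_comb e p) vs"
      by (simp add: t interior_product_def lin_comb_Cons)
    then show ?case
      using Cons ew_contract[of I] by (simp add: t contract_terms_def lin_comb_append lin_comb_scale)
  qed (simp add: interior_product_def lin_comb_Nil contract_terms_def)
qed

end

section \<open>Coefficients of the structure\<close>

definition phi_terms :: term_list where
  "phi_terms = [(1, [1,3,5]), (-1, [2,4,5]), (1, [1,4,6]), (1, [2,3,6]), (-1, [1,2,7]), (-1, [3,4,7]), (1, [5,6,7])]"

text \<open>In short: e^1234 + sigma_1^+ \<wedge> e^67 + sigma_2^+ \<wedge> e^57 - sigma_3^+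
  \<wedge> e^56.\<close>

definition psi_terms :: term_list where
  "psi_terms = [(1, [1,2,3,4]), (-1, [2,4,6,7]), (1, [1,3,6,7]), (-1, [2,3,5,7]), (-1, [1,4,5,7]), (-1, [3,4,5,6]), (-1, [1,2,5,6])]"

definition structure_terms :: "real \<Rightarrow> real \<Rightarrow> real \<Rightarrow> real \<Rightarrow> nat \<Rightarrow> term_list" where
  "structure_terms \<delta> \<epsilon>1 \<epsilon>2 \<epsilon>3 i =
    (if i = 5 then [(\<delta> + \<epsilon>1, [1,3]), (\<epsilon>1 - \<delta>, [2,4])]
     else if i = 6 then [(\<epsilon>2 - \<delta>, [1,4]), (- \<delta> - \<epsilon>2, [2,3])]
     else if i = 7 then [(\<delta> + \<epsilon>3, [1,2]), (\<delta> - \<epsilon>3, [3,4])]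
     else [])"

text \<open>The coefficient of e^1234 is 2\<delta> - 2\<delta> - 2\<delta>: each sigma_i^+ in \<phi>
  meets the self-dual part of its own de^j, with the sign it has in \<phi>, and its product with the
  anti-self-dual part is zero.\<close>

definition dphi_terms :: "real \<Rightarrow> real \<Rightarrow> real \<Rightarrow> real \<Rightarrow> term_list" where
  "dphi_terms \<delta> \<epsilon>1 \<epsilon>2 \<epsilon>3 = [(- 2 * \<delta>, [1,2,3,4]), (\<delta> + \<epsilon>1, [1,3,6,7]), (\<epsilon>1 - \<delta>, [2,4,6,7]), (\<delta> - \<epsilon>2, [1,4,5,7]),
     (\<delta> + \<epsilon>2, [2,3,5,7]), (\<delta> + \<epsilon>3, [1,2,5,6]), (\<delta> - \<epsilon>3, [3,4,5,6])]"

definition star_dphi_terms :: "real \<Rightarrow> real \<Rightarrow> real \<Rightarrow> real \<Rightarrow> term_list" where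
  "star_dphi_terms \<delta> \<epsilon>1 \<epsilon>2 \<epsilon>3 = [(- 2 * \<delta>, [5,6,7]), (- \<delta> - \<epsilon>1, [2,4,5]), (\<delta> - \<epsilon>1, [1,3,5]), (\<epsilon>2 - \<delta>, [2,3,6]),
     (- \<delta> - \<epsilon>2, [1,4,6]), (\<delta> + \<epsilon>3, [3,4,7]), (\<delta> - \<epsilon>3, [1,2,7])]"

text \<open>The factor of \<phi> is one sixth of the value - 4 \<delta> found in
  \<open>star_dphi_wedge_phi\<close>; the summand with \<open>g2_tau1\<close> vanishes by
  \<open>g2_tau1_phi\<close>.\<close>

definition torsion_terms :: "real \<Rightarrow> real \<Rightarrow> real \<Rightarrow> real \<Rightarrow> term_list" where
  "torsion_terms \<delta> \<epsilon>1 \<epsilon>2 \<epsilon>3 = scale_terms (- 2 / 3 * \<delta>) phi_terms @ scale_terms (- 1) (star_dphi_terms \<delta> \<epsilon>1 \<epsilon>2 \<epsilon>3)"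

text \<open>The appended term is the component of half the bracket of A with itself along the i-th
  basis element of sl(2). The order \<open>[7,5]\<close> follows the bracket of Y7 and Y5; the last
  branch stands for \<open>i = 7\<close>.\<close>

definition curvature_terms :: "real \<Rightarrow> real \<Rightarrow> real \<Rightarrow> real \<Rightarrow> nat \<Rightarrow> term_list" where
  "curvature_terms \<delta> \<epsilon>1 \<epsilon>2 \<epsilon>3 i = structure_terms \<delta> \<epsilon>1 \<epsilon>2 \<epsilon>3 i @
    [if i = 5 then (- 2 * \<delta>, [6,7]) else if i = 6 then (2 * \<delta>, [7,5]) else (2 * \<delta>, [5,6])]"

lemmas term_list_defs = phi_terms_def psi_terms_def structure_terms_def dphi_terms_def star_dphi_terms_def torsion_terms_def
  curvature_terms_def
lemmas term_list_eval = term_list_defs wedge_terms_def d_terms_def scale_terms_def star_terms_def Let_def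

lemma star_phi: "lin_comb e (star_terms phi_terms) = lin_comb e psi_terms"
  by (simp add: term_list_eval lin_comb_Cons lin_comb_Nil fun_eq_iff del: ew.simps)

text \<open>The pattern of most identities below: after passing to the normal form, one
  \<open>simp\<close> runs the list functions and the next compares polynomial coefficients.\<close>

lemma d_phi: "lin_comb e (d_terms (structure_terms \<delta> \<epsilon>1 \<epsilon>2 \<epsilon>3) phi_terms) = lin_comb e (dphi_terms \<delta> \<epsilon>1 \<epsilon>2 \<epsilon>3)"
  by (subst lin_comb_collect_terms[symmetric],
      simp add: term_list_eval del: ew.simps,
      simp add: lin_comb_Cons lin_comb_Nil fun_eq_iff algebra_simps del: ew.simps)

text \<open>In \<psi> the form sigma_i^+ is never multiplied by its own one of e^5, e^6, e^7. So
  only products of sigma_i^+ with sigma_j^+ or sigma_j^- for i \<noteq> j arise, and these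
  vanish.\<close>

lemma d_psi: "lin_comb e (d_terms (structure_terms \<delta> \<epsilon>1 \<epsilon>2 \<epsilon>3) psi_terms) vs = 0"
  by (subst lin_comb_collect_terms[symmetric],
      simp add: term_list_eval del: ew.simps,
      simp add: lin_comb_Cons lin_comb_Nil fun_eq_iff algebra_simps del: ew.simps)

lemma star_d_phi: "star_terms (dphi_terms \<delta> \<epsilon>1 \<epsilon>2 \<epsilon>3) = star_dphi_terms \<delta> \<epsilon>1 \<epsilon>2 \<epsilon>3"
  by (simp add: term_list_eval)

lemma lin_comb_filter: "lin_comb e (filter (\<lambda>(c, I). c \<noteq> 0) p) = lin_comb e p"
  by (induction p) (auto simp: lin_comb_Cons)

lemma wedge_dphi_phi: "lin_comb e (wedge_terms (dphi_terms \<delta> \<epsilon>1 \<epsilon>2 \<epsilon>3) phi_terms) = lin_comb e [(- 4 * \<delta>, [1,2,3,4,5,6,7])]"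
  by (subst lin_comb_collect_terms[symmetric],
      simp add: term_list_eval del: ew.simps,
      simp add: lin_comb_Cons lin_comb_Nil fun_eq_iff algebra_simps del: ew.simps)

text \<open>Every product either repeats one of e^5, e^6, e^7 or contains sigma_i^+ wedged with
  sigma_j^+ or sigma_j^- for i \<noteq> j, which is zero.\<close>

lemma wedge_phi_star_dphi: "lin_comb e (wedge_terms phi_terms (star_dphi_terms \<delta> \<epsilon>1 \<epsilon>2 \<epsilon>3)) vs = 0"
  by (subst lin_comb_collect_terms[symmetric],
      simp add: term_list_eval del: ew.simps,
      simp add: lin_comb_Cons lin_comb_Nil fun_eq_iff algebra_simps del: ew.simps)

text \<open>Of each de^j only the self-dual part survives; its product with the matching summand of
  \<psi> has coefficient 2\<delta> up to sign, and the bracket term times e^1234 cancels it. The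
  signs of the three sigma_i^+ in \<psi> thus dictate the signs of the brackets, and these are the
  ones of sl(2).\<close>

lemma wedge_curvature_psi:
  assumes "i \<in> {5,6,7}"
  shows "lin_comb e (wedge_terms (curvature_terms \<delta> \<epsilon>1 \<epsilon>2 \<epsilon>3 i) psi_terms) vs = 0"
  using assms
  by (subst lin_comb_collect_terms[symmetric],
      elim insertE emptyE,
      simp_all add: term_list_eval del: ew.simps,
      simp_all add: lin_comb_Cons lin_comb_Nil fun_eq_iff algebra_simps del: ew.simps)

text \<open>An anti-self-dual form wedges to zero with each sigma_i^+, and with e^1234 by
  degree.\<close>

lemma wedge_asd_psi: "lin_comb e (wedge_terms [(1, [1,3]), (1, [2,4])] psi_terms) vs = 0"
  by (subst lin_comb_collect_terms[symmetric],
      simp_all add: term_list_eval del: ew.simps,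
      simp_all add: lin_comb_Cons lin_comb_Nil fun_eq_iff algebra_simps del: ew.simps)

text \<open>The component 4/3 \<delta> e^567 of the torsion produces all terms of dT except e^1234.
  With the signs -, +, + the mixed terms of the three curvature squares add up to 4 \<delta>
  d(e^567), whence the factor 1/3. What remains is a multiple of e^1234, written through the square
  of sigma_1^-, which is -2 e^1234.\<close>

lemma d_torsion: "lin_comb e (d_terms (structure_terms \<delta> \<epsilon>1 \<epsilon>2 \<epsilon>3) (torsion_terms \<delta> \<epsilon>1 \<epsilon>2 \<epsilon>3)) vs =
    (8 / 3 * \<delta>\<^sup>2 + 2 / 3 * (2 * \<epsilon>1\<^sup>2 + \<epsilon>2\<^sup>2 + \<epsilon>3\<^sup>2)) * lin_comb e (wedge_terms [(1, [1,3]), (1, [2,4])] [(1, [1,3]), (1, [2,4])]) vs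
    + 1 / 3 * (- lin_comb e (wedge_terms (curvature_terms \<delta> \<epsilon>1 \<epsilon>2 \<epsilon>3 5) (curvature_terms \<delta> \<epsilon>1 \<epsilon>2 \<epsilon>3 5)) vs
      + lin_comb e (wedge_terms (curvature_terms \<delta> \<epsilon>1 \<epsilon>2 \<epsilon>3 6) (curvature_terms \<delta> \<epsilon>1 \<epsilon>2 \<epsilon>3 6)) vs
      + lin_comb e (wedge_terms (curvature_terms \<delta> \<epsilon>1 \<epsilon>2 \<epsilon>3 7) (curvature_terms \<delta> \<epsilon>1 \<epsilon>2 \<epsilon>3 7)) vs)"
  unfolding lin_comb_collect_terms[of e "wedge_terms _ _", symmetric] lin_comb_collect_terms[of e "d_terms _ _", symmetric]
  by (simp add: term_list_eval del: ew.simps,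
      simp add: lin_comb_Cons lin_comb_Nil fun_eq_iff field_simps power2_eq_square del: ew.simps)

lemma contract_phi:
  assumes "i \<in> {1..7}" "j \<in> {1..7}"
  shows "lin_comb e (wedge_terms (wedge_terms (contract_terms i phi_terms) (contract_terms j phi_terms)) phi_terms) vs
    = (if i = j then 6 * ew e [1,2,3,4,5,6,7] vs else 0)"
proof -
  let ?c = "\<lambda>i. contract_terms i phi_terms"
  \<comment> \<open>All coefficients are numerals here, so without zero terms the normal forms can
    be compared as lists. The inner \<open>collect_terms\<close> keeps the intermediate lists short
    in the 49 evaluations.\<close>
  define w where "w p q = filter (\<lambda>(c, I). c \<noteq> 0) (collect_terms (wedge_terms (collect_terms (wedge_terms p q)) phi_terms))"
    for p q
  note eval = w_def contract_terms_def term_list_eval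
  have "\<forall>j\<in>set [1,2,3,4,5,6,7]. w (?c 1) (?c j) = (if 1 = j then [(6, [1,2,3,4,5,6,7])] else [])"
    by (simp, (intro conjI)?; simp add: eval)
  moreover
  have "\<forall>j\<in>set [1,2,3,4,5,6,7]. w (?c 2) (?c j) = (if 2 = j then [(6, [1,2,3,4,5,6,7])] else [])"
    by (simp, (intro conjI)?; simp add: eval)
  moreover
  have "\<forall>j\<in>set [1,2,3,4,5,6,7]. w (?c 3) (?c j) = (if 3 = j then [(6, [1,2,3,4,5,6,7])] else [])"
    by (simp, (intro conjI)?; simp add: eval)
  moreover
  have "\<forall>j\<in>set [1,2,3,4,5,6,7]. w (?c 4) (?c j) = (if 4 = j then [(6, [1,2,3,4,5,6,7])] else [])"
    by (simp, (intro conjI)?; simp add: eval)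
  moreover
  have "\<forall>j\<in>set [1,2,3,4,5,6,7]. w (?c 5) (?c j) = (if 5 = j then [(6, [1,2,3,4,5,6,7])] else [])"
    by (simp, (intro conjI)?; simp add: eval)
  moreover
  have "\<forall>j\<in>set [1,2,3,4,5,6,7]. w (?c 6) (?c j) = (if 6 = j then [(6, [1,2,3,4,5,6,7])] else [])"
    by (simp, (intro conjI)?; simp add: eval)
  moreover
  have "\<forall>j\<in>set [1,2,3,4,5,6,7]. w (?c 7) (?c j) = (if 7 = j then [(6, [1,2,3,4,5,6,7])] else [])"
    by (simp, (intro conjI)?; simp add: eval)
  ultimately have "\<forall>i\<in>set [1,2,3,4,5,6,7]. \<forall>j\<in>set [1,2,3,4,5,6,7]. w (?c i) (?c j) = (if i = j then [(6, [1,2,3,4,5,6,7])] else [])"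
    unfolding list.set ball_simps by blast
  then have "w (?c i) (?c j) = (if i = j then [(6, [1,2,3,4,5,6,7])] else [])"
    using assms unfolding atLeastAtMost_1_7 by blast
  moreover have "lin_comb e (wedge_terms (wedge_terms (?c i) (?c j)) phi_terms) = lin_comb e (w (?c i) (?c j))"
    unfolding w_def lin_comb_filter lin_comb_collect_terms wedge_lin_comb[symmetric] ..
  ultimately show ?thesis by (simp add: lin_comb_Cons lin_comb_Nil del: ew.simps)
qed

section \<open>The G2-structure of a moving coframe\<close>

context coframe
begin

lemma g2_metric_vol_phi: "g2_metric_vol (lin_comb e phi_terms) metric volume"
  unfolding g2_metric_vol_def
proof (intro conjI allI impI)
  let ?\<phi> = "lin_comb e phi_terms"
  show "inner_product metric" by (rule inner_product_metric)
  show "alternating_form 7 volume"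
  proof -
    have "length [1,2,3,4,5,6,7::nat] = 7" by simp
    then show ?thesis by (metis alternating_formI homogeneous_ew multilinear_ew alternates_ew)
  qed
  show "\<bar>volume E\<bar> = 1" if "orthonormal_frame metric E" for E
    by (rule volume_orthonormal_frame[OF that])
  fix X Y and vs :: "'a list"
  have lin: "linear (\<lambda>v. ?\<phi> (v # us))" for us by (rule multilinear_linear_Cons[OF multilinear_lin_comb])
  have add: "interior_product (u + v) ?\<phi> = (\<lambda>us. interior_product u ?\<phi> us + interior_product v ?\<phi> us)"
    and scale: "interior_product (r *\<^sub>R v) ?\<phi> = (\<lambda>us. r * interior_product v ?\<phi> us)" for u v r
    by (simp_all add: interior_product_def linear_add[OF lin] linear_scale[OF lin])
  have wedge_fun: "wedge (\<lambda>us. \<alpha> us + \<alpha>' us) \<beta> = (\<lambda>us. wedge \<alpha> \<beta> us + wedge \<alpha>' \<beta> us)"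
    "wedge \<beta> (\<lambda>us. \<alpha> us + \<alpha>' us) = (\<lambda>us. wedge \<beta> \<alpha> us + wedge \<beta> \<alpha>' us)"
    "wedge (\<lambda>us. r * \<alpha> us) \<beta> = (\<lambda>us. r * wedge \<alpha> \<beta> us)"
    "wedge \<beta> (\<lambda>us. r * \<alpha> us) = (\<lambda>us. r * wedge \<beta> \<alpha> us)" for \<alpha> \<alpha>' \<beta> :: "('a, real) form" and r
    by (intro ext wedge_add_left wedge_add_right wedge_scale_left wedge_scale_right)+
  have bil: "bilinear (\<lambda>X Y. wedge (wedge (interior_product X ?\<phi>) (interior_product Y ?\<phi>)) ?\<phi> vs)"
    unfolding bilinear_def by (auto intro!: linearI simp: add scale wedge_fun)
  have bil': "bilinear (\<lambda>X Y. 6 * metric X Y * volume vs)"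
    unfolding bilinear_def
    by (auto intro!: linearI simp: bilinear_ladd[OF bilinear_metric] bilinear_radd[OF bilinear_metric]
        bilinear_lmul[OF bilinear_metric] bilinear_rmul[OF bilinear_metric] algebra_simps simp del: ew.simps)
  show "6 * metric X Y * volume vs = wedge (wedge (interior_product X ?\<phi>) (interior_product Y ?\<phi>)) ?\<phi> vs"
  proof (rule bilinear_eq[OF bil' bil, of UNIV "b ` {1..7}" UNIV "b ` {1..7}"])
    fix x y assume "x \<in> b ` {1..7}" "y \<in> b ` {1..7}"
    then obtain i j where ij: "i \<in> {1..7}" "x = b i" "j \<in> {1..7}" "y = b j" by blast
    have "\<forall>(c, I)\<in>set phi_terms. set I \<subseteq> {1..7}" by (simp add: phi_terms_def)
    note ip = interior_product_lin_comb[OF _ this]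
    show "6 * metric x y * volume vs = wedge (wedge (interior_product x ?\<phi>) (interior_product y ?\<phi>)) ?\<phi> vs"
      using ij unfolding ij(2,4) ip[OF ij(1)] ip[OF ij(3)] wedge_lin_comb contract_phi[OF ij(1,3)]
      by (simp add: metric_frame del: ew.simps)
  qed (use span_frame in auto)
qed

lemma ew_reindex: "ew (\<lambda>i. a (p i)) I = ew a (map p I)"
  by (induction I) auto

text \<open>The permutation \<open>1, 3, 5, 7, 2, 4, 6\<close> of the coframe turns \<open>\<phi>\<close> into the standard 3-form.\<close>

lemma g2_form_phi: "g2_form (lin_comb e phi_terms)"
proof -
  define p :: "nat \<Rightarrow> nat" where "p i = [0,1,3,5,7,2,4,6] ! i" for i
  have p: "p 1 = 1" "p 2 = 3" "p 3 = 5" "p 4 = 7" "p 5 = 2" "p 6 = 4" "p 7 = 6"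
    by (simp_all add: p_def numeral_eq_Suc One_nat_def)
  have p_range: "p i \<in> {1..7}" if "i \<in> {1..7}" for i
    using that p unfolding atLeastAtMost_1_7 by auto
  have p_inj: "p i = p j \<longleftrightarrow> i = j" if "i \<in> {1..7}" "j \<in> {1..7}" for i j
    using that p unfolding atLeastAtMost_1_7 by auto
  have "coframe (\<lambda>i. e (p i)) (\<lambda>i. b (p i))"
    using DIM_7 p_inj dual p_range by unfold_locales auto
  then have "dual_basis (\<lambda>i. e (p i)) 7" by (rule coframe.dual_basis)
  moreover have "lin_comb e phi_terms = lin_comb e [(1, [1,3,5]), (1, [1,7,2]), (1, [1,4,6]), (1, [3,7,4]), (- 1, [3,2,6]), (- 1, [5,7,6]), (- 1, [5,2,4])]"
    unfolding lin_comb_collect_terms[of e "_ # _", symmetric]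
    by (simp add: phi_terms_def lin_comb_Cons lin_comb_Nil fun_eq_iff del: ew.simps)
  ultimately show ?thesis
    unfolding g2_form_def
    by (intro exI[of _ "\<lambda>i. e (p i)"]) (simp add: ew_reindex p lin_comb_Cons lin_comb_Nil fun_eq_iff del: ew.simps)
qed

end

lemma g2_star_lin_comb:
  assumes "coframe (f x) b" "\<phi> x = lin_comb (f x) phi_terms" "\<beta> x = lin_comb (f x) p" "increasing_terms p"
  shows "g2_star \<phi> \<beta> x = lin_comb (f x) (star_terms p)"
proof -
  interpret coframe "f x" b by (rule assms(1))
  show ?thesis
    unfolding g2_star_def assms(2,3) g2_metric_volume[OF g2_metric_vol_phi] by (rule hodge_lin_comb[OF assms(4)])
qed

lemma wedge_by_const:
  fixes \<alpha> \<beta> :: "('a, real) form"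
  assumes "bilinear h"
  shows "wedge_by h (\<lambda>us. \<alpha> us *\<^sub>R u) (\<lambda>us. \<beta> us *\<^sub>R v) vs = wedge \<alpha> \<beta> vs *\<^sub>R h u v"
  by (simp add: wedge_by_def bilinear_lmul[OF assms] bilinear_rmul[OF assms] scaleR_sum_left mult_ac)

lemma wedge_by_scaleR_const:
  fixes \<alpha> \<beta> :: "('a, real) form"
  shows "wedge_by (\<lambda>F r. r *\<^sub>R F) (\<lambda>us. \<alpha> us *\<^sub>R u) \<beta> vs = wedge \<alpha> \<beta> vs *\<^sub>R u"
  by (simp add: wedge_by_def scaleR_sum_left mult.commute)

lemma bilinear_scaleR_flip: "bilinear (\<lambda>F r. r *\<^sub>R F)"
  by (auto simp: bilinear_def scaleR_add_left scaleR_add_right intro!: linearI)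

lemma bilinear_sl2_bracket: "bilinear sl2_bracket"
  by (auto simp: bilinear_def sl2_bracket_def vec_eq_iff matrix_matrix_mult_def sum.distrib sum_distrib_left
      sum_subtractf algebra_simps intro!: linearI)

text \<open>Isolates the input of the G2 and gauge computations, a coframe with the structure
  equations of the Lie algebra. The group returns only when such a coframe is produced, in
  \<open>g2_moving_coframe_left_invariant\<close>.\<close>

locale g2_moving_coframe =
  fixes f :: "'a::euclidean_space \<Rightarrow> nat \<Rightarrow> ('a \<Rightarrow>\<^sub>L real)" and b :: "'a \<Rightarrow> nat \<Rightarrow> 'a"
    and \<delta> \<epsilon>1 \<epsilon>2 \<epsilon>3 :: real
  assumes coframe: "coframe (f x) (b x)"
    and smooth_coframe: "smooth (\<lambda>x. blinfun_apply (f x i) v)"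
    and structure_eq: "i \<in> {1..7} \<Longrightarrow> ext_d (\<lambda>y. oneform (f y i)) x = lin_comb (f x) (structure_terms \<delta> \<epsilon>1 \<epsilon>2 \<epsilon>3 i)"
begin

abbreviation phi :: "'a \<Rightarrow> ('a, real) form" where
  "phi \<equiv> \<lambda>x. lin_comb (f x) phi_terms"

lemma ext_d_coframe:
  "\<forall>(c, I)\<in>set p. set I \<subseteq> {1..7} \<Longrightarrow>
    ext_d (\<lambda>y. lin_comb (f y) p) x = lin_comb (f x) (d_terms (structure_terms \<delta> \<epsilon>1 \<epsilon>2 \<epsilon>3) p)"
  by (rule ext_d_lin_comb[OF smooth_coframe structure_eq])

lemma smooth_family_coframe: "smooth_family (\<lambda>x. lin_comb (f x) p)"
  by (rule smooth_family_lin_comb[OF smooth_coframe])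

lemma smooth_family_oneform_coframe: "smooth_family (\<lambda>x. oneform (f x i))"
  by (rule smooth_family_oneform[OF smooth_coframe])

lemma g2_structure_phi: "g2_structure phi"
proof -
  have "alternating_form 3 (phi x)" for x
    by (intro alternating_formI homogeneous_lin_comb multilinear_lin_comb alternates_lin_comb)
      (simp add: homogeneous_terms_def phi_terms_def)
  then show ?thesis
    using smooth_family_coframe coframe.g2_form_phi[OF coframe]
    by (simp add: g2_structure_def smooth_form_def smooth_family_def)
qed

lemma star_phi_coframe:
  "\<beta> x = lin_comb (f x) p \<Longrightarrow> increasing_terms p \<Longrightarrow> g2_star phi \<beta> x = lin_comb (f x) (star_terms p)"
  by (rule g2_star_lin_comb[OF coframe refl])

lemma g2_psi_phi: "g2_psi phi x = lin_comb (f x) psi_terms"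
  unfolding g2_psi_def star_phi[symmetric]
  by (rule star_phi_coframe[OF refl]) (simp add: increasing_terms_def phi_terms_def)

lemma g2_coclosed_phi: "g2_coclosed phi"
  unfolding g2_coclosed_def
proof (intro allI)
  fix x vs
  have "g2_psi phi = (\<lambda>x. lin_comb (f x) psi_terms)" by (rule ext) (rule g2_psi_phi)
  moreover have "\<forall>(c, I)\<in>set psi_terms. set I \<subseteq> {1..7}" by (simp add: psi_terms_def)
  ultimately show "ext_d (g2_psi phi) x vs = 0" using ext_d_coframe d_psi by metis
qed

lemma ext_d_phi: "ext_d phi x = lin_comb (f x) (dphi_terms \<delta> \<epsilon>1 \<epsilon>2 \<epsilon>3)"
proof -
  have "\<forall>(c, I)\<in>set phi_terms. set I \<subseteq> {1..7}" by (simp add: phi_terms_def)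
  then show ?thesis using ext_d_coframe d_phi by metis
qed

lemma star_dphi_wedge_phi: "g2_star phi (\<lambda>y. wedge (ext_d phi y) (phi y)) x [] = - 4 * \<delta>"
proof -
  have "wedge (ext_d phi x) (phi x) = lin_comb (f x) [(- 4 * \<delta>, [1,2,3,4,5,6,7])]"
    unfolding ext_d_phi wedge_lin_comb by (rule wedge_dphi_phi)
  from star_phi_coframe[of "\<lambda>y. wedge (ext_d phi y) (phi y)" x, OF this]
  show ?thesis by (simp add: increasing_terms_def star_terms_def lin_comb_Cons lin_comb_Nil)
qed

lemma g2_tau0_phi: "g2_tau0 phi x = - 4 / 7 * \<delta>"
  unfolding g2_tau0_def star_dphi_wedge_phi by simp

lemma star_dphi: "g2_star phi (ext_d phi) x = lin_comb (f x) (star_dphi_terms \<delta> \<epsilon>1 \<epsilon>2 \<epsilon>3)"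
  unfolding star_d_phi[symmetric]
  by (rule star_phi_coframe[OF ext_d_phi]) (simp add: increasing_terms_def dphi_terms_def)

lemma g2_tau1_phi: "g2_tau1 phi x vs = 0"
proof -
  have "wedge (phi x) (g2_star phi (ext_d phi) x) = lin_comb (f x) []"
    unfolding star_dphi wedge_lin_comb by (simp add: wedge_phi_star_dphi lin_comb_Nil fun_eq_iff)
  from star_phi_coframe[of "\<lambda>y. wedge (phi y) (g2_star phi (ext_d phi) y)" x, OF this]
  show ?thesis by (simp add: g2_tau1_def increasing_terms_def star_terms_def lin_comb_Nil)
qed

lemma g2_torsion_phi: "g2_torsion phi x = lin_comb (f x) (torsion_terms \<delta> \<epsilon>1 \<epsilon>2 \<epsilon>3)"
proof -
  have "wedge (\<lambda>us. 4 * g2_tau1 phi x us) (phi x) = lin_comb (f x) []"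
    by (auto simp: g2_tau1_phi wedge_zero_left lin_comb_Nil)
  from star_phi_coframe[of "\<lambda>y. wedge (\<lambda>us. 4 * g2_tau1 phi y us) (phi y)" x, OF this]
  have "g2_star phi (\<lambda>y. wedge (\<lambda>us. 4 * g2_tau1 phi y us) (phi y)) x = (\<lambda>vs. 0)"
    by (simp add: increasing_terms_def star_terms_def lin_comb_Nil)
  then show ?thesis
    unfolding g2_torsion_def star_dphi_wedge_phi star_dphi torsion_terms_def lin_comb_append lin_comb_scale
    by (auto simp: fun_eq_iff)
qed

lemma ext_d_torsion: "ext_d (g2_torsion phi) x = lin_comb (f x) (d_terms (structure_terms \<delta> \<epsilon>1 \<epsilon>2 \<epsilon>3) (torsion_terms \<delta> \<epsilon>1 \<epsilon>2 \<epsilon>3))"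
proof -
  have "g2_torsion phi = (\<lambda>x. lin_comb (f x) (torsion_terms \<delta> \<epsilon>1 \<epsilon>2 \<epsilon>3))" by (rule ext) (rule g2_torsion_phi)
  moreover have "\<forall>(c, I)\<in>set (torsion_terms \<delta> \<epsilon>1 \<epsilon>2 \<epsilon>3). set I \<subseteq> {1..7}"
    by (simp add: torsion_terms_def scale_terms_def phi_terms_def star_dphi_terms_def)
  ultimately show ?thesis using ext_d_coframe by metis
qed

lemma closed_coframe:
  assumes "i \<in> {1..4}"
  shows "\<exists>F. smooth F \<and> (\<forall>x. (F has_derivative blinfun_apply (f x i)) (at x))"
proof (rule poincare_one_form)
  show "linear (blinfun_apply (f x i))" for x by (rule bounded_linear.linear[OF blinfun.bounded_linear_right])
  fix x u v
  have "ext_d (\<lambda>y. oneform (f y i)) x [u, v] = 0"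
    using structure_eq[of i x] assms by (simp add: structure_terms_def lin_comb_Nil)
  then show "frechet_derivative (\<lambda>y. blinfun_apply (f y i) v) (at x) u = frechet_derivative (\<lambda>y. blinfun_apply (f y i) u) (at x) v"
    by (simp add: ext_d_def oneform_def)
qed (rule smooth_coframe)

end

section \<open>Instantons and the Bianchi identity\<close>

lemma sl2_bracket_anticommute: "sl2_bracket N M = - sl2_bracket M N"
  by (simp add: sl2_bracket_def)

lemma trace_sl2_bracket: "trace (sl2_bracket M N ** L) + trace (N ** sl2_bracket M L) = 0"
  by (simp add: sl2_bracket_def trace_def matrix_matrix_mult_def sum_2 algebra_simps)

text \<open>Polarized Cayley-Hamilton: for traceless M and N the sum MN + NM is tr(MN) times the
  identity. The formula allows traces to be read off from known brackets, as in
  \<open>trace_Y_diagonal\<close>.\<close>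

lemma sl2_double_bracket:
  assumes "M \<in> sl2" "N \<in> sl2"
  shows "sl2_bracket M (sl2_bracket M N) = (2 * trace (M ** M)) *\<^sub>R N - (2 * trace (M ** N)) *\<^sub>R M"
proof -
  have "M $ 2 $ 2 = - (M $ 1 $ 1)" "N $ 2 $ 2 = - (N $ 1 $ 1)"
    using assms by (auto simp: sl2_def trace_def sum_2 add_eq_0_iff)
  then show ?thesis
    by (simp add: vec_eq_iff forall_2 sl2_bracket_def trace_def matrix_matrix_mult_def sum_2 algebra_simps)
qed

lemma trace_transpose_mult_eq_0:
  fixes M :: "real^2^2"
  assumes "trace (M ** transpose M) = 0" shows "M = 0"
proof -
  have "(M $ 1 $ 1)\<^sup>2 + (M $ 1 $ 2)\<^sup>2 + ((M $ 2 $ 1)\<^sup>2 + (M $ 2 $ 2)\<^sup>2) = 0"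
    using assms by (simp add: trace_def matrix_matrix_mult_def transpose_def sum_2 power2_eq_square)
  then show ?thesis by (simp add: vec_eq_iff forall_2 add_nonneg_eq_0_iff)
qed

definition u1_sl2_pairing :: "real \<Rightarrow> real \<Rightarrow> complex \<times> (real^2^2) \<Rightarrow> complex \<times> (real^2^2) \<Rightarrow> real" where
  "u1_sl2_pairing r s x y = r * (Im (fst x) * Im (fst y)) + s * trace (snd x ** snd y)"

lemma bilinear_u1_sl2_pairing: "bilinear (u1_sl2_pairing r s)"
  by (auto simp: bilinear_def u1_sl2_pairing_def trace_def matrix_matrix_mult_def sum_2 algebra_simps intro!: linearI)

lemma ad_invariant_u1_sl2_pairing:
  assumes "r \<noteq> 0" "s \<noteq> 0"
  shows "ad_invariant_pairing (u1 \<times> sl2) u1_sl2_bracket (u1_sl2_pairing r s)"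
  unfolding ad_invariant_pairing_def
proof (intro conjI ballI impI)
  show "bilinear (u1_sl2_pairing r s)" by (rule bilinear_u1_sl2_pairing)
  show "u1_sl2_pairing r s x y = u1_sl2_pairing r s y x" for x y
    by (simp add: u1_sl2_pairing_def trace_mul_sym[of "snd x" "snd y"])
  show "u1_sl2_pairing r s (u1_sl2_bracket x y) z + u1_sl2_pairing r s y (u1_sl2_bracket x z) = 0" for x y z
    using trace_sl2_bracket[of "snd x" "snd y" "snd z"]
    by (simp add: u1_sl2_pairing_def u1_sl2_bracket_def u1_bracket_def distrib_left[symmetric])
  fix x assume x: "x \<in> u1 \<times> sl2" and 0: "\<forall>y\<in>u1 \<times> sl2. u1_sl2_pairing r s x y = 0"
  have "(\<i>, 0) \<in> u1 \<times> sl2" by (simp add: u1_def sl2_def trace_def)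
  from 0[rule_format, OF this] have "Im (fst x) = 0"
    using assms by (simp add: u1_sl2_pairing_def trace_def matrix_matrix_mult_def)
  moreover have "Re (fst x) = 0" using x by (auto simp: u1_def)
  \<comment> \<open>The trace form is indefinite, so x is not paired with itself but with the
    transpose, which is traceless too and yields a sum of squares.\<close>
  moreover have "(0, transpose (snd x)) \<in> u1 \<times> sl2"
    using x by (auto simp: u1_def sl2_def trace_def transpose_def)
  from 0[rule_format, OF this] have "snd x = 0"
    using assms by (intro trace_transpose_mult_eq_0) (simp add: u1_sl2_pairing_def)
  ultimately show "x = 0" by (simp add: prod_eq_iff complex_eq_iff)
qed

context
  fixes \<delta> :: real and Y5 Y6 Y7 :: "real^2^2"
  assumes Y_basis: "independent {Y5, Y6, Y7}" "span {Y5, Y6, Y7} = sl2"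
    and brackets: "sl2_bracket Y6 Y7 = (- 2 * \<delta>) *\<^sub>R Y5"
      "sl2_bracket Y7 Y5 = (2 * \<delta>) *\<^sub>R Y6" "sl2_bracket Y5 Y6 = (2 * \<delta>) *\<^sub>R Y7"
    and \<delta>: "\<delta> \<noteq> 0"
begin

lemma Y_sl2: "Y5 \<in> sl2" "Y6 \<in> sl2" "Y7 \<in> sl2"
  using span_base[of _ "{Y5, Y6, Y7}"] Y_basis(2) by auto

text \<open>By invariance N is trace-orthogonal to every bracket of N with another matrix, and up to
  a nonzero factor each basis element is a bracket of the other two.\<close>

lemma trace_Y_offdiagonal: "trace (Y5 ** Y6) = 0" "trace (Y5 ** Y7) = 0" "trace (Y6 ** Y7) = 0"
proof -
  have self: "trace (N ** sl2_bracket M N) = 0" for M N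
    using trace_sl2_bracket[of M N N] by (simp add: trace_mul_sym[of "sl2_bracket M N"])
  have scale: "trace (M ** (c *\<^sub>R N)) = c * trace (M ** N)" for M N :: "real^2^2" and c
    by (simp add: trace_def matrix_matrix_mult_def sum_2 algebra_simps)
  show "trace (Y5 ** Y6) = 0" using self[of Y5 Y7] \<delta> by (simp add: brackets scale)
  show "trace (Y6 ** Y7) = 0" using self[of Y6 Y5] \<delta> by (simp add: brackets scale)
  show "trace (Y5 ** Y7) = 0" using self[of Y7 Y6, unfolded brackets scale] \<delta> by (simp add: trace_mul_sym[of Y7])
qed

text \<open>Three double brackets, such as that of Y5 with the bracket of Y5 and Y6, are evaluated
  both from the given brackets and by \<open>sl2_double_bracket\<close>. The negative sign at Y5 is
  what matches the sign pattern in \<open>d_torsion\<close>.\<close>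

lemma trace_Y_diagonal: "trace (Y5 ** Y5) = - 2 * \<delta>\<^sup>2" "trace (Y6 ** Y6) = 2 * \<delta>\<^sup>2" "trace (Y7 ** Y7) = 2 * \<delta>\<^sup>2"
proof -
  have nz: "Y5 \<noteq> 0" "Y6 \<noteq> 0" "Y7 \<noteq> 0" using Y_basis(1) dependent_zero[of "{Y5, Y6, Y7}"] by auto
  have scale: "sl2_bracket M (c *\<^sub>R N) = c *\<^sub>R sl2_bracket M N" for M N c
    by (rule bilinear_rmul[OF bilinear_sl2_bracket])
  note dbl = sl2_double_bracket[OF Y_sl2(1) Y_sl2(2)] sl2_double_bracket[OF Y_sl2(2) Y_sl2(3)] sl2_double_bracket[OF Y_sl2(3) Y_sl2(1)]
  have rev: "sl2_bracket Y5 Y7 = (- 2 * \<delta>) *\<^sub>R Y6" "sl2_bracket Y6 Y5 = (- 2 * \<delta>) *\<^sub>R Y7" "sl2_bracket Y7 Y6 = (2 * \<delta>) *\<^sub>R Y5"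
    using brackets sl2_bracket_anticommute[of Y5 Y7] sl2_bracket_anticommute[of Y6 Y5] sl2_bracket_anticommute[of Y7 Y6] by simp_all
  have "(2 * trace (Y5 ** Y5)) *\<^sub>R Y6 = (2 * (- 2 * \<delta>\<^sup>2)) *\<^sub>R Y6"
    using dbl(1)[unfolded brackets scale rev trace_Y_offdiagonal] by (auto simp: power2_eq_square)
  then show "trace (Y5 ** Y5) = - 2 * \<delta>\<^sup>2" using nz by (simp only: scaleR_cancel_right) simp
  have "(2 * trace (Y6 ** Y6)) *\<^sub>R Y7 = (2 * (2 * \<delta>\<^sup>2)) *\<^sub>R Y7"
    using dbl(2)[unfolded brackets scale rev trace_Y_offdiagonal] by (auto simp: power2_eq_square)
  then show "trace (Y6 ** Y6) = 2 * \<delta>\<^sup>2" using nz by simp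
  have "(2 * trace (Y7 ** Y7)) *\<^sub>R Y5 = (2 * (2 * \<delta>\<^sup>2)) *\<^sub>R Y5"
    using dbl(3)[unfolded brackets scale rev trace_mul_sym[of Y7 Y5] trace_Y_offdiagonal] by (auto simp: power2_eq_square)
  then show "trace (Y7 ** Y7) = 2 * \<delta>\<^sup>2" using nz by simp
qed

end

section \<open>Curvature of a product connection\<close>

lemma wedge_by_fst_snd:
  "wedge_by u1_sl2_bracket \<alpha> \<beta> vs =
    (wedge_by u1_bracket (\<lambda>us. fst (\<alpha> us)) (\<lambda>us. fst (\<beta> us)) vs, wedge_by sl2_bracket (\<lambda>us. snd (\<alpha> us)) (\<lambda>us. snd (\<beta> us)) vs)"
  by (simp add: prod_eq_iff wedge_by_def fst_sum snd_sum u1_sl2_bracket_def)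

lemma curvature_product_connection:
  assumes "smooth_family \<xi>" "smooth_family A"
  shows "curvature u1_sl2_bracket (product_connection \<xi> A) x vs = (curvature u1_bracket \<xi> x vs, curvature sl2_bracket A x vs)"
proof -
  let ?l = "\<lambda>z::complex. (z, 0::real^2^2)" and ?r = "\<lambda>M::real^2^2. (0::complex, M)"
  have bl: "bounded_linear ?l" "bounded_linear ?r"
    by (auto intro!: bounded_linear_Pair bounded_linear_ident bounded_linear_zero)
  have sm: "smooth_family (\<lambda>x us. ?l (\<xi> x us))" "smooth_family (\<lambda>x us. ?r (A x us))"
    using assms by (auto simp: smooth_family_def intro: smooth_bounded_linear_compose[OF bl(1)] smooth_bounded_linear_compose[OF bl(2)])
  have "product_connection \<xi> A = (\<lambda>x us. ?l (\<xi> x us) + ?r (A x us))"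
    by (auto simp: product_connection_def fun_eq_iff)
  then have "ext_d (product_connection \<xi> A) x vs = (ext_d \<xi> x vs, ext_d A x vs)"
    using ext_d_add[OF sm, of x vs] ext_d_bounded_linear[OF bl(1) assms(1), of x vs] ext_d_bounded_linear[OF bl(2) assms(2), of x vs]
    by simp
  then show ?thesis
    by (simp add: curvature_def wedge_by_fst_snd product_connection_def)
qed

section \<open>The abelian instanton\<close>

context g2_moving_coframe
begin

lemma u1_instanton:
  obtains \<xi> where "g2_instanton u1 u1_bracket phi \<xi>" "smooth_family \<xi>"
    "\<And>x vs. curvature u1_bracket \<xi> x vs = lin_comb (f x) [(1, [1,3]), (1, [2,4])] vs *\<^sub>R \<i>"
proof -
  obtain X1 where X1: "smooth X1" "\<And>x. (X1 has_derivative blinfun_apply (f x 1)) (at x)"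
    using closed_coframe[of 1] by auto
  obtain X2 where X2: "smooth X2" "\<And>x. (X2 has_derivative blinfun_apply (f x 2)) (at x)"
    using closed_coframe[of 2] by auto
  \<comment> \<open>A function as a 0-form: its product with a 1-form is then a wedge product, which
    \<open>ext_d_wedge\<close> differentiates with \<open>k = 0\<close>.\<close>
  define z where "z X x us = (if us = [] then X x else 0)" for X :: "'a \<Rightarrow> real" and x and us :: "'a list"
  have sm_z: "smooth_family (z X)" if "smooth X" for X
    unfolding smooth_family_def
  proof
    fix us show "smooth (\<lambda>x. z X x us)" by (cases "us = []") (simp_all add: z_def that smooth_const)
  qed
  have hom_z: "homogeneous 0 (z X x)" for X x by (simp add: homogeneous_def z_def)
  have d_z: "ext_d (z X) x = oneform (f x i)" if "\<And>x. (X has_derivative blinfun_apply (f x i)) (at x)" for X i x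
  proof
    fix us :: "'a list"
    show "ext_d (z X) x us = oneform (f x i) us"
    proof (cases "length us = 1")
      case True
      then obtain v where "us = [v]" by (cases us) auto
      then show ?thesis
        using frechet_derivative_at[OF that, of x] by (simp add: ext_d_def z_def oneform_def)
    next
      case False
      then show ?thesis
        using homogeneousD[OF homogeneous_ext_d[OF hom_z], of us] by (simp add: oneform_def One_nat_def)
    qed
  qed
  define \<eta> where "\<eta> x us = wedge (z X1 x) (oneform (f x 3)) us + wedge (z X2 x) (oneform (f x 4)) us" for x us
  have \<eta>: "\<eta> x us = X1 x * oneform (f x 3) us + X2 x * oneform (f x 4) us" for x us
    by (simp add: \<eta>_def z_def[abs_def] wedge_zero_form)
  have sm_\<eta>': "smooth_family (\<lambda>x. wedge (z X1 x) (oneform (f x 3)))" "smooth_family (\<lambda>x. wedge (z X2 x) (oneform (f x 4)))"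
    by (intro smooth_family_wedge_by bounded_bilinear_mult sm_z X1 X2 smooth_family_oneform_coframe)+
  then have sm_\<eta>: "smooth_family \<eta>" by (auto simp: smooth_family_def \<eta>_def intro: smooth_add)
  have d_oneform: "ext_d (\<lambda>y. oneform (f y i)) x = (\<lambda>us. 0)" if "i \<in> {3, 4}" for i x
    using that by (subst structure_eq) (auto simp: structure_terms_def lin_comb_Nil)
  have d_\<eta>: "ext_d \<eta> x us = lin_comb (f x) [(1, [1,3]), (1, [2,4])] us" for x us
  proof -
    have "ext_d \<eta> x us = ext_d (\<lambda>x. wedge (z X1 x) (oneform (f x 3))) x us + ext_d (\<lambda>x. wedge (z X2 x) (oneform (f x 4))) x us"
      using ext_d_add[OF sm_\<eta>', of x us] by (simp add: \<eta>_def[abs_def])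
    also have "\<dots> = wedge (oneform (f x 1)) (oneform (f x 3)) us + wedge (oneform (f x 2)) (oneform (f x 4)) us"
      using ext_d_wedge[OF hom_z sm_z[OF X1(1)] smooth_family_oneform_coframe[of 3], of x us]
        ext_d_wedge[OF hom_z sm_z[OF X2(1)] smooth_family_oneform_coframe[of 4], of x us]
      by (simp add: d_z[OF X1(2)] d_z[OF X2(2)] d_oneform wedge_zero_right)
    finally show ?thesis
      by (simp add: lin_comb_Cons lin_comb_Nil ew_singleton[symmetric] wedge_ew del: ew.simps)
  qed
  define \<xi> where "\<xi> x us = \<eta> x us *\<^sub>R \<i>" for x us
  have bl: "bounded_linear (\<lambda>r. r *\<^sub>R \<i>)" by (rule bounded_linear_scaleR_left)
  have sm_\<xi>: "smooth_family \<xi>"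
    using sm_\<eta> by (auto simp: smooth_family_def \<xi>_def intro: smooth_bounded_linear_compose[OF bl])
  have curv: "curvature u1_bracket \<xi> x vs = lin_comb (f x) [(1, [1,3]), (1, [2,4])] vs *\<^sub>R \<i>" for x vs
    using ext_d_bounded_linear[OF bl sm_\<eta>, of x vs]
    by (simp add: curvature_def d_\<eta> \<xi>_def[abs_def] wedge_by_def u1_bracket_def mult.commute)
  have "alternating_form 1 (\<xi> x)" for x
  proof (rule alternating_formI)
    have hom: "oneform (f x i) us = 0" if "length us \<noteq> 1" for i us
      using homogeneousD[OF homogeneous_oneform that] .
    show "homogeneous 1 (\<xi> x)" by (simp add: homogeneous_def \<xi>_def \<eta> hom)
    \<comment> \<open>At a fixed point the coefficients are just numbers, so the algebraic facts
      about \<open>lin_comb\<close> apply although they vary with the point.\<close>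
    have eq: "\<xi> x us = lin_comb (f x) [(X1 x, [3]), (X2 x, [4])] us *\<^sub>R \<i>" for us
      by (simp add: \<xi>_def \<eta> lin_comb_Cons lin_comb_Nil ew_singleton del: ew.simps)
    show "alternates (\<xi> x)"
      using alternates_lin_comb[of "f x" "[(X1 x, [3]), (X2 x, [4])]"] by (simp add: alternates_def eq)
    show "multilinear (\<xi> x)"
      unfolding multilinear_def eq
    proof (intro allI impI)
      fix vs :: "'a list" and i assume "i < length vs"
      then have "linear (\<lambda>v. lin_comb (f x) [(X1 x, [3]), (X2 x, [4])] (vs[i := v]))"
        using multilinear_lin_comb[of "f x" "[(X1 x, [3]), (X2 x, [4])]"] unfolding multilinear_def by blast
      from linear_compose[OF this bounded_linear.linear[OF bl]]
      show "linear (\<lambda>v. lin_comb (f x) [(X1 x, [3]), (X2 x, [4])] (vs[i := v]) *\<^sub>R \<i>)" by (simp add: comp_def)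
    qed
  qed
  then have "connection_form u1 \<xi>"
    using sm_\<xi> by (simp add: connection_form_def smooth_form_def smooth_family_def u1_def \<xi>_def)
  moreover have "wedge_by (\<lambda>F r. r *\<^sub>R F) (curvature u1_bracket \<xi> x) (g2_psi phi x) vs = 0" for x vs
    using wedge_asd_psi by (simp add: curv[abs_def] g2_psi_phi wedge_by_scaleR_const wedge_lin_comb)
  ultimately show ?thesis using that sm_\<xi> curv by (auto simp: g2_instanton_def)
qed

end

section \<open>The nonabelian instanton and the Bianchi identity\<close>

context g2_moving_coframe
begin

context
  fixes Y5 Y6 Y7 :: "real^2^2"
  assumes Y_basis: "independent {Y5, Y6, Y7}" "span {Y5, Y6, Y7} = sl2"
    and brackets: "sl2_bracket Y6 Y7 = (- 2 * \<delta>) *\<^sub>R Y5"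
      "sl2_bracket Y7 Y5 = (2 * \<delta>) *\<^sub>R Y6" "sl2_bracket Y5 Y6 = (2 * \<delta>) *\<^sub>R Y7"
    and \<delta>: "\<delta> \<noteq> 0"
begin

definition sl2_connection :: "'a \<Rightarrow> ('a, real^2^2) form" where
  "sl2_connection x = (\<lambda>vs. oneform (f x 5) vs *\<^sub>R Y5 + oneform (f x 6) vs *\<^sub>R Y6 + oneform (f x 7) vs *\<^sub>R Y7)"

lemma smooth_family_scaleR: "smooth_family \<alpha> \<Longrightarrow> smooth_family (\<lambda>x us. \<alpha> x us *\<^sub>R u)"
  by (auto simp: smooth_family_def intro: smooth_bounded_linear_compose[OF bounded_linear_scaleR_left])

lemma smooth_family_sl2_connection: "smooth_family sl2_connection"
  using smooth_family_scaleR[OF smooth_family_oneform_coframe]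
  by (auto simp: smooth_family_def sl2_connection_def intro!: smooth_add)

lemma connection_form_sl2_connection: "connection_form sl2 sl2_connection"
proof -
  have lin: "linear (\<lambda>v. oneform (f x i) (vs[j := v]) *\<^sub>R Y)" if "j < length vs" for x i vs j and Y :: "real^2^2"
  proof -
    have "linear (\<lambda>v. oneform (f x i) (vs[j := v]))"
      using multilinear_ew[of "f x" "[i]"] that unfolding ew_singleton multilinear_def by blast
    from linear_compose[OF this bounded_linear.linear[OF bounded_linear_scaleR_left]] show ?thesis by (simp add: comp_def)
  qed
  have hom: "oneform (f x i) vs = 0" if "length vs \<noteq> 1" for x i vs
    using homogeneousD[OF homogeneous_oneform that] .
  have alt: "oneform (f x i) vs = 0" if "\<not> distinct vs" for x i vs
    using alternates_ew[of "f x" "[i]"] that unfolding ew_singleton alternates_def by blast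
  have "alternating_form 1 (sl2_connection x)" for x
    by (rule alternating_formI)
      (auto simp: homogeneous_def multilinear_def alternates_def sl2_connection_def hom alt intro!: linear_compose_add lin)
  moreover have "sl2_connection x vs \<in> sl2" for x vs
    unfolding sl2_connection_def Y_basis(2)[symmetric] by (intro span_add span_scale span_base) auto
  ultimately show ?thesis
    using smooth_family_sl2_connection by (simp add: connection_form_def smooth_form_def smooth_family_def)
qed

lemma curvature_sl2_connection:
  "curvature sl2_bracket sl2_connection x vs =
    lin_comb (f x) (curvature_terms \<delta> \<epsilon>1 \<epsilon>2 \<epsilon>3 5) vs *\<^sub>R Y5
    + lin_comb (f x) (curvature_terms \<delta> \<epsilon>1 \<epsilon>2 \<epsilon>3 6) vs *\<^sub>R Y6
    + lin_comb (f x) (curvature_terms \<delta> \<epsilon>1 \<epsilon>2 \<epsilon>3 7) vs *\<^sub>R Y7"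
proof -
  let ?a = "\<lambda>i x. oneform (f x i)" and ?s = "structure_terms \<delta> \<epsilon>1 \<epsilon>2 \<epsilon>3"
  note sm = smooth_family_scaleR[OF smooth_family_oneform_coframe]
  have sm56: "smooth_family (\<lambda>x us. ?a 5 x us *\<^sub>R Y5 + ?a 6 x us *\<^sub>R Y6)"
    using sm by (auto simp: smooth_family_def intro!: smooth_add)
  have d: "ext_d (\<lambda>x us. ?a i x us *\<^sub>R Y) x vs = lin_comb (f x) (?s i) vs *\<^sub>R Y" if "i \<in> {1..7}" for i and Y :: "real^2^2"
    by (simp add: ext_d_bounded_linear[OF bounded_linear_scaleR_left smooth_family_oneform_coframe] structure_eq[OF that])
  have ext: "ext_d sl2_connection x vs = lin_comb (f x) (?s 5) vs *\<^sub>R Y5 + lin_comb (f x) (?s 6) vs *\<^sub>R Y6 + lin_comb (f x) (?s 7) vs *\<^sub>R Y7"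
    unfolding sl2_connection_def[abs_def] ext_d_add[OF sm56 sm] ext_d_add[OF sm sm] by (simp add: d)
  note bil = bilinear_sl2_bracket
  have ew: "wedge (?a i x) (?a j x) = ew (f x) [i, j]" for i j
    using wedge_ew[of "f x" "[i]" "[j]"] by (simp add: ew_singleton del: ew.simps)
  have swap: "ew (f x) [6,5] vs = - ew (f x) [5,6] vs" "ew (f x) [7,6] vs = - ew (f x) [6,7] vs" "ew (f x) [5,7] vs = - ew (f x) [7,5] vs"
    by (rule ew_swap)+
  have rev: "sl2_bracket Y5 Y7 = (- 2 * \<delta>) *\<^sub>R Y6" "sl2_bracket Y6 Y5 = (- 2 * \<delta>) *\<^sub>R Y7" "sl2_bracket Y7 Y6 = (2 * \<delta>) *\<^sub>R Y5"
    using brackets sl2_bracket_anticommute[of Y5 Y7] sl2_bracket_anticommute[of Y6 Y5] sl2_bracket_anticommute[of Y7 Y6] by simp_all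
  have self: "sl2_bracket M M = 0" for M by (simp add: sl2_bracket_def)
  \<comment> \<open>Each pair of basis elements contributes in both orders, hence
    \<open>4 * \<delta>\<close>; the factor 1/2 in \<open>curvature\<close> brings back
    \<open>2 * \<delta>\<close>.\<close>
  have wedge: "wedge_by sl2_bracket (sl2_connection x) (sl2_connection x) vs =
      (- 4 * \<delta> * ew (f x) [6,7] vs) *\<^sub>R Y5 + (4 * \<delta> * ew (f x) [7,5] vs) *\<^sub>R Y6 + (4 * \<delta> * ew (f x) [5,6] vs) *\<^sub>R Y7"
    unfolding sl2_connection_def wedge_by_add_left[OF bil] wedge_by_add_right[OF bil] wedge_by_const[OF bil] ew brackets rev self swap
    by (simp add: vec_eq_iff algebra_simps del: ew.simps)
  show ?thesis
    unfolding curvature_def ext wedge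
    by (simp add: curvature_terms_def lin_comb_append lin_comb_Cons lin_comb_Nil vec_eq_iff algebra_simps del: ew.simps)
qed

lemma sl2_instanton: "g2_instanton sl2 sl2_bracket phi sl2_connection"
  unfolding g2_instanton_def
proof (intro conjI allI)
  fix x vs
  show "wedge_by (\<lambda>F r. r *\<^sub>R F) (curvature sl2_bracket sl2_connection x) (g2_psi phi x) vs = 0"
    unfolding curvature_sl2_connection[abs_def] g2_psi_phi wedge_by_add_left[OF bilinear_scaleR_flip] wedge_by_scaleR_const
      wedge_lin_comb
    by (simp add: wedge_curvature_psi)
qed (rule connection_form_sl2_connection)

lemma heterotic_bianchi:
  assumes "smooth_family \<xi>"
    and curv_\<xi>: "\<And>x vs. curvature u1_bracket \<xi> x vs = lin_comb (f x) [(1, [1,3]), (1, [2,4])] vs *\<^sub>R \<i>"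
    and r: "r = 8 / 3 * \<delta>\<^sup>2 + 2 / 3 * (2 * \<epsilon>1\<^sup>2 + \<epsilon>2\<^sup>2 + \<epsilon>3\<^sup>2)" and s: "s = 1 / (6 * \<delta>\<^sup>2)"
  shows "ext_d (g2_torsion phi) x vs = wedge_by (u1_sl2_pairing r s)
    (curvature u1_sl2_bracket (product_connection \<xi> sl2_connection) x)
    (curvature u1_sl2_bracket (product_connection \<xi> sl2_connection) x) vs"
proof -
  let ?G = "lin_comb (f x) [(1, [1,3]), (1, [2,4])]" and ?F = "\<lambda>i. lin_comb (f x) (curvature_terms \<delta> \<epsilon>1 \<epsilon>2 \<epsilon>3 i)"
  note bil = bilinear_u1_sl2_pairing[of r s]
  have curv: "curvature u1_sl2_bracket (product_connection \<xi> sl2_connection) x =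
      (\<lambda>us. ?G us *\<^sub>R (\<i>, 0) + ?F 5 us *\<^sub>R (0, Y5) + ?F 6 us *\<^sub>R (0, Y6) + ?F 7 us *\<^sub>R (0, Y7))"
    by (simp add: fun_eq_iff curvature_product_connection[OF assms(1) smooth_family_sl2_connection] curv_\<xi> curvature_sl2_connection)
  note trace = trace_Y_offdiagonal[OF Y_basis brackets \<delta>] trace_Y_diagonal[OF Y_basis brackets \<delta>]
  have trace': "trace (Y6 ** Y5) = 0" "trace (Y7 ** Y5) = 0" "trace (Y7 ** Y6) = 0"
    using trace trace_mul_sym[of Y6 Y5] trace_mul_sym[of Y7 Y5] trace_mul_sym[of Y7 Y6] by simp_all
  have zero: "trace (M ** 0) = 0" "trace (0 ** M) = 0" "trace (0 :: real^2^2) = 0" for M :: "real^2^2"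
    by (simp_all add: trace_def matrix_matrix_mult_def)
  have pairing: "u1_sl2_pairing r s (\<i>, 0) (\<i>, 0) = r" "u1_sl2_pairing r s (\<i>, 0) (0, M) = 0"
    "u1_sl2_pairing r s (0, M) (\<i>, 0) = 0" "u1_sl2_pairing r s (0, M) (0, L) = s * trace (M ** L)" for M L
    by (simp_all add: u1_sl2_pairing_def zero)
  \<comment> \<open>The scale s is chosen so that the diagonal traces become the coefficients -1/3,
    1/3, 1/3 of \<open>d_torsion\<close>.\<close>
  have s_\<delta>: "s * (2 * \<delta>\<^sup>2) = 1 / 3" "s * (- 2 * \<delta>\<^sup>2) = - 1 / 3" using \<delta> by (simp_all add: s)
  have "wedge_by (u1_sl2_pairing r s) (curvature u1_sl2_bracket (product_connection \<xi> sl2_connection) x)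
      (curvature u1_sl2_bracket (product_connection \<xi> sl2_connection) x) vs
    = r * wedge ?G ?G vs + 1 / 3 * (- wedge (?F 5) (?F 5) vs + wedge (?F 6) (?F 6) vs + wedge (?F 7) (?F 7) vs)"
    unfolding curv wedge_by_add_left[OF bil] wedge_by_add_right[OF bil] wedge_by_const[OF bil] pairing trace trace' s_\<delta>
    by (simp add: algebra_simps)
  then show ?thesis
    unfolding ext_d_torsion d_torsion wedge_lin_comb r by simp
qed

end

end

section \<open>Pulling forms on the Lie algebra back to the group\<close>

lemma wedge_by_map: "wedge_by h \<alpha> \<beta> (map T vs) = wedge_by h (\<lambda>us. \<alpha> (map T us)) (\<lambda>us. \<beta> (map T us)) vs"
  by (simp add: wedge_by_def nths_map)

lemma oneform_map:
  assumes "blinfun_apply a' = (\<lambda>v. blinfun_apply a (T v))"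
  shows "oneform a (map T vs) = oneform a' vs"
  using assms by (simp add: oneform_def)

lemma ew_map:
  assumes "\<And>i. blinfun_apply (e' i) = (\<lambda>v. blinfun_apply (e i) (T v))"
  shows "ew e I (map T vs) = ew e' I vs"
proof (induction I arbitrary: vs)
  case (Cons i I)
  then show ?case by (simp add: wedge_by_map oneform_map[OF assms])
qed simp

lemma lin_comb_map:
  assumes "\<And>i. blinfun_apply (e' i) = (\<lambda>v. blinfun_apply (e i) (T v))"
  shows "lin_comb e p (map T vs) = lin_comb e' p vs"
  by (simp add: lin_comb_def ew_map[OF assms])

lemma sigma_plus_lin_comb:
  "sigma_plus e 1 = lin_comb e [(1, [1,3]), (- 1, [2,4])]"
  "sigma_plus e 2 = lin_comb e [(- 1, [1,4]), (- 1, [2,3])]"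
  "sigma_plus e 3 = lin_comb e [(1, [1,2]), (1, [3,4])]"
  by (simp_all add: fun_eq_iff sigma_plus_def lin_comb_Cons lin_comb_Nil del: ew.simps)

lemma sigma_minus_lin_comb:
  "sigma_minus e 1 = lin_comb e [(1, [1,3]), (1, [2,4])]"
  "sigma_minus e 2 = lin_comb e [(1, [1,4]), (- 1, [2,3])]"
  "sigma_minus e 3 = lin_comb e [(1, [1,2]), (- 1, [3,4])]"
  by (simp_all add: fun_eq_iff sigma_minus_def lin_comb_Cons lin_comb_Nil del: ew.simps)

text \<open>The Maurer-Cartan equation turns \<open>lie_d br (e i)\<close> into the exterior
  derivative of the pulled-back 1-form, with the same coefficients. The dual frame consists of the
  left-invariant fields through the vectors dual to e.\<close>

lemma g2_moving_coframe_left_invariant: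
  fixes br mul :: "'n::euclidean_space \<Rightarrow> 'n \<Rightarrow> 'n" and e :: "nat \<Rightarrow> ('n \<Rightarrow>\<^sub>L real)"
  assumes dim: "DIM('n) = 7"
    and basis: "dual_basis e 7"
    and de_1_4: "\<And>i vs. i \<in> {1..4} \<Longrightarrow> lie_d br (e i) vs = 0"
    and de_5: "\<And>vs. lie_d br (e 5) vs = \<delta> * sigma_plus e 1 vs + \<epsilon>1 * sigma_minus e 1 vs"
    and de_6: "\<And>vs. lie_d br (e 6) vs = \<delta> * sigma_plus e 2 vs + \<epsilon>2 * sigma_minus e 2 vs"
    and de_7: "\<And>vs. lie_d br (e 7) vs = \<delta> * sigma_plus e 3 vs + \<epsilon>3 * sigma_minus e 3 vs"
    and N: "lie_group_with_algebra br mul iv"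
    and f: "\<And>x i. blinfun_apply (f x i) = (\<lambda>v. blinfun_apply (e i) (mc_form mul iv x v))"
  shows "\<exists>b. g2_moving_coframe f b \<delta> \<epsilon>1 \<epsilon>2 \<epsilon>3"
proof -
  obtain b where b: "\<And>i j. i \<in> {1..7} \<Longrightarrow> j \<in> {1..7} \<Longrightarrow> blinfun_apply (e i) (b j) = (if i = j then 1 else 0)"
    using dual_basis_vectors[of e] basis dim by metis
  have lie_d: "lie_d br (e i) = lin_comb e (structure_terms \<delta> \<epsilon>1 \<epsilon>2 \<epsilon>3 i)" if "i \<in> {1..7}" for i
  proof
    fix vs
    have "i \<in> {1..4} \<or> i = 5 \<or> i = 6 \<or> i = 7" using that by auto
    then consider "i \<in> {1..4}" | "i = 5" | "i = 6" | "i = 7" by blast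
    then show "lie_d br (e i) vs = lin_comb e (structure_terms \<delta> \<epsilon>1 \<epsilon>2 \<epsilon>3 i) vs"
    proof cases
      case 1
      then show ?thesis by (auto simp: de_1_4 structure_terms_def lin_comb_Nil)
    qed (simp_all add: de_5 de_6 de_7 sigma_plus_lin_comb sigma_minus_lin_comb structure_terms_def lin_comb_Cons lin_comb_Nil
        algebra_simps del: ew.simps)
  qed
  have smooth_f: "smooth (\<lambda>x. blinfun_apply (f x i) v)" for i v
    unfolding f by (rule smooth_bounded_linear_compose[OF blinfun.bounded_linear_right smooth_mc_form[OF N]])
  have "ext_d (\<lambda>y. oneform (f y i)) x vs = lin_comb (f x) (structure_terms \<delta> \<epsilon>1 \<epsilon>2 \<epsilon>3 i) vs" if i: "i \<in> {1..7}" for i x vs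
  proof (cases "length vs = 2")
    case True
    then obtain u v where vs: "vs = [u, v]" by (auto simp: length_Suc_conv numeral_2_eq_2)
    have fd: "frechet_derivative (\<lambda>y. blinfun_apply (f y i) w) (at x) =
        (\<lambda>z. blinfun_apply (e i) (frechet_derivative (\<lambda>y. mc_form mul iv y w) (at x) z))" for w
      unfolding f
      by (rule frechet_derivative_bounded_linear[OF blinfun.bounded_linear_right smooth_differentiable[OF smooth_mc_form[OF N]]])
    have "ext_d (\<lambda>y. oneform (f y i)) x vs = lie_d br (e i) (map (mc_form mul iv x) vs)"
      using arg_cong[OF maurer_cartan[OF N, of v x u], of "blinfun_apply (e i)"]
      by (simp add: vs ext_d_def oneform_def fd lie_d_def blinfun.diff_right blinfun.minus_right)
    also have "\<dots> = lin_comb (f x) (structure_terms \<delta> \<epsilon>1 \<epsilon>2 \<epsilon>3 i) vs"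
      unfolding lie_d[OF i] by (rule lin_comb_map[OF f])
    finally show ?thesis .
  next
    case False
    have "homogeneous (Suc 1) (ext_d (\<lambda>y. oneform (f y i)) x)" by (rule homogeneous_ext_d[OF homogeneous_oneform])
    moreover have "homogeneous 2 (lin_comb (f x) (structure_terms \<delta> \<epsilon>1 \<epsilon>2 \<epsilon>3 i))"
      by (rule homogeneous_lin_comb) (auto simp: homogeneous_terms_def structure_terms_def)
    ultimately show ?thesis using False by (simp add: homogeneous_def numeral_2_eq_2 One_nat_def)
  qed
  then have "g2_moving_coframe f (\<lambda>x j. left_field mul (b j) x) \<delta> \<epsilon>1 \<epsilon>2 \<epsilon>3"
    using dim b smooth_f by unfold_locales (auto simp: f mc_form_left_field[OF N])
  then show ?thesis by blast
qed

theorem proposition3p11: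
  fixes br :: "'n::euclidean_space \<Rightarrow> 'n \<Rightarrow> 'n"
    and mul :: "'n \<Rightarrow> 'n \<Rightarrow> 'n" and iv :: "'n \<Rightarrow> 'n"
    and e :: "nat \<Rightarrow> ('n \<Rightarrow>\<^sub>L real)"
    and \<delta> \<epsilon>1 \<epsilon>2 \<epsilon>3 :: real
    and Y5 Y6 Y7 :: "real^2^2"
    and \<phi> :: "'n \<Rightarrow> ('n, real) form"
    and A :: "'n \<Rightarrow> ('n, real^2^2) form"
  assumes dim: "DIM('n) = 7"
    and nilpotent: "nilpotent_lie_algebra br"
    and basis: "dual_basis e 7"
    and de_1_4: "\<And>i vs. i \<in> {1..4} \<Longrightarrow> lie_d br (e i) vs = 0"
    and de_5: "\<And>vs. lie_d br (e 5) vs = \<delta> * sigma_plus e 1 vs + \<epsilon>1 * sigma_minus e 1 vs"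
    and de_6: "\<And>vs. lie_d br (e 6) vs = \<delta> * sigma_plus e 2 vs + \<epsilon>2 * sigma_minus e 2 vs"
    and de_7: "\<And>vs. lie_d br (e 7) vs = \<delta> * sigma_plus e 3 vs + \<epsilon>3 * sigma_minus e 3 vs"
    and delta: "\<delta> \<noteq> 0"
    and N: "lie_group_with_algebra br mul iv"
    and phi: "\<phi> = left_invariant mul iv (\<lambda>vs.
        wedge (sigma_plus e 1) (oneform (e 5)) vs
      - wedge (sigma_plus e 2) (oneform (e 6)) vs
      - wedge (sigma_plus e 3) (oneform (e 7)) vs
      + ew e [5,6,7] vs)"
    and Y_basis: "distinct [Y5, Y6, Y7]" "independent {Y5, Y6, Y7}" "span {Y5, Y6, Y7} = sl2"
    and Y_brackets: "sl2_bracket Y6 Y7 = (- 2 * \<delta>) *\<^sub>R Y5"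
      "sl2_bracket Y7 Y5 = (2 * \<delta>) *\<^sub>R Y6"
      "sl2_bracket Y5 Y6 = (2 * \<delta>) *\<^sub>R Y7"
    and A: "A = left_invariant mul iv (\<lambda>vs.
        oneform (e 5) vs *\<^sub>R Y5 + oneform (e 6) vs *\<^sub>R Y6 + oneform (e 7) vs *\<^sub>R Y7)"
  shows "g2_structure \<phi> \<and> g2_coclosed \<phi> \<and> (\<forall>x. g2_tau0 \<phi> x \<noteq> 0) \<and>
    g2_instanton sl2 sl2_bracket \<phi> A \<and>
    (\<exists>\<xi>. g2_instanton u1 u1_bracket \<phi> \<xi> \<and>
      (\<exists>B. ad_invariant_pairing (u1 \<times> sl2) u1_sl2_bracket B \<and>
        (\<forall>x vs. ext_d (g2_torsion \<phi>) x vs =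
          wedge_by B
            (curvature u1_sl2_bracket (product_connection \<xi> A) x)
            (curvature u1_sl2_bracket (product_connection \<xi> A) x) vs)))"
proof -
  define f where "f x i = blinfun_compose (e i) (Blinfun (mc_form mul iv x))" for x i
  have f: "blinfun_apply (f x i) = (\<lambda>v. blinfun_apply (e i) (mc_form mul iv x v))" for x i
    using bounded_linear_Blinfun_apply[OF linear_conv_bounded_linear[THEN iffD1, OF linear_mc_form[OF N]]]
    by (simp add: f_def fun_eq_iff)
  obtain b where "g2_moving_coframe f b \<delta> \<epsilon>1 \<epsilon>2 \<epsilon>3"
    using g2_moving_coframe_left_invariant[OF dim basis de_1_4 de_5 de_6 de_7 N f] by blast
  then interpret g2_moving_coframe f b \<delta> \<epsilon>1 \<epsilon>2 \<epsilon>3 .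
  have left_invariant: "left_invariant mul iv \<omega> x vs = \<omega> (map (mc_form mul iv x) vs)"
    for \<omega> :: "('n, 'c) form" and x vs
    by (simp add: left_invariant_def mc_form_def)
  have oneform: "oneform (e i) = lin_comb e [(1, [i])]" for i
    by (simp add: fun_eq_iff lin_comb_Cons lin_comb_Nil ew_singleton del: ew.simps)
  have "(\<lambda>vs. wedge (sigma_plus e 1) (oneform (e 5)) vs - wedge (sigma_plus e 2) (oneform (e 6)) vs
      - wedge (sigma_plus e 3) (oneform (e 7)) vs + ew e [5,6,7] vs) = lin_comb e phi_terms"
    unfolding sigma_plus_lin_comb oneform wedge_lin_comb
    by (simp add: fun_eq_iff wedge_terms_def phi_terms_def lin_comb_Cons lin_comb_Nil del: ew.simps)
  then have phi': "\<phi> = (\<lambda>x. lin_comb (f x) phi_terms)"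
    unfolding phi by (simp add: fun_eq_iff left_invariant lin_comb_map[OF f])
  have A': "A = sl2_connection Y5 Y6 Y7"
    unfolding A by (simp add: fun_eq_iff left_invariant sl2_connection_def[OF Y_basis(2,3) Y_brackets delta] oneform_map[OF f])
  obtain \<xi> where \<xi>: "g2_instanton u1 u1_bracket \<phi> \<xi>" "smooth_family \<xi>"
    "\<And>x vs. curvature u1_bracket \<xi> x vs = lin_comb (f x) [(1, [1,3]), (1, [2,4])] vs *\<^sub>R \<i>"
    unfolding phi' by (rule u1_instanton) blast
  define r where "r = 8 / 3 * \<delta>\<^sup>2 + 2 / 3 * (2 * \<epsilon>1\<^sup>2 + \<epsilon>2\<^sup>2 + \<epsilon>3\<^sup>2)"
  define s where "s = 1 / (6 * \<delta>\<^sup>2)"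
  \<comment> \<open>The summand with \<delta> keeps r away from zero even if all the \<epsilon>
    vanish, so the pairing is nondegenerate on u(1).\<close>
  have "r > 0" unfolding r_def using delta by (intro add_pos_nonneg) auto
  then have "ad_invariant_pairing (u1 \<times> sl2) u1_sl2_bracket (u1_sl2_pairing r s)"
    using delta by (intro ad_invariant_u1_sl2_pairing) (auto simp: s_def)
  moreover have "\<forall>x vs. ext_d (g2_torsion \<phi>) x vs = wedge_by (u1_sl2_pairing r s)
      (curvature u1_sl2_bracket (product_connection \<xi> A) x) (curvature u1_sl2_bracket (product_connection \<xi> A) x) vs"
    unfolding phi' A' using heterotic_bianchi[OF Y_basis(2,3) Y_brackets delta \<xi>(2,3) r_def s_def] by blast
  moreover have "g2_instanton sl2 sl2_bracket \<phi> A"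
    unfolding phi' A' by (rule sl2_instanton[OF Y_basis(2,3) Y_brackets delta])
  ultimately show ?thesis
    using \<xi>(1) g2_structure_phi g2_coclosed_phi g2_tau0_phi delta unfolding phi' by auto
qed

end
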